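(* Let $n\geq 3$, let $K$ be an integral domain, and let $G$ be the general linear group ${\rm GL}_n(K)$ or the special linear group ${\rm SL}_n(K)$. If $K$ contains the ring of integers $\mathbb{Z}$ as a subring and the group ${\rm Aut}(K)$ of ring automorphisms of $K$ is a torsion group (every element has finite order), then $G$ possesses the $R_\infty$-property.
   Context: An integral domain is a commutative ring with unit element and without zero divisors. Twisted conjugacy: for a group $G$ and an automorphism $\varphi:G\to G$, elements $x,y\in G$ are $\varphi$-conjugated if there is $c\in G$ with $x=c\,y\,\varphi(c^{-1})$. This is an equivalence relation, whose classes are the $\varphi$-conjugacy classes; their number $R(\varphi)$ is the Reidemeister number of $\varphi$. The group $G$ possesses the $R_\infty$-property if $R(\varphi)$ is infinite for every automorphism $\varphi$ of $G$. *)

theory Defs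
  imports
    "HOL-Algebra.Group"
    "HOL-Library.Extended_Nat"
    "Jordan_Normal_Form.Determinant"
begin

definition twisted_conj_rel :: "('g, 'm) monoid_scheme \<Rightarrow> ('g \<Rightarrow> 'g) \<Rightarrow> ('g \<times> 'g) set" where
  "twisted_conj_rel G \<phi> =
    {(x, y) \<in> carrier G \<times> carrier G.
      \<exists>c\<in>carrier G. x = c \<otimes>\<^bsub>G\<^esub> y \<otimes>\<^bsub>G\<^esub> \<phi> (inv\<^bsub>G\<^esub> c)}"

definition twisted_conj_classes :: "('g, 'm) monoid_scheme \<Rightarrow> ('g \<Rightarrow> 'g) \<Rightarrow> 'g set set" where
  "twisted_conj_classes G \<phi> = carrier G // twisted_conj_rel G \<phi>"

definition reidemeister_number :: "('g, 'm) monoid_scheme \<Rightarrow> ('g \<Rightarrow> 'g) \<Rightarrow> enat" where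
  "reidemeister_number G \<phi> =
    (if finite (twisted_conj_classes G \<phi>) then enat (card (twisted_conj_classes G \<phi>)) else \<infinity>)"

definition R_infinity_property :: "('g, 'm) monoid_scheme \<Rightarrow> bool" where
  "R_infinity_property G \<longleftrightarrow> (\<forall>\<phi>\<in>iso G G. reidemeister_number G \<phi> = \<infinity>)"

lemma (in group) equiv_twisted_conj_rel:
  assumes "\<phi> \<in> hom G G"
  shows "equiv (carrier G) (twisted_conj_rel G \<phi>)"
proof -
  interpret \<phi>: group_hom G G \<phi>
    using assms by (unfold_locales) auto
  show ?thesis
  proof (rule equivI)
    show "twisted_conj_rel G \<phi> \<subseteq> carrier G \<times> carrier G"
      by (auto simp: twisted_conj_rel_def)
    show "refl_on (carrier G) (twisted_conj_rel G \<phi>)"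
      by (auto simp: refl_on_def twisted_conj_rel_def intro!: bexI[of _ \<one>])
    show "sym (twisted_conj_rel G \<phi>)"
    proof (rule symI)
      fix x y assume "(x, y) \<in> twisted_conj_rel G \<phi>"
      then obtain c where c: "c \<in> carrier G" "y \<in> carrier G" "x = c \<otimes> y \<otimes> \<phi> (inv c)"
        by (auto simp: twisted_conj_rel_def)
      have "y = inv c \<otimes> x \<otimes> \<phi> (inv (inv c))"
        using c by (simp add: m_assoc[symmetric]) (simp add: m_assoc)
      then show "(y, x) \<in> twisted_conj_rel G \<phi>"
        using c by (auto simp: twisted_conj_rel_def intro!: bexI[of _ "inv c"])
    qed
    show "trans (twisted_conj_rel G \<phi>)"
    proof (rule transI)
      fix x y z
      assume "(x, y) \<in> twisted_conj_rel G \<phi>" "(y, z) \<in> twisted_conj_rel G \<phi>"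
      then obtain c d where cd: "c \<in> carrier G" "d \<in> carrier G" "z \<in> carrier G"
        "y = d \<otimes> z \<otimes> \<phi> (inv d)" "x = c \<otimes> y \<otimes> \<phi> (inv c)"
        by (auto simp: twisted_conj_rel_def)
      have "x = (c \<otimes> d) \<otimes> z \<otimes> \<phi> (inv (c \<otimes> d))"
        using cd by (simp add: m_assoc inv_mult_group)
      then show "(x, z) \<in> twisted_conj_rel G \<phi>"
        using cd by (auto simp: twisted_conj_rel_def intro!: bexI[of _ "c \<otimes> d"])
    qed
  qed
qed

definition torsion_group :: "('g, 'm) monoid_scheme \<Rightarrow> bool" where
  "torsion_group G \<longleftrightarrow> group G \<and> (\<forall>x\<in>carrier G. \<exists>m::nat. m > 0 \<and> x [^]\<^bsub>G\<^esub> m = \<one>\<^bsub>G\<^esub>)"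

definition ring_Aut :: "'a::ring_1 itself \<Rightarrow> ('a \<Rightarrow> 'a) monoid" where
  "ring_Aut _ = \<lparr>carrier = {\<sigma>. ring_isom \<sigma>}, mult = (\<circ>), one = id\<rparr>"

lemma ring_isom_iff:
  "ring_isom (\<sigma> :: 'a::ring_1 \<Rightarrow> 'a) \<longleftrightarrow>
    bij \<sigma> \<and> \<sigma> 1 = 1 \<and> (\<forall>x y. \<sigma> (x + y) = \<sigma> x + \<sigma> y) \<and> (\<forall>x y. \<sigma> (x * y) = \<sigma> x * \<sigma> y)"
proof
  assume "ring_isom \<sigma>"
  then interpret ring_isom \<sigma> .
  show "bij \<sigma> \<and> \<sigma> 1 = 1 \<and> (\<forall>x y. \<sigma> (x + y) = \<sigma> x + \<sigma> y) \<and> (\<forall>x y. \<sigma> (x * y) = \<sigma> x * \<sigma> y)"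
    by (simp add: bij hom_add hom_mult)
next
  assume *: "bij \<sigma> \<and> \<sigma> 1 = 1 \<and> (\<forall>x y. \<sigma> (x + y) = \<sigma> x + \<sigma> y) \<and> (\<forall>x y. \<sigma> (x * y) = \<sigma> x * \<sigma> y)"
  then have z: "\<sigma> 0 = 0"
    by (metis add_cancel_left_left add_0)
  show "ring_isom \<sigma>"
    using * z by unfold_locales (auto dest: bij_is_surj, metis bij_is_inj injD)
qed

lemma group_ring_Aut: "group (ring_Aut TYPE('a::ring_1))"
proof (rule groupI)
  fix \<sigma> :: "'a \<Rightarrow> 'a" assume "\<sigma> \<in> carrier (ring_Aut TYPE('a))"
  then have s: "bij \<sigma>" "\<sigma> 1 = 1" "\<And>x y. \<sigma> (x + y) = \<sigma> x + \<sigma> y" "\<And>x y. \<sigma> (x * y) = \<sigma> x * \<sigma> y"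
    by (auto simp: ring_Aut_def ring_isom_iff)
  define \<tau> where "\<tau> = inv_into UNIV \<sigma>"
  have i: "\<tau> x = y \<longleftrightarrow> x = \<sigma> y" for x y
    using s(1) unfolding \<tau>_def by (metis bij_inv_eq_iff)
  have "\<sigma> (\<tau> x) = x" for x
    using i by metis
  moreover have "bij \<tau>"
    using s(1) unfolding \<tau>_def by (rule bij_imp_bij_inv)
  ultimately have "ring_isom \<tau>"
    unfolding ring_isom_iff using s by (simp add: i)
  moreover have "\<tau> \<circ> \<sigma> = id"
    by (auto simp: fun_eq_iff i)
  ultimately show "\<exists>\<tau>\<in>carrier (ring_Aut TYPE('a)). \<tau> \<otimes>\<^bsub>ring_Aut TYPE('a)\<^esub> \<sigma> = \<one>\<^bsub>ring_Aut TYPE('a)\<^esub>"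
    by (auto simp: ring_Aut_def)
qed (auto simp: ring_Aut_def ring_isom_iff bij_comp o_assoc)

definition GL :: "nat \<Rightarrow> 'a::comm_ring_1 mat monoid" where
  "GL n = units_of (ring_mat TYPE('a) n ())"

definition SL :: "nat \<Rightarrow> 'a::comm_ring_1 mat monoid" where
  "SL n = (GL n)\<lparr>carrier := {A \<in> carrier_mat n n. det A = 1}\<rparr>"

lemma carrier_GL:
  "carrier (GL n :: 'a::comm_ring_1 mat monoid) = {A \<in> carrier_mat n n. invertible_mat A}"
proof (rule Set.set_eqI)
  fix A :: "'a mat"
  have dims: "B \<in> carrier_mat n n"
    if "A \<in> carrier_mat n n" "A * B = 1\<^sub>m n" "B * A = 1\<^sub>m (dim_row B)" for B
  proof -
    have "dim_col B = n"
      using arg_cong[OF that(2), of dim_col] by simp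
    moreover have "dim_row B = n"
      using arg_cong[OF that(3), of dim_col] that(1) by simp
    ultimately show ?thesis
      by (intro carrier_matI)
  qed
  have "A \<in> carrier (GL n) \<longleftrightarrow>
      A \<in> carrier_mat n n \<and> (\<exists>B\<in>carrier_mat n n. B * A = 1\<^sub>m n \<and> A * B = 1\<^sub>m n)"
    by (simp add: GL_def units_of_def Units_def ring_mat_simps)
  also have "\<dots> \<longleftrightarrow> A \<in> carrier_mat n n \<and> (\<exists>B. A * B = 1\<^sub>m n \<and> B * A = 1\<^sub>m (dim_row B))"
    using dims by (metis carrier_matD(1))
  also have "\<dots> \<longleftrightarrow> A \<in> {A \<in> carrier_mat n n. invertible_mat A}"
    by (auto simp: invertible_mat_def inverts_mat_def)
  finally show "A \<in> carrier (GL n) \<longleftrightarrow> A \<in> {A \<in> carrier_mat n n. invertible_mat A}" .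
qed

lemma group_GL: "group (GL n :: 'a::comm_ring_1 mat monoid)"
proof -
  interpret ring "ring_mat TYPE('a) n ()" by (rule ring_mat)
  show ?thesis unfolding GL_def by (rule units_group)
qed

lemma SL_subgroup_GL: "subgroup (carrier (SL n)) (GL n :: 'a::comm_ring_1 mat monoid)"
proof -
  interpret group "GL n :: 'a mat monoid" by (rule group_GL)
  have mult: "mult (GL n :: 'a mat monoid) = (*)" and one: "one (GL n :: 'a mat monoid) = 1\<^sub>m n"
    by (simp_all add: GL_def units_of_def ring_mat_simps)
  have sub: "A \<in> carrier (GL n)" if A: "A \<in> carrier_mat n n" "det A = 1" for A :: "'a mat"
  proof -
    have "A * adj_mat A = 1\<^sub>m n" "adj_mat A * A = 1\<^sub>m n" "adj_mat A \<in> carrier_mat n n"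
      using adj_mat[OF A(1)] A(2) by (simp_all, auto)
    then show ?thesis
      using A by (auto simp: carrier_GL invertible_mat_def inverts_mat_def intro!: exI[of _ "adj_mat A"])
  qed
  show ?thesis
  proof (rule subgroupI)
    fix A :: "'a mat" assume "A \<in> carrier (SL n)"
    then have A: "A \<in> carrier_mat n n" "det A = 1" by (auto simp: SL_def)
    have iA: "inv\<^bsub>GL n\<^esub> A \<in> carrier_mat n n"
      using inv_closed[OF sub[OF A]] by (simp add: carrier_GL)
    have "inv\<^bsub>GL n\<^esub> A * A = 1\<^sub>m n"
      using l_inv[OF sub[OF A]] by (simp add: mult one)
    then have "det (inv\<^bsub>GL n\<^esub> A) * det A = 1"
      using det_mult[OF iA A(1)] by simp
    with A iA show "inv\<^bsub>GL n\<^esub> A \<in> carrier (SL n)" by (simp add: SL_def)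
  qed (auto simp: SL_def sub mult det_mult intro!: exI[of _ "1\<^sub>m n"])
qed

lemma group_SL: "group (SL n :: 'a::comm_ring_1 mat monoid)"
  using subgroup.subgroup_is_group[OF SL_subgroup_GL group_GL] by (simp add: SL_def)

end

theory Submission
  imports Defs
begin

text \<open>
  Let \<open>K\<close> be the given domain, \<open>F\<close> its field of fractions, and \<open>\<phi>\<close> an automorphism of \<open>G\<close>.
  Write \<open>E(i, j)\<close> for the matrix units.  The proof first describes \<open>\<phi>\<close> and then
  separates infinitely many twisted classes by a trace.

  Rigidity (\<open>faithful_rep_standard\<close>).  An injective homomorphism \<open>\<rho>\<close> from \<open>SL\<^sub>n(K)\<close> to \<open>n \<times> n\<close>
  matrices over a field of characteristic other than 2 is, on elementary matrices, either
  \<open>1 + a E(i, j) \<mapsto> g (1 + c(a) E(i, j)) g'\<close> with \<open>c\<close> a ring homomorphism and \<open>g' = g\<^sup>-\<^sup>1\<close>, or the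
  inverse transpose of such a map.  The diagonal matrices of determinant 1 with entries \<open>\<plusminus>1\<close> go to commuting
  involutions, so in a suitable basis they act by \<open>n\<close> sign characters, one for each basis vector.  Since
  these matrices conjugate \<open>1 + a E(i, j)\<close> to \<open>1 \<plusminus> a E(i, j)\<close>, the image of \<open>1 + a E(i, j)\<close> can have
  a nonzero entry in an off-diagonal place \<open>(k, l)\<close> only if the product of the characters \<open>k\<close> and \<open>l\<close>
  is the character by which they act on \<open>E(i, j)\<close>.  Counting pairs shows that every
  \<open>{i, j}\<close> owns exactly one \<open>{k, l}\<close> if \<open>n \<noteq> 4\<close>.  For \<open>n = 4\<close> complementary pairs have
  the same character, and a commutation argument replaces the count
  (\<open>single_pair\<close>).  Hence the image of \<open>1 + 4 E(i, j)\<close> differs from the identity in one \<open>2 \<times> 2\<close>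
  block only, and the commutation relations in the first row and the first column turn these blocks into
  transvections \<open>1 + q E(\<pi> i, \<pi> j)\<close> for a permutation \<open>\<pi>\<close>, or into their transposes
  (\<open>row_or_col_pair\<close>, \<open>row_case\<close>).  The image of a general \<open>1 + a E(i, j)\<close> is then
  found from what it commutes with.

  Automorphisms (\<open>standard_exists\<close>, \<open>standard_up_to_scalar\<close>).  Traces show that for \<open>\<rho> = \<phi>\<close> the map
  \<open>c\<close> takes values in \<open>K\<close>, so it is a ring endomorphism \<open>\<sigma>\<close> of \<open>K\<close>.  Conjugation by \<open>G\<close> preserves the
  group generated by the elementary matrices, because every transvection \<open>1 + u v\<^sup>T\<close> with \<open>v \<cdot> u = 0\<close>
  and \<open>u\<close> unimodular lies in it (\<open>transvection_elementary\<close>, an argument of Suslin).  A matrix that commutes with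
  all elementary matrices is scalar, so the description of \<open>\<phi>\<close> extends to \<open>G\<close> up to scalar factors.
  The trace formula makes \<open>\<phi> \<mapsto> \<sigma>\<close> multiplicative.  Therefore \<open>\<sigma>\<close> is an automorphism, it has
  finite order by hypothesis, and some power \<open>\<phi>\<^sup>L\<close> is conjugation by a matrix \<open>h\<close> over \<open>F\<close>, up to
  scalars (\<open>inner_power_exists\<close>).

  Separation (\<open>class_invariant\<close>, \<open>reidemeister_infinite\<close>).  Put
  \<open>N(x) = x \<phi>(x) \<dots> \<phi>\<^sup>L\<^sup>-\<^sup>1(x)\<close>.  If \<open>x = c y \<phi>(c\<^sup>-\<^sup>1)\<close> then \<open>N(x) = c N(y) \<phi>\<^sup>L(c\<^sup>-\<^sup>1)\<close>, so \<open>N(x) h\<close> is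
  conjugate to a scalar multiple of \<open>N(y) h\<close>.  If \<open>x\<close> and \<open>y\<close> are products of elementary matrices,
  comparing determinants shows that the scalar is an \<open>n\<close>-th root of unity, and the \<open>n\<close>-th power of the
  trace of \<open>N(x) h\<close> depends on the twisted class only.  Along \<open>x\<^sub>t = y (1 + t E(0, 1))\<close> with \<open>t \<in> \<int>\<close> this trace is a
  polynomial in \<open>t\<close> whose coefficient at \<open>t\<^sup>L\<close> is a product of \<open>L\<close> nonzero linear forms,
  each evaluated at the column 0 of \<open>y\<close> or at the row 1 of \<open>y\<^sup>-\<^sup>1\<close>.  An integral matrix \<open>y\<close> for which no
  factor vanishes gives a polynomial of degree \<open>L\<close>, which takes infinitely many values.
\<close>

section \<open>Elementary matrices, rank one perturbations of the identity and sign matrices\<close>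

text \<open>Entries of products are rewritten below by sums over an index range, or by the formulas for special factors; the default expansion into scalar products of rows and columns would get in the way.\<close>

declare index_mult_mat(1) [simp del]

lemma mult_carrier_square [simp]:
  "A \<in> carrier_mat n n \<Longrightarrow> B \<in> carrier_mat n n \<Longrightarrow> A * B \<in> carrier_mat n n"
  by simp

lemma index_mult_mat_sum:
  assumes "A \<in> carrier_mat n n" "B \<in> carrier_mat n n" "i < n" "j < n"
  shows "(A * B) $$ (i, j) = (\<Sum>k<n. A $$ (i, k) * B $$ (k, j))"
  using assms by (auto simp: index_mult_mat(1) scalar_prod_def lessThan_atLeast0)

lemma sum_supp_one:
  fixes f :: "nat \<Rightarrow> 'b::comm_monoid_add"
  assumes "a < n" "\<And>m. m < n \<Longrightarrow> m \<noteq> a \<Longrightarrow> f m = 0"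
  shows "(\<Sum>m<n. f m) = f a"
proof -
  have "(\<Sum>m<n. f m) = (\<Sum>m\<in>{a}. f m)"
    using assms by (intro sum.mono_neutral_right) auto
  then show ?thesis by simp
qed

lemma sum_supp_two:
  fixes f :: "nat \<Rightarrow> 'b::comm_monoid_add"
  assumes "a < n" "b < n" "a \<noteq> b" "\<And>m. m < n \<Longrightarrow> m \<noteq> a \<Longrightarrow> m \<noteq> b \<Longrightarrow> f m = 0"
  shows "(\<Sum>m<n. f m) = f a + f b"
proof -
  have "(\<Sum>m<n. f m) = (\<Sum>m\<in>{a, b}. f m)"
    using assms by (intro sum.mono_neutral_right) auto
  then show ?thesis using assms(3) by simp
qed

text \<open>The matrix \<open>1 + u v\<^sup>T\<close>, a rank one perturbation of the identity; it is a transvection if \<open>v \<cdot> u = 0\<close>.\<close>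

definition dyadic :: "nat \<Rightarrow> (nat \<Rightarrow> 'a::comm_ring_1) \<Rightarrow> (nat \<Rightarrow> 'a) \<Rightarrow> 'a mat" where
  "dyadic n u v = mat n n (\<lambda>(k, l). (if k = l then 1 else 0) + u k * v l)"

definition elem :: "nat \<Rightarrow> nat \<Rightarrow> nat \<Rightarrow> 'a::comm_ring_1 \<Rightarrow> 'a mat" where
  "elem n i j a = mat n n (\<lambda>(k, l). (if k = l then 1 else 0) + (if k = i \<and> l = j then a else 0))"

lemma dyadic_carrier [simp]: "dyadic n u v \<in> carrier_mat n n"
  and dyadic_dim [simp]: "dim_row (dyadic n u v) = n" "dim_col (dyadic n u v) = n"
  and dyadic_index: "k < n \<Longrightarrow> l < n \<Longrightarrow> dyadic n u v $$ (k, l) = (if k = l then 1 else 0) + u k * v l"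
  by (simp_all add: dyadic_def)

lemma elem_carrier [simp]: "elem n i j a \<in> carrier_mat n n"
  and elem_dim [simp]: "dim_row (elem n i j a) = n" "dim_col (elem n i j a) = n"
  and elem_index: "k < n \<Longrightarrow> l < n \<Longrightarrow>
    elem n i j a $$ (k, l) = (if k = l then 1 else 0) + (if k = i \<and> l = j then a else 0)"
  by (simp_all add: elem_def)

lemma elem_eq_dyadic: "elem n i j a = dyadic n (\<lambda>k. if k = i then 1 else 0) (\<lambda>l. if l = j then a else 0)"
  by (rule eq_matI) (auto simp: elem_index dyadic_index)

lemma sum_delta_left:
  fixes A :: "nat \<Rightarrow> 'a::comm_ring_1"
  assumes "k < n"
  shows "(\<Sum>m<n. ((if k = m then 1 else 0) + c * f m) * A m) = A k + c * (\<Sum>m<n. f m * A m)"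
proof -
  have "(\<Sum>m<n. ((if k = m then 1 else 0) + c * f m) * A m)
      = (\<Sum>m<n. (if k = m then A m else 0) + c * (f m * A m))"
    by (rule sum.cong) (auto simp: algebra_simps)
  then show ?thesis using assms by (simp add: sum.distrib sum_distrib_left)
qed

lemma dyadic_mult_index:
  assumes A: "A \<in> carrier_mat n n" and "k < n" "l < n"
  shows "(dyadic n u v * A) $$ (k, l) = A $$ (k, l) + u k * (\<Sum>m<n. v m * A $$ (m, l))"
  using assms by (simp only: index_mult_mat_sum[OF dyadic_carrier A]) (simp add: dyadic_index sum_delta_left)

lemma mult_dyadic_index:
  assumes A: "A \<in> carrier_mat n n" and "k < n" "l < n"
  shows "(A * dyadic n u v) $$ (k, l) = A $$ (k, l) + (\<Sum>m<n. A $$ (k, m) * u m) * v l"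
proof -
  have "(A * dyadic n u v) $$ (k, l) = (\<Sum>m<n. ((if l = m then 1 else 0) + v l * u m) * A $$ (k, m))"
    using assms by (subst index_mult_mat_sum[OF A dyadic_carrier])
      (auto simp: dyadic_index algebra_simps intro!: sum.cong)
  also have "\<dots> = A $$ (k, l) + v l * (\<Sum>m<n. u m * A $$ (k, m))"
    using assms by (subst sum_delta_left) auto
  finally show ?thesis by (simp add: mult.commute)
qed

lemma elem_mult_index:
  assumes A: "A \<in> carrier_mat n n" and "k < n" "l < n" "j < n"
  shows "(elem n i j a * A) $$ (k, l) = A $$ (k, l) + (if k = i then a * A $$ (j, l) else 0)"
proof -
  have "(\<Sum>m<n. (if m = j then a else 0) * A $$ (m, l)) = (\<Sum>m<n. if m = j then a * A $$ (m, l) else 0)"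
    by (rule sum.cong) auto
  also have "\<dots> = a * A $$ (j, l)" using assms by simp
  finally show ?thesis unfolding elem_eq_dyadic dyadic_mult_index[OF assms(1-3)] by simp
qed

lemma mult_elem_index:
  assumes A: "A \<in> carrier_mat n n" and "k < n" "l < n" "i < n"
  shows "(A * elem n i j a) $$ (k, l) = A $$ (k, l) + (if l = j then A $$ (k, i) * a else 0)"
proof -
  have "(\<Sum>m<n. A $$ (k, m) * (if m = i then 1 else 0)) = (\<Sum>m<n. if m = i then A $$ (k, m) else 0)"
    by (rule sum.cong) auto
  also have "\<dots> = A $$ (k, i)" using assms by simp
  finally have "(\<Sum>m<n. A $$ (k, m) * (if m = i then 1 else 0)) = A $$ (k, i)" .
  then show ?thesis unfolding elem_eq_dyadic mult_dyadic_index[OF assms(1-3)] by simp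
qed

lemma elem_0 [simp]: "elem n i j 0 = 1\<^sub>m n"
  by (rule eq_matI) (auto simp: elem_index)

lemma elem_inj:
  assumes "i < n" "j < n" "elem n i j a = elem n i j b" shows "a = b"
proof -
  have "elem n i j a $$ (i, j) = elem n i j b $$ (i, j)" by (simp only: assms(3))
  then show ?thesis using assms(1,2) by (simp add: elem_index)
qed

lemma elem_add:
  assumes "i < n" "j < n" "i \<noteq> j"
  shows "elem n i j a * elem n i j b = elem n i j (a + b)"
  by (rule eq_matI) (use assms in \<open>auto simp: elem_mult_index elem_index\<close>)

lemma elem_inverse:
  assumes "i < n" "j < n" "i \<noteq> j"
  shows "elem n i j a * elem n i j (- a) = 1\<^sub>m n" "elem n i j (- a) * elem n i j a = 1\<^sub>m n"
  using assms by (simp_all add: elem_add)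

lemma elem_commute:
  assumes "i < n" "j < n" "k < n" "l < n" "j \<noteq> k" "i \<noteq> l"
  shows "elem n i j a * elem n k l b = elem n k l b * elem n i j a"
  by (rule eq_matI) (use assms in \<open>auto simp: elem_mult_index elem_index\<close>)

lemma elem_commutator:
  assumes "i < n" "j < n" "k < n" "i \<noteq> j" "j \<noteq> k" "i \<noteq> k"
  shows "elem n i j a * elem n j k b = elem n i k (a * b) * (elem n j k b * elem n i j a)"
  by (rule eq_matI) (use assms in \<open>auto simp: elem_mult_index elem_index\<close>)

lemma elem_not_commute:
  assumes "i < n" "j < n" "k < n" "i \<noteq> j" "j \<noteq> k" "a * b \<noteq> 0"
  shows "elem n i j a * elem n j k b \<noteq> elem n j k b * elem n i j a"
proof
  assume "elem n i j a * elem n j k b = elem n j k b * elem n i j a"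
  then have "(elem n i j a * elem n j k b) $$ (i, k) = (elem n j k b * elem n i j a) $$ (i, k)"
    by simp
  then show False
    using assms by (auto simp: elem_mult_index elem_index split: if_splits)
qed

lemma transpose_elem: "transpose_mat (elem n i j a) = elem n j i a"
  by (rule eq_matI) (auto simp: elem_index)

lemma det_elem:
  assumes "i < n" "j < n" "i \<noteq> j"
  shows "det (elem n i j a) = 1"
proof -
  have "elem n i j a = addrow_mat n a i j"
    using assms by (intro eq_matI) (auto simp: elem_index)
  then show ?thesis using det_addrow_mat[of i j n a] assms by simp
qed

text \<open>The determinant one matrices as a bare set, since representations are studied on them before any group structure is needed.\<close>

definition special :: "nat \<Rightarrow> 'a::comm_ring_1 mat set" where
  "special n = {A \<in> carrier_mat n n. det A = 1}"

lemma special_mult [simp]: "A \<in> special n \<Longrightarrow> B \<in> special n \<Longrightarrow> A * B \<in> special n"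
  by (simp add: special_def det_mult[of _ n])

lemma special_one [simp]: "1\<^sub>m n \<in> special n"
  by (auto simp: special_def)

lemma special_elem [simp]: "i < n \<Longrightarrow> j < n \<Longrightarrow> i \<noteq> j \<Longrightarrow> elem n i j a \<in> special n"
  by (auto simp: special_def det_elem)

lemma special_adj:
  assumes "A \<in> special n"
  shows "adj_mat A \<in> special n" "A * adj_mat A = 1\<^sub>m n" "adj_mat A * A = 1\<^sub>m n"
proof -
  have A: "A \<in> carrier_mat n n" "det A = 1" using assms by (auto simp: special_def)
  show 1: "A * adj_mat A = 1\<^sub>m n" and 2: "adj_mat A * A = 1\<^sub>m n"
    using adj_mat[OF A(1)] A(2) by (auto intro!: eq_matI)
  have c: "adj_mat A \<in> carrier_mat n n" using adj_mat[OF A(1)] by simp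
  have "det A * det (adj_mat A) = 1"
    using det_mult[OF A(1) c] 1 by simp
  then show "adj_mat A \<in> special n" using A c by (simp add: special_def)
qed

text \<open>For \<open>u \<noteq> v\<close> exactly the two coordinates \<open>u\<close> and \<open>v\<close> change sign, so that the determinant is 1. The degenerate case \<open>u = v\<close> gives the identity, which makes the multiplication rule \<open>sign_mat_mult\<close> hold without exceptions.\<close>

definition sign_vec :: "nat \<Rightarrow> nat \<Rightarrow> nat \<Rightarrow> 'a::comm_ring_1" where
  "sign_vec u v k = (if (k = u) = (k = v) then 1 else - 1)"

definition sign_mat :: "nat \<Rightarrow> nat \<Rightarrow> nat \<Rightarrow> 'a::comm_ring_1 mat" where
  "sign_mat n u v = mat_diag n (sign_vec u v)"

lemma sign_vec_sq [simp]: "sign_vec u v k * sign_vec u v k = 1"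
  by (simp add: sign_vec_def)

lemma sign_mat_carrier [simp]: "sign_mat n u v \<in> carrier_mat n n"
  by (simp add: sign_mat_def)

lemma det_mat_diag: "det (mat_diag n f) = (\<Prod>k<n. f k)"
proof -
  have "det (mat_diag n f) = prod_list (diag_mat (mat_diag n f))"
    by (rule det_upper_triangular[OF _ mat_diag_dim]) (auto simp: upper_triangular_def mat_diag_def)
  also have "diag_mat (mat_diag n f) = map f [0..<n]"
    by (auto simp: diag_mat_def mat_diag_def)
  finally show ?thesis by (simp add: prod.list_conv_set_nth lessThan_atLeast0)
qed

lemma sign_mat_special [simp]:
  assumes "u < n" "v < n" shows "sign_mat n u v \<in> special n"
proof (cases "u = v")
  case True then show ?thesis by (simp add: sign_mat_def sign_vec_def special_def det_mat_diag)
next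
  case False
  have "(\<Prod>k<n. sign_vec u v k) = (\<Prod>k\<in>{u, v}. (sign_vec u v k :: 'a))"
    using assms by (intro prod.mono_neutral_right) (auto simp: sign_vec_def)
  also have "\<dots> = 1" using False by (simp add: sign_vec_def)
  finally show ?thesis by (simp add: sign_mat_def special_def det_mat_diag)
qed

lemma sign_mat_self [simp]: "sign_mat n u u = (1\<^sub>m n :: 'a::comm_ring_1 mat)"
proof -
  have "sign_vec u u = (\<lambda>_. 1 :: 'a)" by (auto simp: sign_vec_def)
  then show ?thesis by (simp add: sign_mat_def)
qed

lemma sign_mat_mult: "sign_mat n u v * sign_mat n v w = sign_mat n u w"
  unfolding sign_mat_def mat_diag_diag by (rule arg_cong[where f = "mat_diag n"]) (auto simp: sign_vec_def)

lemma sign_mat_commute: "sign_mat n u v * sign_mat n x y = sign_mat n x y * sign_mat n u v"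
  unfolding sign_mat_def mat_diag_diag by (simp add: mult.commute)

lemma sign_mat_sq: "sign_mat n u v * sign_mat n u v = 1\<^sub>m n"
  by (simp add: sign_mat_def)

lemma sign_mat_elem:
  assumes "i < n" "j < n" "i \<noteq> j"
  shows "sign_mat n u v * elem n i j a * sign_mat n u v = elem n i j (sign_vec u v i * sign_vec u v j * a)"
  unfolding sign_mat_def
  by (simp add: mat_diag_mult_left[of _ n n] mat_diag_mult_right[of _ n n])
    (rule eq_matI, use assms in \<open>auto simp: elem_index algebra_simps\<close>)

text \<open>A transposition matrix with one sign changed, which brings the determinant to 1. It makes all sign matrices conjugate in the special linear group.\<close>

definition signed_swap :: "nat \<Rightarrow> nat \<Rightarrow> nat \<Rightarrow> 'a::comm_ring_1 mat" where
  "signed_swap n v w = swaprows_mat n v w * mat_diag n (\<lambda>k. if k = w then - 1 else 1)"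

lemma signed_swap_special [simp]:
  assumes "v < n" "w < n" "v \<noteq> w" shows "signed_swap n v w \<in> special n"
  unfolding signed_swap_def special_def using assms
  by (auto simp: det_mult[of _ n] det_swaprows_mat det_mat_diag)

lemma special_carrier [simp]: "A \<in> special n \<Longrightarrow> A \<in> carrier_mat n n"
  by (simp add: special_def)

lemma signed_swap_sign_mat:
  assumes "u < n" "v < n" "w < n" "u \<noteq> v" "v \<noteq> w" "u \<noteq> w"
  shows "signed_swap n v w * sign_mat n u v = sign_mat n u w * signed_swap n v w"
  unfolding sign_mat_def signed_swap_def
  by (simp add: mat_diag_mult_left[of _ n n] mat_diag_mult_right[of _ n n] assoc_mult_mat[of _ n n _ n _ n])
    (rule eq_matI, use assms in \<open>auto simp: sign_vec_def\<close>)

section \<open>Commuting involutions and sign characters\<close>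

definition eigen_column :: "nat \<Rightarrow> 'f::field mat \<Rightarrow> 'f mat \<Rightarrow> nat \<Rightarrow> bool" where
  "eigen_column n A P k \<longleftrightarrow> (\<exists>s. s * s = 1 \<and> (\<forall>i<n. (A * P) $$ (i, k) = s * P $$ (i, k)))"

definition replace_column :: "nat \<Rightarrow> 'f::field mat \<Rightarrow> nat \<Rightarrow> (nat \<Rightarrow> 'f) \<Rightarrow> 'f mat" where
  "replace_column n P k w = mat n n (\<lambda>(i, j). if j = k then w i else P $$ (i, j))"

lemma replace_column_carrier [simp]: "replace_column n P k w \<in> carrier_mat n n"
  by (simp add: replace_column_def)

lemma det_replace_column:
  assumes P: "P \<in> carrier_mat n n" and k: "k < n"
  shows "det (replace_column n P k w) = (\<Sum>i<n. w i * cofactor P i k)"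
proof -
  have "cofactor (replace_column n P k w) i k = cofactor P i k" if "i < n" for i
  proof -
    have "mat_delete (replace_column n P k w) i k = mat_delete P i k"
      using that k P by (intro eq_matI) (auto simp: mat_delete_def replace_column_def)
    then show ?thesis by (simp add: cofactor_def)
  qed
  then show ?thesis
    unfolding laplace_expansion_column[OF replace_column_carrier k]
    using k by (intro sum.cong) (auto simp: replace_column_def)
qed

text \<open>Over a field of characteristic not 2, the vectors \<open>w + B w\<close> and \<open>w - B w\<close> are eigenvectors of the involution \<open>B\<close> or zero. The determinant is linear in a column, and \<open>2 w\<close> is their sum, so one of them can replace the column \<open>w\<close> of an invertible matrix without destroying invertibility. Whatever commutes with \<open>B\<close> keeps its eigenvectors.\<close>

lemma eigen_column_step:
  fixes B :: "'f::field mat"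
  assumes two: "(2 :: 'f) \<noteq> 0"
    and B: "B \<in> carrier_mat n n" "B * B = 1\<^sub>m n"
    and \<A>: "\<And>A. A \<in> \<A> \<Longrightarrow> A \<in> carrier_mat n n" "\<And>A. A \<in> \<A> \<Longrightarrow> A * B = B * A"
    and P: "P \<in> carrier_mat n n" "det P \<noteq> 0" and k: "k < n"
  shows "\<exists>P'\<in>carrier_mat n n. det P' \<noteq> 0 \<and> eigen_column n B P' k \<and>
    (\<forall>A\<in>\<A>. eigen_column n A P k \<longrightarrow> eigen_column n A P' k) \<and>
    (\<forall>A\<in>carrier_mat n n. \<forall>j<n. j \<noteq> k \<longrightarrow> eigen_column n A P j \<longrightarrow> eigen_column n A P' j)"
proof -
  define w where "w s i = P $$ (i, k) + s * (B * P) $$ (i, k)" for s i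
  have "(\<Sum>i<n. w 1 i * cofactor P i k) + (\<Sum>i<n. w (- 1) i * cofactor P i k)
      = 2 * (\<Sum>i<n. P $$ (i, k) * cofactor P i k)"
    by (simp add: w_def sum.distrib [symmetric] sum_distrib_left algebra_simps)
  \<comment> \<open>Both signs are tried: the two candidate columns add up to twice the old one.\<close>
  then have "det (replace_column n P k (w 1)) + det (replace_column n P k (w (- 1))) = 2 * det P"
    by (simp add: det_replace_column[OF P(1) k] laplace_expansion_column[OF P(1) k])
  then have "det (replace_column n P k (w 1)) \<noteq> 0 \<or> det (replace_column n P k (w (- 1))) \<noteq> 0"
    using two P(2) by auto
  then obtain s where s: "s * s = 1" "det (replace_column n P k (w s)) \<noteq> 0"
    by (metis mult_1 mult_minus1 minus_minus)
  let ?P = "replace_column n P k (w s)"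
  have wk: "(A * ?P) $$ (i, k) = (A * P) $$ (i, k) + s * (A * (B * P)) $$ (i, k)"
    if A: "A \<in> carrier_mat n n" and i: "i < n" for A i
    unfolding index_mult_mat_sum[OF A replace_column_carrier i k] index_mult_mat_sum[OF A P(1) i k]
      index_mult_mat_sum[OF A mult_carrier_square[OF B(1) P(1)] i k]
    using k by (simp add: replace_column_def w_def sum.distrib sum_distrib_left algebra_simps)
  have Pk: "?P $$ (i, k) = P $$ (i, k) + s * (B * P) $$ (i, k)" if "i < n" for i
    using that k by (simp add: replace_column_def w_def)
  have "eigen_column n B ?P k"
  proof -
    have "B * (B * P) = P"
      using assoc_mult_mat[OF B(1) B(1) P(1)] B(2) P(1) by simp
    moreover have "s * ?P $$ (i, k) = s * P $$ (i, k) + s * s * (B * P) $$ (i, k)" if "i < n" for i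
      using Pk[OF that] by (simp add: distrib_left mult.assoc)
    ultimately have "(B * ?P) $$ (i, k) = s * ?P $$ (i, k)" if "i < n" for i
      using wk[OF B(1) that] s(1) that by simp
    then show ?thesis using s(1) by (auto simp: eigen_column_def)
  qed
  moreover have "eigen_column n A ?P k" if A: "A \<in> \<A>" and "eigen_column n A P k" for A
  proof -
    obtain c where c: "c * c = 1" "\<forall>i<n. (A * P) $$ (i, k) = c * P $$ (i, k)"
      using \<open>eigen_column n A P k\<close> by (auto simp: eigen_column_def)
    note cA = \<A>(1)[OF A]
    have "A * (B * P) = B * (A * P)"
      using assoc_mult_mat[OF cA B(1) P(1)] assoc_mult_mat[OF B(1) cA P(1)] \<A>(2)[OF A] by simp
    moreover have "(B * (A * P)) $$ (i, k) = c * (B * P) $$ (i, k)" if i: "i < n" for i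
      unfolding index_mult_mat_sum[OF B(1) mult_carrier_square[OF cA P(1)] i k]
        index_mult_mat_sum[OF B(1) P(1) i k]
      using c(2) by (simp add: sum_distrib_left algebra_simps)
    ultimately have "(A * ?P) $$ (i, k) = c * ?P $$ (i, k)" if "i < n" for i
      using wk[OF cA that] Pk[OF that] c(2) that by (simp add: algebra_simps)
    then show ?thesis using c(1) by (auto simp: eigen_column_def)
  qed
  moreover have "eigen_column n A ?P j"
    if A: "A \<in> carrier_mat n n" and j: "j < n" "j \<noteq> k" and "eigen_column n A P j" for A j
  proof -
    have "(A * ?P) $$ (i, j) = (A * P) $$ (i, j)" if i: "i < n" for i
      unfolding index_mult_mat_sum[OF A replace_column_carrier i j(1)] index_mult_mat_sum[OF A P(1) i j(1)]
      using j by (simp add: replace_column_def)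
    moreover have "?P $$ (i, j) = P $$ (i, j)" if "i < n" for i
      using that j by (simp add: replace_column_def)
    ultimately show ?thesis using \<open>eigen_column n A P j\<close> by (simp add: eigen_column_def)
  qed
  ultimately show ?thesis using s(2) by (intro bexI[of _ ?P]) auto
qed

lemma commuting_involutions_eigen_columns:
  fixes \<A> :: "'f::field mat set"
  assumes two: "(2 :: 'f) \<noteq> 0" and fin: "finite \<A>"
    and "\<And>A. A \<in> \<A> \<Longrightarrow> A \<in> carrier_mat n n" "\<And>A. A \<in> \<A> \<Longrightarrow> A * A = 1\<^sub>m n"
    and "\<And>A B. A \<in> \<A> \<Longrightarrow> B \<in> \<A> \<Longrightarrow> A * B = B * A"
  shows "\<exists>P\<in>carrier_mat n n. det P \<noteq> 0 \<and> (\<forall>A\<in>\<A>. \<forall>k<n. eigen_column n A P k)"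
  using fin assms(3-5)
proof (induction \<A> rule: finite_induct)
  case empty
  show ?case by (rule bexI[of _ "1\<^sub>m n"]) auto
next
  case (insert B \<A>)
  then obtain P where P: "P \<in> carrier_mat n n" "det P \<noteq> 0" "\<forall>A\<in>\<A>. \<forall>k<n. eigen_column n A P k"
    by (metis insertCI)
  have "\<exists>P\<in>carrier_mat n n. det P \<noteq> 0 \<and> (\<forall>A\<in>\<A>. \<forall>k<n. eigen_column n A P k) \<and> (\<forall>k<m. eigen_column n B P k)"
    if "m \<le> n" for m
    using that
  proof (induction m)
    case 0 then show ?case using P by auto
  next
    case (Suc m)
    then obtain P where P: "P \<in> carrier_mat n n" "det P \<noteq> 0" "\<forall>A\<in>\<A>. \<forall>k<n. eigen_column n A P k"
      "\<forall>k<m. eigen_column n B P k" by auto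
    have m: "m < n" using Suc.prems by simp
    have "\<exists>P'\<in>carrier_mat n n. det P' \<noteq> 0 \<and> eigen_column n B P' m \<and>
      (\<forall>A\<in>\<A>. eigen_column n A P m \<longrightarrow> eigen_column n A P' m) \<and>
      (\<forall>A\<in>carrier_mat n n. \<forall>j<n. j \<noteq> m \<longrightarrow> eigen_column n A P j \<longrightarrow> eigen_column n A P' j)"
      using insert.prems by (intro eigen_column_step[OF two _ _ _ _ P(1,2) m]) auto
    then obtain P' where P': "P' \<in> carrier_mat n n" "det P' \<noteq> 0" "eigen_column n B P' m"
      "\<forall>A\<in>\<A>. eigen_column n A P m \<longrightarrow> eigen_column n A P' m"
      "\<forall>A\<in>carrier_mat n n. \<forall>j<n. j \<noteq> m \<longrightarrow> eigen_column n A P j \<longrightarrow> eigen_column n A P' j"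
      by blast
    have "eigen_column n A P' k" if "A \<in> \<A>" "k < n" for A k
      using that P(3) P'(4,5) insert.prems(1) by (cases "k = m") auto
    moreover have "eigen_column n B P' k" if "k < Suc m" for k
      using that m P(4) P'(3,5) insert.prems(1)[of B] by (cases "k = m") auto
    ultimately show ?case using P'(1,2) by blast
  qed
  from this[of n] show ?case by (metis insertE order_refl)
qed

lemma field_det_inverse:
  fixes P :: "'f::field mat"
  assumes P: "P \<in> carrier_mat n n" "det P \<noteq> 0"
  obtains P' where "P' \<in> carrier_mat n n" "P * P' = 1\<^sub>m n" "P' * P = 1\<^sub>m n"
proof -
  have "P \<in> Units (ring_mat TYPE('f) n ())" by (rule det_non_zero_imp_unit[OF P])
  then show thesis using that by (auto simp: Units_def ring_mat_simps)
qed

lemma commuting_involutions_diagonal: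
  fixes \<A> :: "'f::field mat set"
  assumes "(2 :: 'f) \<noteq> 0" "finite \<A>"
    and "\<And>A. A \<in> \<A> \<Longrightarrow> A \<in> carrier_mat n n" "\<And>A. A \<in> \<A> \<Longrightarrow> A * A = 1\<^sub>m n"
    and "\<And>A B. A \<in> \<A> \<Longrightarrow> B \<in> \<A> \<Longrightarrow> A * B = B * A"
  obtains P P' where "P \<in> carrier_mat n n" "P' \<in> carrier_mat n n" "P * P' = 1\<^sub>m n" "P' * P = 1\<^sub>m n"
    "\<And>A k l. A \<in> \<A> \<Longrightarrow> k < n \<Longrightarrow> l < n \<Longrightarrow> k \<noteq> l \<Longrightarrow> (P' * A * P) $$ (k, l) = 0"
proof -
  obtain P where P: "P \<in> carrier_mat n n" "det P \<noteq> 0" and e: "\<forall>A\<in>\<A>. \<forall>k<n. eigen_column n A P k"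
    using commuting_involutions_eigen_columns[OF assms] by blast
  obtain P' where P': "P' \<in> carrier_mat n n" "P * P' = 1\<^sub>m n" "P' * P = 1\<^sub>m n"
    using field_det_inverse[OF P] by blast
  have "(P' * A * P) $$ (k, l) = 0" if A: "A \<in> \<A>" and kl: "k < n" "l < n" "k \<noteq> l" for A k l
  proof -
    obtain s where s: "\<forall>i<n. (A * P) $$ (i, l) = s * P $$ (i, l)"
      using e A kl unfolding eigen_column_def by blast
    have "(P' * A * P) $$ (k, l) = (P' * (A * P)) $$ (k, l)"
      using A P' P assms(3) by (simp add: assoc_mult_mat[of P' n n A n P n])
    also have "\<dots> = (\<Sum>m<n. P' $$ (k, m) * (s * P $$ (m, l)))"
      using assms(3)[OF A] P P' kl s by (subst index_mult_mat_sum[where n = n]) auto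
    also have "\<dots> = s * (P' * P) $$ (k, l)"
      using P P' kl by (subst index_mult_mat_sum[where n = n]) (auto simp: sum_distrib_left algebra_simps)
    finally show ?thesis using kl P'(3) by simp
  qed
  then show thesis using that P P' by blast
qed

text \<open>Only the values of \<open>\<rho>\<close> on determinant one matrices are constrained, so that the locale applies to automorphisms of the special and of the general linear group alike.\<close>

locale faithful_rep =
  fixes n :: nat and \<rho> :: "'a::idom mat \<Rightarrow> 'f::field mat"
  assumes n3: "n \<ge> 3" and two_dom: "(2 :: 'a) \<noteq> 0" and two_fld: "(2 :: 'f) \<noteq> 0"
    and rep_carrier [simp]: "A \<in> special n \<Longrightarrow> \<rho> A \<in> carrier_mat n n"
    and rep_mult: "A \<in> special n \<Longrightarrow> B \<in> special n \<Longrightarrow> \<rho> (A * B) = \<rho> A * \<rho> B"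
    and rep_one: "\<rho> (1\<^sub>m n) = 1\<^sub>m n"
    and rep_inj: "A \<in> special n \<Longrightarrow> B \<in> special n \<Longrightarrow> \<rho> A = \<rho> B \<Longrightarrow> A = B"
begin

lemma not_in_two:
  obtains w where "w < n" "w \<noteq> i" "w \<noteq> j"
proof -
  have "\<exists>w<3. w \<noteq> i \<and> w \<noteq> j" by presburger
  then show ?thesis using that n3 by (meson less_le_trans)
qed

lemma rep_dim [simp]:
  assumes "A \<in> special n"
  shows "dim_row (\<rho> A) = n" "dim_col (\<rho> A) = n"
  using rep_carrier[OF assms] by auto

lemma det_rep_mult:
  "A \<in> special n \<Longrightarrow> B \<in> special n \<Longrightarrow> det (\<rho> (A * B)) = det (\<rho> A) * det (\<rho> B)"
  by (simp add: rep_mult det_mult[of _ n])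

text \<open>The sign matrices are conjugate to each other, so their images share one determinant \<open>\<delta>\<close>. The product of two of them is a third, whence \<open>\<delta>\<^sup>2 = \<delta>\<close>.\<close>

lemma det_rep_sign_mat:
  assumes "u < n" "v < n"
  shows "det (\<rho> (sign_mat n u v)) = 1"
proof (cases "u = v")
  case True then show ?thesis by (simp add: rep_one)
next
  case False
  have conj: "det (\<rho> (sign_mat n u v)) = det (\<rho> (sign_mat n u w))"
    if "u < n" "v < n" "w < n" "u \<noteq> v" "v \<noteq> w" "u \<noteq> w" for u v w
  proof -
    let ?S = "signed_swap n v w :: 'a mat"
    have S: "?S \<in> special n" using that by simp
    have "det (\<rho> ?S) * det (\<rho> (adj_mat ?S)) = 1"
      using det_rep_mult[OF S special_adj(1)[OF S]] special_adj(2)[OF S] by (simp add: rep_one)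
    moreover have "det (\<rho> ?S) * det (\<rho> (sign_mat n u v)) = det (\<rho> (sign_mat n u w)) * det (\<rho> ?S)"
      unfolding det_rep_mult[OF S sign_mat_special[OF that(1,2)], symmetric]
        det_rep_mult[OF sign_mat_special[OF that(1,3)] S, symmetric] signed_swap_sign_mat[OF that] ..
    ultimately show ?thesis by (metis mult.commute mult_cancel_left mult_zero_left zero_neq_one)
  qed
  obtain w where w: "w < n" "w \<noteq> u" "w \<noteq> v" using not_in_two .
  let ?d = "\<lambda>x y. det (\<rho> (sign_mat n x y))"
  have sym: "sign_mat n x y = (sign_mat n y x :: 'a mat)" for x y :: nat
    unfolding sign_mat_def sign_vec_def by (rule arg_cong[where f = "mat_diag n"]) auto
  have "?d u v * ?d v w = ?d u w"
    using assms w det_rep_mult[of "sign_mat n u v" "sign_mat n v w"] by (simp add: sign_mat_mult)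
  moreover have "?d u v = ?d u w" by (rule conj) (use assms w False in auto)
  moreover have "?d v u = ?d v w" by (rule conj) (use assms w False in auto)
  moreover have "?d u v * ?d u v = 1"
    using assms det_rep_mult[of "sign_mat n u v" "sign_mat n u v"] by (simp add: sign_mat_sq rep_one)
  ultimately show ?thesis using sym[of u v] by auto
qed

end

text \<open>The situation after a change of basis that diagonalises the images of all sign matrices.\<close>

locale diag_rep = faithful_rep +
  assumes diag: "u < n \<Longrightarrow> v < n \<Longrightarrow> k < n \<Longrightarrow> l < n \<Longrightarrow> k \<noteq> l \<Longrightarrow> \<rho> (sign_mat n u v) $$ (k, l) = 0"
begin

text \<open>The character by which the sign matrices act on the basis vector \<open>k\<close>.\<close>

definition sgn_char :: "nat \<Rightarrow> nat \<Rightarrow> nat \<Rightarrow> 'b" where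
  "sgn_char k u v = \<rho> (sign_mat n u v) $$ (k, k)"

lemma rho_sign_mat:
  assumes "u < n" "v < n"
  shows "\<rho> (sign_mat n u v) = mat_diag n (\<lambda>k. sgn_char k u v)"
  by (rule eq_matI)
    (use assms diag rep_dim[OF sign_mat_special[OF assms]] in \<open>auto simp: sgn_char_def mat_diag_def\<close>)

lemma sgn_char_mult:
  assumes "u < n" "v < n" "w < n" "k < n"
  shows "sgn_char k u v * sgn_char k v w = sgn_char k u w"
proof -
  have "mat_diag n (\<lambda>k. sgn_char k u v * sgn_char k v w) = mat_diag n (\<lambda>k. sgn_char k u w)"
    using assms sign_mat_mult[of n u v w] rho_sign_mat rep_mult by (metis sign_mat_special mat_diag_diag)
  then have "mat_diag n (\<lambda>k. sgn_char k u v * sgn_char k v w) $$ (k, k) = mat_diag n (\<lambda>k. sgn_char k u w) $$ (k, k)"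
    by simp
  then show ?thesis using assms(4) by (simp add: mat_diag_def)
qed

lemma sgn_char_self: "u < n \<Longrightarrow> k < n \<Longrightarrow> sgn_char k u u = 1"
  by (simp add: sgn_char_def rep_one)

lemma sgn_char_sym: "sgn_char k u v = sgn_char k v u"
proof -
  have "sign_mat n u v = (sign_mat n v u :: 'a mat)"
    unfolding sign_mat_def sign_vec_def by (rule arg_cong[where f = "mat_diag n"]) auto
  then show ?thesis by (simp add: sgn_char_def)
qed

lemma sgn_char_sq: "u < n \<Longrightarrow> v < n \<Longrightarrow> k < n \<Longrightarrow> sgn_char k u v * sgn_char k u v = 1"
  using sgn_char_mult[of u v u k] sgn_char_self sgn_char_sym[of k v u] by simp

text \<open>Whether the pair \<open>{i, j}\<close> fails to separate \<open>u\<close> from \<open>v\<close>. This is also the condition for the sign matrix of \<open>u\<close> and \<open>v\<close> to commute with the elementary matrices at \<open>(i, j)\<close>.\<close>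

definition same_side :: "nat \<Rightarrow> nat \<Rightarrow> nat \<Rightarrow> nat \<Rightarrow> bool" where
  "same_side i j u v \<longleftrightarrow> (u = i \<or> u = j) = (v = i \<or> v = j)"

text \<open>The matrix unit at \<open>(k, l)\<close> in the target has the same weight under the sign matrices as the matrix unit at \<open>(i, j)\<close> in the source.\<close>

definition realizes :: "nat \<Rightarrow> nat \<Rightarrow> nat \<Rightarrow> nat \<Rightarrow> bool" where
  "realizes k l i j \<longleftrightarrow> (\<forall>u<n. \<forall>v<n. sgn_char k u v * sgn_char l u v = (if same_side i j u v then 1 else - 1))"

lemma realizes_sym: "realizes k l i j \<Longrightarrow> realizes l k i j" and realizes_sym': "realizes k l i j \<Longrightarrow> realizes k l j i"
  unfolding realizes_def same_side_def by (auto simp: mult.commute disj_commute)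

lemma sign_vec_same_side: "i \<noteq> j \<Longrightarrow> sign_vec u v i * sign_vec u v j = (if same_side i j u v then 1 else - 1)"
  by (auto simp: sign_vec_def same_side_def)

lemma sgn_char_entry:
  assumes "i < n" "j < n" "i \<noteq> j" "u < n" "v < n" "k < n" "l < n"
  shows "sgn_char k u v * sgn_char l u v * \<rho> (elem n i j a) $$ (k, l)
    = \<rho> (elem n i j (if same_side i j u v then a else - a)) $$ (k, l)"
proof -
  have "\<rho> (sign_mat n u v * elem n i j a * sign_mat n u v) = \<rho> (sign_mat n u v) * \<rho> (elem n i j a) * \<rho> (sign_mat n u v)"
    using assms by (simp add: rep_mult)
  then have "\<rho> (elem n i j (if same_side i j u v then a else - a))
      = mat_diag n (\<lambda>k. sgn_char k u v) * \<rho> (elem n i j a) * mat_diag n (\<lambda>k. sgn_char k u v)"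
    using assms by (simp add: sign_mat_elem sign_vec_same_side rho_sign_mat split: if_splits)
  moreover have "\<rho> (elem n i j a) \<in> carrier_mat n n" using assms by simp
  ultimately show ?thesis using assms
    by (simp add: mat_diag_mult_left[of _ n n] mat_diag_mult_right[of _ n n] algebra_simps)
qed

text \<open>Triviality on the sign matrices that fix \<open>E(i, j)\<close> leaves only two characters, because these sign matrices form a subgroup of index 2.\<close>

lemma sgn_char_prod_alt:
  assumes ij: "i < n" "j < n" "i \<noteq> j" and kl: "k < n" "l < n"
    and same: "\<And>u v. u < n \<Longrightarrow> v < n \<Longrightarrow> same_side i j u v \<Longrightarrow> sgn_char k u v * sgn_char l u v = 1"
  shows "realizes k l i j \<or> (\<forall>u<n. \<forall>v<n. sgn_char k u v * sgn_char l u v = 1)"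
proof -
  \<comment> \<open>Any \<open>w\<close> outside \<open>{i, j}\<close> decides between the two cases, since \<open>t\<close> is multiplicative.\<close>
  define t where "t u v = sgn_char k u v * sgn_char l u v" for u v
  have t_mult: "t u v * t v w = t u w" if "u < n" "v < n" "w < n" for u v w
    unfolding t_def sgn_char_mult[OF that kl(1), symmetric] sgn_char_mult[OF that kl(2), symmetric]
    by (simp only: ac_simps)
  have t_sym: "t u v = t v u" for u v unfolding t_def using sgn_char_sym by metis
  obtain w where w: "w < n" "w \<noteq> i" "w \<noteq> j" using not_in_two .
  have c: "t u v = t i w" if uv: "u < n" "v < n" "u = i \<or> u = j" "\<not> (v = i \<or> v = j)" for u v
  proof -
    have "t u i = 1" "t w v = 1" using same uv ij w by (auto simp: t_def same_side_def)
    then show ?thesis using t_mult[of u i w] t_mult[of u w v] uv ij w by simp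
  qed
  have n: "t u v = t i w" if "u < n" "v < n" "\<not> same_side i j u v" for u v
    using c[of u v] c[of v u] that t_sym[of u v] by (auto simp: same_side_def)
  have "t i w * t i w = 1" using t_mult[of i w i] t_sym[of w i] same[of i i] ij w by (simp add: t_def same_side_def)
  then have "t i w = 1 \<or> t i w = - 1" by (simp add: square_eq_1_iff)
  then show ?thesis using n same unfolding realizes_def t_def by metis
qed

text \<open>A nonzero entry at \<open>(k, l)\<close> has a weight that is trivial on every sign matrix commuting with the given elementary matrix.\<close>

lemma entry_alt:
  assumes ij: "i < n" "j < n" "i \<noteq> j" and kl: "k < n" "l < n" and nz: "\<rho> (elem n i j a) $$ (k, l) \<noteq> 0"
  shows "realizes k l i j \<or> (\<forall>u<n. \<forall>v<n. sgn_char k u v * sgn_char l u v = 1)"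
proof (rule sgn_char_prod_alt[OF ij kl])
  fix u v assume "u < n" "v < n" "same_side i j u v"
  then show "sgn_char k u v * sgn_char l u v = 1" using sgn_char_entry[of i j u v k l a] ij kl nz by simp
qed

lemma not_same_side_ex:
  assumes "i < n" "j < n" "i \<noteq> j" obtains u v where "u < n" "v < n" "\<not> same_side i j u v"
proof -
  obtain w where "w < n" "w \<noteq> i" "w \<noteq> j" using not_in_two .
  then show thesis using that[of i w] assms by (auto simp: same_side_def)
qed

text \<open>If no place had the weight of \<open>E(i, j)\<close>, the image of \<open>1 + E(i, j)\<close> would commute with all sign matrices. But one of them inverts it, and \<open>1 + E(i, j)\<close> does not have order two.\<close>

lemma realizes_exists:
  assumes ij: "i < n" "j < n" "i \<noteq> j"
  shows "\<exists>k<n. \<exists>l<n. realizes k l i j"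
proof (rule ccontr)
  assume "\<not> ?thesis"
  then have no: "\<not> realizes k l i j" if "k < n" "l < n" for k l using that by blast
  obtain u v where uv: "u < n" "v < n" "\<not> same_side i j u v" using not_same_side_ex[OF ij] .
  have "\<rho> (elem n i j 1) = \<rho> (elem n i j (- 1))"
  proof (rule eq_matI)
    fix k l assume "k < dim_row (\<rho> (elem n i j (- 1)))" "l < dim_col (\<rho> (elem n i j (- 1)))"
    then have kl: "k < n" "l < n" using ij by auto
    have "sgn_char k u v * sgn_char l u v * \<rho> (elem n i j 1) $$ (k, l) = \<rho> (elem n i j (- 1)) $$ (k, l)"
      using sgn_char_entry[of i j u v k l 1] ij kl uv by simp
    moreover have "\<rho> (elem n i j 1) $$ (k, l) = 0 \<or> sgn_char k u v * sgn_char l u v = 1"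
      using entry_alt[OF ij kl, of 1] no[OF kl] uv by blast
    ultimately show "\<rho> (elem n i j 1) $$ (k, l) = \<rho> (elem n i j (- 1)) $$ (k, l)" by auto
  qed (use ij in auto)
  then have "elem n i j (1 :: 'a) = elem n i j (- 1)" using rep_inj ij by simp
  then have "(1 :: 'a) = - 1" by (rule elem_inj[OF ij(1,2)])
  then show False using two_dom by (simp add: eq_neg_iff_add_eq_0)
qed

lemma realizes_neq: "k < n \<Longrightarrow> i < n \<Longrightarrow> j < n \<Longrightarrow> i \<noteq> j \<Longrightarrow> \<not> realizes k k i j"
  by (metis realizes_def sgn_char_sq not_same_side_ex one_add_one two_fld add.right_inverse)

end

section \<open>The block of an elementary matrix\<close>

context diag_rep
begin

text \<open>A pair and its complement induce the same partition. With four coordinates the complement is again a pair, which is the reason for the exception.\<close>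

lemma same_side_determines_pair:
  assumes ij: "i < n" "j < n" "i \<noteq> j" and ij': "i' < n" "j' < n" "i' \<noteq> j'" and n4: "n \<noteq> 4"
    and eq: "\<And>u v. u < n \<Longrightarrow> v < n \<Longrightarrow> same_side i j u v = same_side i' j' u v"
  shows "{i, j} = {i', j'}"
proof (rule ccontr)
  assume ne: "{i, j} \<noteq> {i', j'}"
  have a: "i \<noteq> i'" "i \<noteq> j'" "j \<noteq> i'" "j \<noteq> j'"
    using eq[of i j] eq[of i' j'] ij ij' ne by (auto simp: same_side_def)
  have "card {i, j, i', j'} = 4" using a ij ij' by simp
  moreover have "card {i, j, i', j'} \<le> card {..<n}" using ij ij' by (intro card_mono) auto
  ultimately have "n \<ge> 5" using n4 by simp
  have "\<not> {..<n} \<subseteq> {i, j, i', j'}"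
  proof
    assume "{..<n} \<subseteq> {i, j, i', j'}"
    then have "card {..<n} \<le> card {i, j, i', j'}" by (intro card_mono) auto
    then show False using \<open>n \<ge> 5\<close> \<open>card {i, j, i', j'} = 4\<close> by simp
  qed
  then obtain w where "w < n" "w \<notin> {i, j, i', j'}" by auto
  then show False using eq[of i' w] ij' a by (auto simp: same_side_def)
qed

lemma realizes_determines_same_side:
  assumes "realizes k l i j" "realizes k l i' j'" "u < n" "v < n"
  shows "same_side i j u v = same_side i' j' u v"
proof -
  have "(1 :: 'b) \<noteq> - 1" using two_fld by (metis one_add_one add.right_inverse)
  then show ?thesis using assms unfolding realizes_def by (metis (full_types))
qed

definition index_pairs :: "nat set set" where
  "index_pairs = {S. \<exists>i j. S = {i, j} \<and> i < n \<and> j < n \<and> i \<noteq> j}"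

text \<open>Every pair \<open>{i, j}\<close> is realised by some pair \<open>{k, l}\<close>, and a pair \<open>{k, l}\<close> realises at most one \<open>{i, j}\<close>. An injection of the finite set of pairs into itself is a bijection.\<close>

lemma realizes_bijection:
  assumes n4: "n \<noteq> 4"
  obtains f where "bij_betw f index_pairs index_pairs"
    "\<And>i j. i < n \<Longrightarrow> j < n \<Longrightarrow> i \<noteq> j \<Longrightarrow> \<exists>k l. f {i, j} = {k, l} \<and> k < n \<and> l < n \<and> k \<noteq> l \<and> realizes k l i j"
proof -
  have "\<exists>T. \<forall>i j. S = {i, j} \<longrightarrow> i < n \<longrightarrow> j < n \<longrightarrow> i \<noteq> j \<longrightarrow>
      (\<exists>k l. T = {k, l} \<and> k < n \<and> l < n \<and> k \<noteq> l \<and> realizes k l i j)" for S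
  proof (cases "S \<in> index_pairs")
    case True
    then obtain i j where ij: "S = {i, j}" "i < n" "j < n" "i \<noteq> j" by (auto simp: index_pairs_def)
    obtain k l where kl: "k < n" "l < n" "realizes k l i j" using realizes_exists[OF ij(2-4)] by blast
    then have "k \<noteq> l" using realizes_neq[OF kl(1) ij(2-4)] by blast
    have "realizes k l i' j'" if "S = {i', j'}" for i' j'
      using kl(3) realizes_sym' that unfolding ij(1) doubleton_eq_iff by blast
    then show ?thesis using kl(1,2) \<open>k \<noteq> l\<close> by (intro exI[of _ "{k, l}"]) blast
  next
    case False then show ?thesis unfolding index_pairs_def by blast
  qed
  then obtain f where f: "\<And>i j. i < n \<Longrightarrow> j < n \<Longrightarrow> i \<noteq> j \<Longrightarrow>
      \<exists>k l. f {i, j} = {k, l} \<and> k < n \<and> l < n \<and> k \<noteq> l \<and> realizes k l i j"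
    by metis
  have "index_pairs \<subseteq> Pow {..<n}" by (auto simp: index_pairs_def)
  then have fin: "finite index_pairs" by (rule finite_subset) simp
  have maps: "f ` index_pairs \<subseteq> index_pairs"
  proof
    fix T assume "T \<in> f ` index_pairs"
    then obtain i j where "T = f {i, j}" "i < n" "j < n" "i \<noteq> j" by (auto simp: index_pairs_def)
    then show "T \<in> index_pairs" using f[of i j] by (auto simp: index_pairs_def)
  qed
  moreover have inj: "inj_on f index_pairs"
  proof (rule inj_onI)
    fix S S' assume "S \<in> index_pairs" "S' \<in> index_pairs" and eq: "f S = f S'"
    then obtain i j i' j' where S: "S = {i, j}" "i < n" "j < n" "i \<noteq> j"
      and S': "S' = {i', j'}" "i' < n" "j' < n" "i' \<noteq> j'" by (auto simp: index_pairs_def)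
    obtain k l where kl: "f S = {k, l}" "realizes k l i j" using f S by blast
    obtain k' l' where kl': "f S' = {k', l'}" "realizes k' l' i' j'" using f S' by blast
    have "realizes k l i' j'" using kl(1) kl' eq realizes_sym by (metis doubleton_eq_iff)
    then show "S = S'"
      unfolding S(1) S'(1) using same_side_determines_pair[OF S(2-4) S'(2-4) n4] realizes_determines_same_side[OF kl(2)] by blast
  qed
  moreover have "f ` index_pairs = index_pairs"
    using endo_inj_surj[OF fin maps inj] .
  ultimately show thesis using that f by (auto simp: bij_betw_def)
qed

lemma realizes_unique:
  assumes n4: "n \<noteq> 4" and ij: "i < n" "j < n" "i \<noteq> j"
    and kl: "k < n" "l < n" "realizes k l i j" and kl': "k' < n" "l' < n" "realizes k' l' i j"
  shows "{k, l} = {k', l'}"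
proof -
  obtain f where bij: "bij_betw f index_pairs index_pairs" and f: "\<And>i j. i < n \<Longrightarrow> j < n \<Longrightarrow> i \<noteq> j \<Longrightarrow>
      \<exists>k l. f {i, j} = {k, l} \<and> k < n \<and> l < n \<and> k \<noteq> l \<and> realizes k l i j"
    using realizes_bijection[OF n4] by blast
  have "f {i, j} = {k, l}" if kl: "k < n" "l < n" "realizes k l i j" for k l
  proof -
    have "k \<noteq> l" using realizes_neq kl ij by metis
    then have "{k, l} \<in> f ` index_pairs" using kl bij by (auto simp: bij_betw_def index_pairs_def)
    then obtain i' j' where i'j': "i' < n" "j' < n" "i' \<noteq> j'" "f {i', j'} = {k, l}"
      by (auto simp: index_pairs_def)
    then obtain k' l' where "{k, l} = {k', l'}" "realizes k' l' i' j'" using f by metis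
    then have "realizes k l i' j'" using realizes_sym by (metis doubleton_eq_iff)
    then have "{i, j} = {i', j'}"
      using same_side_determines_pair[OF ij i'j'(1-3) n4] realizes_determines_same_side[OF kl(3)] by blast
    then show ?thesis using i'j' by simp
  qed
  then show ?thesis using kl kl' by metis
qed

text \<open>For \<open>n \<noteq> 4\<close> every pair \<open>{k, l}\<close> realises some \<open>{i, j}\<close>, and such a weight is nontrivial. For \<open>n = 4\<close> the product of all four characters is trivial because sign matrices have images of determinant 1. Hence if two characters agreed, so would the other two, and only one nontrivial weight would remain for the three different weights of \<open>E(0, 1)\<close>, \<open>E(0, 2)\<close> and \<open>E(0, 3)\<close>.\<close>

lemma sgn_char_distinct:
  assumes kl: "k < n" "l < n" "k \<noteq> l"
  shows "\<not> (\<forall>u<n. \<forall>v<n. sgn_char k u v * sgn_char l u v = 1)"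
proof (cases "n = 4")
  case False
  then obtain f where bij: "bij_betw f index_pairs index_pairs" and f: "\<And>i j. i < n \<Longrightarrow> j < n \<Longrightarrow> i \<noteq> j \<Longrightarrow>
      \<exists>k l. f {i, j} = {k, l} \<and> k < n \<and> l < n \<and> k \<noteq> l \<and> realizes k l i j"
    using realizes_bijection by blast
  have "{k, l} \<in> f ` index_pairs" using kl bij by (auto simp: bij_betw_def index_pairs_def)
  then obtain i' j' where i'j': "i' < n" "j' < n" "i' \<noteq> j'" "f {i', j'} = {k, l}"
    by (auto simp: index_pairs_def)
  then obtain k' l' where "{k, l} = {k', l'}" "realizes k' l' i' j'" using f by metis
  then have "realizes k l i' j'" using realizes_sym by (metis doubleton_eq_iff)
  moreover obtain u v where "u < n" "v < n" "\<not> same_side i' j' u v" using not_same_side_ex[OF i'j'(1-3)] .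
  ultimately show ?thesis unfolding realizes_def using two_fld
    by (metis one_add_one add.right_inverse)
next
  case True
  show ?thesis
  proof
    assume kl1: "\<forall>u<n. \<forall>v<n. sgn_char k u v * sgn_char l u v = 1"
    have "card ({..<n} - {k, l}) = 2" using kl True by (simp add: card_Diff_subset)
    then obtain m p where mp: "{..<n} - {k, l} = {m, p}" "m \<noteq> p" by (auto simp: card_2_iff)
    then have all: "{..<n} = {k, l, m, p}" using kl by auto
    have dist: "k \<noteq> m" "k \<noteq> p" "l \<noteq> m" "l \<noteq> p" "m < n" "p < n" using mp by auto
    \<comment> \<open>\<open>m\<close> and \<open>p\<close> are the two coordinates other than \<open>k\<close> and \<open>l\<close>.\<close>
    have mp1: "sgn_char m u v * sgn_char p u v = 1" if uv: "u < n" "v < n" for u v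
    proof -
      have "(\<Prod>q<n. sgn_char q u v) = 1"
        using det_rep_sign_mat[OF uv] by (simp add: rho_sign_mat[OF uv] det_mat_diag)
      then have "sgn_char k u v * sgn_char l u v * (sgn_char m u v * sgn_char p u v) = 1"
        unfolding all using dist mp(2) kl(3) by (simp add: mult.assoc)
      then show ?thesis using kl1 uv by simp
    qed
    have inv: "x = y" if "x * y = 1" "x * x = 1" for x y :: 'b
      using that by (metis mult.left_neutral mult.assoc mult.right_neutral)
    have le: "sgn_char l u v = sgn_char k u v" "sgn_char p u v = sgn_char m u v" if "u < n" "v < n" for u v
      using inv[of "sgn_char k u v" "sgn_char l u v"] inv[of "sgn_char m u v" "sgn_char p u v"] kl1 mp1 that sgn_char_sq kl dist by metis+
    have km: "realizes k m i j" if ij: "i < n" "j < n" "i \<noteq> j" for i j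
    proof -
      obtain a b where ab: "a < n" "b < n" "realizes a b i j" using realizes_exists ij by blast
      obtain u v where uv: "u < n" "v < n" "\<not> same_side i j u v" using not_same_side_ex[OF ij] .
      have ne: "\<not> (\<forall>u<n. \<forall>v<n. sgn_char a u v = sgn_char b u v)"
      proof
        assume "\<forall>u<n. \<forall>v<n. sgn_char a u v = sgn_char b u v"
        then have "sgn_char a u v * sgn_char b u v = 1" using sgn_char_sq uv ab by metis
        moreover have "sgn_char a u v * sgn_char b u v = - 1" using ab(3) uv by (simp add: realizes_def)
        ultimately show False using two_fld by (metis one_add_one add.right_inverse)
      qed
      have "a \<in> {k, l, m, p}" "b \<in> {k, l, m, p}" using ab all by blast+
      then consider "a \<in> {k, l}" "b \<in> {m, p}" | "b \<in> {k, l}" "a \<in> {m, p}"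
        using ne le by auto
      then have "sgn_char a u v * sgn_char b u v = sgn_char k u v * sgn_char m u v" if "u < n" "v < n" for u v
        by cases (use le that in \<open>auto simp: mult.commute\<close>)
      then show ?thesis using ab(3) by (simp add: realizes_def)
    qed
    have "same_side 0 1 0 1 = same_side 0 2 0 1"
      using realizes_determines_same_side[OF km[of 0 1] km[of 0 2], of 0 1] True by simp
    then show False by (simp add: same_side_def)
  qed
qed

lemma entry_realizes:
  assumes "i < n" "j < n" "i \<noteq> j" "k < n" "l < n" "k \<noteq> l" "\<rho> (elem n i j a) $$ (k, l) \<noteq> 0"
  shows "realizes k l i j"
  using entry_alt[OF assms(1-5,7)] sgn_char_distinct[OF assms(4-6)] by blast

lemma realizes_match:
  assumes "realizes k l i j" "realizes k l' i j" "k < n" "l < n" "l' < n"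
  shows "l = l'"
proof (rule ccontr)
  assume "l \<noteq> l'"
  have "sgn_char l u v * sgn_char l' u v = 1" if uv: "u < n" "v < n" for u v
  proof -
    have "sgn_char l u v * sgn_char l' u v = (sgn_char k u v * sgn_char k u v) * (sgn_char l u v * sgn_char l' u v)"
      using sgn_char_sq[OF uv assms(3)] by simp
    also have "\<dots> = (sgn_char k u v * sgn_char l u v) * (sgn_char k u v * sgn_char l' u v)" by (simp only: ac_simps)
    also have "\<dots> = 1" using assms(1,2) uv by (auto simp: realizes_def)
    finally show ?thesis .
  qed
  then show False using sgn_char_distinct[of l l'] assms \<open>l \<noteq> l'\<close> by blast
qed

text \<open>Conjugation by a sign matrix that separates \<open>i\<close> and \<open>j\<close> inverts the image, keeps its diagonal and changes the sign of all other entries.\<close>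

lemma inverse_entry:
  assumes ij: "i < n" "j < n" "i \<noteq> j" and kl: "k < n" "l < n"
  shows "\<rho> (elem n i j (- a)) $$ (k, l) = (if k = l then 1 else - 1) * \<rho> (elem n i j a) $$ (k, l)"
proof -
  obtain u v where uv: "u < n" "v < n" "\<not> same_side i j u v" using not_same_side_ex[OF ij] .
  have *: "\<rho> (elem n i j (- a)) $$ (k, l) = sgn_char k u v * sgn_char l u v * \<rho> (elem n i j a) $$ (k, l)"
    using sgn_char_entry[OF ij uv(1,2) kl, of a] uv(3) by simp
  consider "k = l" | "k \<noteq> l" "realizes k l i j" | "k \<noteq> l" "\<rho> (elem n i j a) $$ (k, l) = 0"
    using entry_realizes[OF ij kl] by blast
  then show ?thesis
    by cases (use * sgn_char_sq[OF uv(1,2) kl(1)] uv in \<open>auto simp: realizes_def\<close>)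
qed

lemma rep_elem_add:
  assumes ij: "i < n" "j < n" "i \<noteq> j"
  shows "\<rho> (elem n i j (a + b)) = \<rho> (elem n i j a) * \<rho> (elem n i j b)"
  using ij by (simp add: elem_add[symmetric] rep_mult)

lemma entry_mult_realizes:
  assumes ij: "i < n" "j < n" "i \<noteq> j" and kl: "k < n" "l < n" "realizes k l i j"
    and Y: "Y \<in> carrier_mat n n" "m < n"
  shows "(\<rho> (elem n i j a) * Y) $$ (k, m)
    = \<rho> (elem n i j a) $$ (k, k) * Y $$ (k, m) + \<rho> (elem n i j a) $$ (k, l) * Y $$ (l, m)"
proof -
  have "k \<noteq> l" using realizes_neq kl ij by metis
  have "\<rho> (elem n i j a) $$ (k, q) = 0" if "q < n" "q \<noteq> k" "q \<noteq> l" for q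
    using entry_realizes[OF ij kl(1), of q a] realizes_match[OF kl(3), of q] kl that by auto
  then show ?thesis
    using ij kl Y \<open>k \<noteq> l\<close> by (subst index_mult_mat_sum[where n = n]) (auto intro!: sum_supp_two)
qed

lemma entry_mult_diag:
  assumes X: "X \<in> carrier_mat n n" and k: "k < n" "\<And>q. q < n \<Longrightarrow> q \<noteq> k \<Longrightarrow> X $$ (k, q) = 0"
    and Y: "Y \<in> carrier_mat n n" "m < n"
  shows "(X * Y) $$ (k, m) = X $$ (k, k) * Y $$ (k, m)"
  using assms by (subst index_mult_mat_sum[where n = n]) (auto intro!: sum_supp_one)

lemma diag_entry_sq:
  assumes ij: "i < n" "j < n" "i \<noteq> j" and k: "k < n"
    and z: "\<And>q. q < n \<Longrightarrow> q \<noteq> k \<Longrightarrow> \<rho> (elem n i j a) $$ (k, q) = 0"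
  shows "\<rho> (elem n i j a) $$ (k, k) * \<rho> (elem n i j a) $$ (k, k) = 1"
proof -
  have "(\<rho> (elem n i j a) * \<rho> (elem n i j (- a))) $$ (k, k) = 1"
    using rep_elem_add[OF ij, of a "- a", symmetric] k by (simp add: rep_one)
  then show ?thesis
    using entry_mult_diag[of "\<rho> (elem n i j a)" k "\<rho> (elem n i j (- a))" k] z ij k
    by (simp add: inverse_entry)
qed

text \<open>These are the entries of \<open>X X\<^sup>-\<^sup>1 = 1\<close>, where \<open>X\<^sup>-\<^sup>1\<close> has the off-diagonal entries negated.\<close>

lemma block_relations:
  fixes a :: 'a
  assumes ij: "i < n" "j < n" "i \<noteq> j" and kl: "k < n" "l < n" "realizes k l i j"
  defines "X \<equiv> \<rho> (elem n i j a)"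
  shows "X $$ (k, k) * X $$ (k, k) - X $$ (k, l) * X $$ (l, k) = 1"
    and "X $$ (k, l) * X $$ (k, k) = X $$ (k, l) * X $$ (l, l)"
    and "\<rho> (elem n i j (a + a)) $$ (k, k) = \<rho> (elem n i j (a + a)) $$ (l, l)"
proof -
  have "k \<noteq> l" using realizes_neq kl ij by metis
  have one: "X * \<rho> (elem n i j (- a)) = 1\<^sub>m n"
    using rep_elem_add[OF ij, of a "- a"] by (simp add: rep_one X_def)
  have *: "X $$ (k, k) * X $$ (k, k) - X $$ (k, l) * X $$ (l, k) = 1 \<and>
      X $$ (k, l) * X $$ (k, k) = X $$ (k, l) * X $$ (l, l)"
    if kl: "k < n" "l < n" "realizes k l i j" "k \<noteq> l" for k l
  proof
    have "X $$ (k, k) * \<rho> (elem n i j (- a)) $$ (k, k) + X $$ (k, l) * \<rho> (elem n i j (- a)) $$ (l, k) = 1"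
      using entry_mult_realizes[OF ij kl(1-3), of "\<rho> (elem n i j (- a))" k a] one ij kl by (simp add: X_def)
    then show "X $$ (k, k) * X $$ (k, k) - X $$ (k, l) * X $$ (l, k) = 1"
      using ij kl by (simp add: inverse_entry X_def)
    have "X $$ (k, k) * \<rho> (elem n i j (- a)) $$ (k, l) + X $$ (k, l) * \<rho> (elem n i j (- a)) $$ (l, l) = 0"
      using entry_mult_realizes[OF ij kl(1-3), of "\<rho> (elem n i j (- a))" l a] one ij kl by (simp add: X_def)
    then show "X $$ (k, l) * X $$ (k, k) = X $$ (k, l) * X $$ (l, l)"
      using ij kl by (auto simp: inverse_entry X_def algebra_simps)
  qed
  show a: "X $$ (k, k) * X $$ (k, k) - X $$ (k, l) * X $$ (l, k) = 1"
    and "X $$ (k, l) * X $$ (k, k) = X $$ (k, l) * X $$ (l, l)"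
    using *[OF kl \<open>k \<noteq> l\<close>] by auto
  have b: "X $$ (l, l) * X $$ (l, l) - X $$ (l, k) * X $$ (k, l) = 1"
    using *[OF kl(2,1) realizes_sym[OF kl(3)]] \<open>k \<noteq> l\<close> by auto
  have "X \<in> carrier_mat n n" using ij by (simp add: X_def)
  then show "\<rho> (elem n i j (a + a)) $$ (k, k) = \<rho> (elem n i j (a + a)) $$ (l, l)"
    using entry_mult_realizes[OF ij kl, of X k a] entry_mult_realizes[OF ij kl(2,1) realizes_sym[OF kl(3)], of X l a] a b kl
    unfolding rep_elem_add[OF ij] X_def[symmetric]
    by (simp add: algebra_simps)
qed


text \<open>The off-diagonal support is a matching of the coordinates, and each block of the matching has equal diagonal entries. Such matrices commute iff their blocks do, and two blocks with constant diagonal commute iff their off-diagonal parts are proportional.\<close>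

definition matching_blocks :: "nat \<Rightarrow> nat \<Rightarrow> 'b mat \<Rightarrow> bool" where
  "matching_blocks i j X \<longleftrightarrow> X \<in> carrier_mat n n \<and>
    (\<forall>k<n. \<forall>l<n. k \<noteq> l \<longrightarrow> X $$ (k, l) \<noteq> 0 \<longrightarrow> realizes k l i j) \<and>
    (\<forall>k<n. \<forall>l<n. realizes k l i j \<longrightarrow> X $$ (k, k) = X $$ (l, l))"

lemma matching_blocks_rep:
  assumes "i < n" "j < n" "i \<noteq> j"
  shows "matching_blocks i j (\<rho> (elem n i j 2))"
  unfolding matching_blocks_def using assms entry_realizes block_relations(3)[OF assms, of _ _ 1] by auto

lemma matching_blocks_mult_realizes:
  assumes ij: "i < n" "j < n" "i \<noteq> j" and kl: "k < n" "l < n" "realizes k l i j"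
    and X: "matching_blocks i j X" and Y: "Y \<in> carrier_mat n n" "m < n"
  shows "(X * Y) $$ (k, m) = X $$ (k, k) * Y $$ (k, m) + X $$ (k, l) * Y $$ (l, m)"
proof -
  have "k \<noteq> l" using realizes_neq kl ij by metis
  have "X $$ (k, q) = 0" if "q < n" "q \<noteq> k" "q \<noteq> l" for q
    using X realizes_match[OF kl(3), of q] kl that by (auto simp: matching_blocks_def)
  then show ?thesis
    using X kl(1,2) Y \<open>k \<noteq> l\<close>
    by (subst index_mult_mat_sum[where n = n]) (simp_all add: matching_blocks_def sum_supp_two[where a = k and b = l])
qed

lemma matching_blocks_commute_iff:
  assumes ij: "i < n" "j < n" "i \<noteq> j" and X: "matching_blocks i j X" and Y: "matching_blocks i j Y"
  shows "X * Y = Y * X \<longleftrightarrow>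
    (\<forall>k<n. \<forall>l<n. realizes k l i j \<longrightarrow> X $$ (k, l) * Y $$ (l, k) = Y $$ (k, l) * X $$ (l, k))"
proof safe
  have c: "X \<in> carrier_mat n n" "Y \<in> carrier_mat n n" using X Y by (auto simp: matching_blocks_def)
  {
    fix k l assume eq: "X * Y = Y * X" and kl: "k < n" "l < n" "realizes k l i j"
    then have "(X * Y) $$ (k, k) = (Y * X) $$ (k, k)" by simp
    then show "X $$ (k, l) * Y $$ (l, k) = Y $$ (k, l) * X $$ (l, k)"
      unfolding matching_blocks_mult_realizes[OF ij kl X c(2) kl(1)] matching_blocks_mult_realizes[OF ij kl Y c(1) kl(1)]
      by (simp add: mult.commute)
  }
  assume r: "\<forall>k<n. \<forall>l<n. realizes k l i j \<longrightarrow> X $$ (k, l) * Y $$ (l, k) = Y $$ (k, l) * X $$ (l, k)"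
  show "X * Y = Y * X"
  proof (rule eq_matI)
    fix k m assume "k < dim_row (Y * X)" "m < dim_col (Y * X)"
    then have km: "k < n" "m < n" using c by auto
    show "(X * Y) $$ (k, m) = (Y * X) $$ (k, m)"
    proof (cases "\<exists>l<n. realizes k l i j")
      case True
      then obtain l where l: "l < n" "realizes k l i j" by blast
      have "k \<noteq> l" using realizes_neq km l ij by metis
      have d: "X $$ (k, k) = X $$ (l, l)" "Y $$ (k, k) = Y $$ (l, l)" using X Y km l by (auto simp: matching_blocks_def)
      consider "m = k" | "m = l" | "m \<noteq> k" "m \<noteq> l" by blast
      then show ?thesis
      proof cases
        case 1
        have "X $$ (k, l) * Y $$ (l, k) = Y $$ (k, l) * X $$ (l, k)" using r km l by blast
        then show ?thesis
          unfolding matching_blocks_mult_realizes[OF ij km(1) l X c(2) km(2)] matching_blocks_mult_realizes[OF ij km(1) l Y c(1) km(2)]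
          unfolding 1 by (simp only: mult.commute[of "X $$ (k, k)"])
      next
        case 2 then show ?thesis
          unfolding matching_blocks_mult_realizes[OF ij km(1) l X c(2) km(2)] matching_blocks_mult_realizes[OF ij km(1) l Y c(1) km(2)]
          using d by (simp add: algebra_simps)
      next
        case 3
        have "\<not> realizes k m i j" using realizes_match[OF l(2), of m] km l 3 by auto
        moreover have "\<not> realizes l m i j" using realizes_match[OF realizes_sym[OF l(2)], of m] km l 3 by auto
        ultimately have "X $$ (k, m) = 0" "Y $$ (k, m) = 0" "X $$ (l, m) = 0" "Y $$ (l, m) = 0"
          using X Y km l 3 by (auto simp: matching_blocks_def)
        then show ?thesis
          unfolding matching_blocks_mult_realizes[OF ij km(1) l X c(2) km(2)] matching_blocks_mult_realizes[OF ij km(1) l Y c(1) km(2)] by simp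
      qed
    next
      case False
      then have z: "X $$ (k, q) = 0" "Y $$ (k, q) = 0" if "q < n" "q \<noteq> k" for q
        using X Y km that by (auto simp: matching_blocks_def)
      have "(X * Y) $$ (k, m) = X $$ (k, k) * Y $$ (k, m)"
        by (rule entry_mult_diag[OF c(1) km(1) _ c(2) km(2)]) (rule z(1))
      moreover have "(Y * X) $$ (k, m) = Y $$ (k, k) * X $$ (k, m)"
        by (rule entry_mult_diag[OF c(2) km(1) _ c(1) km(2)]) (rule z(2))
      ultimately show ?thesis using z km by (cases "m = k") simp_all
    qed
  qed (use c in auto)
qed

text \<open>For \<open>n = 4\<close> two complementary pairs \<open>{a, b}\<close> and \<open>{c, d}\<close> carry the weight of \<open>E(i, j)\<close>. If both blocks of the image \<open>X\<close> of \<open>1 + 2 E(i, j)\<close> were non-scalar, matrices of the same block shape commuting with \<open>X\<close> would have off-diagonal parts proportional to those of \<open>X\<close> in each block, so they would commute with each other. But \<open>1 + 2 E(i, j)\<close> commutes with both \<open>1 + 2 E(i', j')\<close> and \<open>1 + 2 E(j', i')\<close> for the complementary indices, and these two do not commute.\<close>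

lemma single_pair:
  assumes ij: "i < n" "j < n" "i \<noteq> j"
  shows "\<exists>a<n. \<exists>b<n. realizes a b i j \<and>
    (\<forall>k<n. \<forall>l<n. k \<noteq> l \<longrightarrow> \<rho> (elem n i j 2) $$ (k, l) \<noteq> 0 \<longrightarrow> {k, l} = {a, b})"
proof (cases "n = 4")
  case False
  obtain a b where ab: "a < n" "b < n" "realizes a b i j" using realizes_exists[OF ij] by blast
  then show ?thesis using realizes_unique[OF False ij ab] entry_realizes[OF ij] by metis
next
  case True
  show ?thesis
  proof (rule ccontr)
    assume no: "\<not> ?thesis"
    let ?X = "\<rho> (elem n i j 2)"
    obtain a b where ab: "a < n" "b < n" "realizes a b i j" using realizes_exists[OF ij] by blast
    have no: "\<exists>k<n. \<exists>l<n. k \<noteq> l \<and> ?X $$ (k, l) \<noteq> 0 \<and> {k, l} \<noteq> {a, b}"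
      if "a < n" "b < n" "realizes a b i j" for a b
      using no that by blast
    obtain c d where cd: "c < n" "d < n" "c \<noteq> d" "?X $$ (c, d) \<noteq> 0" "{c, d} \<noteq> {a, b}"
      using no[OF ab] by (elim exE conjE) blast
    have Qcd: "realizes c d i j" using entry_realizes[OF ij cd(1-4)] .
    obtain a' b' where a'b': "a' < n" "b' < n" "a' \<noteq> b'" "?X $$ (a', b') \<noteq> 0" "{a', b'} \<noteq> {c, d}"
      using no[OF cd(1,2) Qcd] by (elim exE conjE) blast
    have Qa'b': "realizes a' b' i j" using entry_realizes[OF ij a'b'(1-4)] .
    have disj: "a' \<noteq> c" "a' \<noteq> d" "b' \<noteq> c" "b' \<noteq> d"
      using realizes_match realizes_sym Qcd Qa'b' cd a'b' by (metis insert_commute)+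
    have "card {a', b', c, d} = card {..<n}" using disj cd a'b' True by simp
    then have all: "{a', b', c, d} = {..<n}" using cd a'b' by (intro card_subset_eq) auto
    \<comment> \<open>By assumption no single pair contains the support, so every block is nonzero.\<close>
    have nz: "?X $$ (k, l) \<noteq> 0 \<or> ?X $$ (l, k) \<noteq> 0" if kl: "k < n" "l < n" "realizes k l i j" for k l
    proof -
      have "k \<in> {a', b', c, d}" using all kl by auto
      then have "{k, l} = {a', b'} \<or> {k, l} = {c, d}"
        using realizes_match[OF kl(3) _ kl(1,2)] Qa'b' Qcd realizes_sym cd a'b' by blast
      then show ?thesis using cd a'b' by (auto simp: doubleton_eq_iff)
    qed
    have "card ({..<n} - {i, j}) = 2" using ij True by (simp add: card_Diff_subset)
    then obtain i' j' where i'j': "{..<n} - {i, j} = {i', j'}" "i' \<noteq> j'" by (auto simp: card_2_iff)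
    have all': "u \<in> {i, j, i', j'}" if "u < n" for u using i'j' that by blast
    have dis: "i' < n" "j' < n" "i \<noteq> i'" "i \<noteq> j'" "j \<noteq> i'" "j \<noteq> j'" using i'j' by auto
    have pr': "same_side i' j' u v = same_side i j u v" if "u < n" "v < n" for u v
      using all'[OF that(1)] all'[OF that(2)] dis i'j'(2) ij(3) unfolding same_side_def by blast
    then have Q': "realizes k l i' j' = realizes k l i j" for k l by (simp add: realizes_def)
    have Q'': "realizes k l j' i' = realizes k l i j" for k l using Q' realizes_sym' by blast
    let ?Y = "\<rho> (elem n i' j' 2)" and ?Z = "\<rho> (elem n j' i' 2)"
    have X: "matching_blocks i j ?X" using matching_blocks_rep ij by blast
    have Y: "matching_blocks i j ?Y" using matching_blocks_rep[of i' j'] dis i'j' by (simp add: matching_blocks_def Q')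
    have Z: "matching_blocks i j ?Z" using matching_blocks_rep[of j' i'] dis i'j' by (simp add: matching_blocks_def Q'')
    have "?X * ?Y = ?Y * ?X"
      using elem_commute[of i n j i' j' 2 2] dis i'j' ij by (metis rep_mult special_elem)
    then have XY: "?X $$ (k, l) * ?Y $$ (l, k) = ?Y $$ (k, l) * ?X $$ (l, k)"
      if "k < n" "l < n" "realizes k l i j" for k l using matching_blocks_commute_iff[OF ij X Y] that by blast
    have "?X * ?Z = ?Z * ?X"
      using elem_commute[of i n j j' i' 2 2] dis i'j' ij by (metis rep_mult special_elem)
    then have XZ: "?X $$ (k, l) * ?Z $$ (l, k) = ?Z $$ (k, l) * ?X $$ (l, k)"
      if "k < n" "l < n" "realizes k l i j" for k l using matching_blocks_commute_iff[OF ij X Z] that by blast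
    \<comment> \<open>If \<open>(y, y')\<close> and \<open>(z, z')\<close> are both proportional to the nonzero vector \<open>(x, x')\<close>, they are proportional to each other.\<close>
    have para: "y * z' = z * y'" if "x * y' = y * x'" "x * z' = z * x'" "x \<noteq> 0 \<or> x' \<noteq> 0"
      for x x' y y' z z' :: 'b
    proof -
      have "x * (y * z' - z * y') = y * (x * z') - z * (x * y')" by (simp add: algebra_simps)
      also have "\<dots> = 0" using that by simp
      finally have 1: "x * (y * z' - z * y') = 0" .
      have "x' * (y * z' - z * y') = (y * x') * z' - (z * x') * y'" by (simp add: algebra_simps)
      also have "\<dots> = 0" using that(1,2)[symmetric] by simp
      finally show ?thesis using 1 that(3) by auto
    qed
    have "?Y * ?Z = ?Z * ?Y"
      unfolding matching_blocks_commute_iff[OF ij Y Z] using para[OF XY XZ nz] by blast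
    then have "elem n i' j' 2 * elem n j' i' (2 :: 'a) = elem n j' i' 2 * elem n i' j' 2"
      using dis i'j'(2) rep_mult by (metis rep_inj special_elem special_mult)
    moreover have "(2 :: 'a) * 2 \<noteq> 0" using two_dom no_zero_divisors by blast
    then have "elem n i' j' 2 * elem n j' i' (2 :: 'a) \<noteq> elem n j' i' 2 * elem n i' j' 2"
      using dis i'j'(2) by (metis elem_not_commute)
    ultimately show False by blast
  qed
qed

text \<open>Equal to the identity outside the coordinates \<open>a\<close> and \<open>b\<close>, with a block of determinant 1 and constant diagonal there.\<close>

definition pair_block :: "nat \<Rightarrow> nat \<Rightarrow> 'b mat \<Rightarrow> bool" where
  "pair_block a b X \<longleftrightarrow> X \<in> carrier_mat n n \<and> a < n \<and> b < n \<and> a \<noteq> b \<and>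
    (\<forall>k<n. \<forall>l<n. k \<notin> {a, b} \<or> l \<notin> {a, b} \<longrightarrow> X $$ (k, l) = (if k = l then 1 else 0)) \<and>
    X $$ (a, a) = X $$ (b, b) \<and> X $$ (a, a) * X $$ (a, a) - X $$ (a, b) * X $$ (b, a) = 1"

lemma pair_block_sym: "pair_block a b X \<Longrightarrow> pair_block b a X"
  by (auto simp: pair_block_def insert_commute mult.commute)

text \<open>The image of \<open>1 + 2 E(i, j)\<close> has diagonal entries \<open>\<plusminus>1\<close> outside its pair, so its square is the identity there.\<close>

lemma block_form:
  assumes ij: "i < n" "j < n" "i \<noteq> j"
  shows "\<exists>a b. realizes a b i j \<and> pair_block a b (\<rho> (elem n i j 4))"
proof -
  obtain a b where ab: "a < n" "b < n" "realizes a b i j"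
    and supp: "\<forall>k<n. \<forall>l<n. k \<noteq> l \<longrightarrow> \<rho> (elem n i j 2) $$ (k, l) \<noteq> 0 \<longrightarrow> {k, l} = {a, b}"
    using single_pair[OF ij] by (elim exE conjE)
  let ?X = "\<rho> (elem n i j 2)"
  have "a \<noteq> b" using realizes_neq ab ij by metis
  have sq: "\<rho> (elem n i j 4) = ?X * ?X" using rep_elem_add[OF ij, of 2 2] by simp
  have c: "?X \<in> carrier_mat n n" using ij by simp
  have z: "?X $$ (k, l) = 0" if "k < n" "l < n" "k \<noteq> l" "k \<notin> {a, b} \<or> l \<notin> {a, b}" for k l
    using supp[rule_format, of k l] that by (metis insertCI)
  have "(?X * ?X) $$ (k, l) = (if k = l then 1 else 0)"
    if kl: "k < n" "l < n" and o: "k \<notin> {a, b} \<or> l \<notin> {a, b}" for k l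
  proof -
    have s: "?X $$ (q, q) * ?X $$ (q, q) = 1" if "q < n" "q \<notin> {a, b}" for q
      using that z by (intro diag_entry_sq[OF ij]) auto
    have "(?X * ?X) $$ (k, l) = ?X $$ (k, k) * ?X $$ (k, l)" if "k \<notin> {a, b}"
      using that z kl by (intro entry_mult_diag[OF c kl(1) _ c kl(2)]) auto
    moreover have "(?X * ?X) $$ (k, l) = ?X $$ (k, l) * ?X $$ (l, l)" if "l \<notin> {a, b}"
      using that z kl c by (subst index_mult_mat_sum[where n = n]) (auto intro!: sum_supp_one)
    ultimately show ?thesis using o s z kl by (cases "k = l") auto
  qed
  moreover have "(?X * ?X) $$ (a, a) = (?X * ?X) $$ (b, b)"
    using block_relations(3)[OF ij ab, of 2] sq by simp
  moreover have "(?X * ?X) $$ (a, a) * (?X * ?X) $$ (a, a) - (?X * ?X) $$ (a, b) * (?X * ?X) $$ (b, a) = 1"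
    using block_relations(1)[OF ij ab, of 4] sq by simp
  ultimately have "pair_block a b (\<rho> (elem n i j 4))"
    unfolding pair_block_def sq using ab \<open>a \<noteq> b\<close> mult_carrier_square[OF c c] by simp
  then show ?thesis using ab by blast
qed

end

section \<open>Commuting blocks are transvections\<close>

lemma elem_unique:
  assumes "elem n a b q = elem n a' b' (q' :: 'a::comm_ring_1)" "q \<noteq> 0" "a \<noteq> b" "a < n" "b < n"
  shows "a = a' \<and> b = b'"
proof -
  have "elem n a b q $$ (a, b) = elem n a' b' q' $$ (a, b)" by (simp only: assms(1))
  then have "q = (if a = a' \<and> b = b' then q' else 0)" using assms(3-5) by (simp add: elem_index)
  then show ?thesis using assms(2) by (metis)
qed

lemma mult_right_cancel_mat:
  assumes "A \<in> carrier_mat n n" "B \<in> carrier_mat n n" "C \<in> carrier_mat n n" "C' \<in> carrier_mat n n"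
    and "C * C' = 1\<^sub>m n" "A * C = B * (C :: 'a::comm_ring_1 mat)"
  shows "A = B"
proof -
  have "A = A * C * C'" using assms(1,5) assoc_mult_mat[OF assms(1,3,4)] by simp
  also have "\<dots> = B * C * C'" by (simp only: assms(6))
  also have "\<dots> = B" using assms(2,5) assoc_mult_mat[OF assms(2,3,4)] by simp
  finally show ?thesis .
qed

text \<open>Commuting with \<open>1 + q E(a, b)\<close> means commuting with \<open>E(a, b)\<close>.\<close>

lemma commute_elem_entries:
  fixes Z :: "'a::idom mat"
  assumes Z: "Z \<in> carrier_mat n n" and ab: "a < n" "b < n" and q: "q \<noteq> 0"
    and eq: "Z * elem n a b q = elem n a b q * Z"
  shows "\<And>k. k < n \<Longrightarrow> k \<noteq> a \<Longrightarrow> Z $$ (k, a) = 0"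
    and "\<And>l. l < n \<Longrightarrow> l \<noteq> b \<Longrightarrow> Z $$ (b, l) = 0"
    and "Z $$ (a, a) = Z $$ (b, b)"
proof -
  have *: "(if l = b then Z $$ (k, a) * q else 0) = (if k = a then q * Z $$ (b, l) else 0)"
    if "k < n" "l < n" for k l
  proof -
    have "(Z * elem n a b q) $$ (k, l) = (elem n a b q * Z) $$ (k, l)" by (simp only: eq)
    then show ?thesis using that ab by (simp add: mult_elem_index[OF Z] elem_mult_index[OF Z])
  qed
  show "Z $$ (k, a) = 0" if "k < n" "k \<noteq> a" for k using *[of k b] that ab q by simp
  show "Z $$ (b, l) = 0" if "l < n" "l \<noteq> b" for l using *[of a l] that ab q by simp
  show "Z $$ (a, a) = Z $$ (b, b)" using *[of a b] ab q by simp
qed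

text \<open>Conjugation by \<open>g\<close>, with inverse \<open>g'\<close>, after applying the ring homomorphism \<open>c\<close> to the entries. Only elementary matrices are considered, which determines \<open>\<rho>\<close> on all their products.\<close>

definition std_form :: "nat \<Rightarrow> ('a::idom mat \<Rightarrow> 'f::field mat) \<Rightarrow> 'f mat \<Rightarrow> 'f mat \<Rightarrow> ('a \<Rightarrow> 'f) \<Rightarrow> bool" where
  "std_form n \<rho> g g' c \<longleftrightarrow> g \<in> carrier_mat n n \<and> g' \<in> carrier_mat n n \<and> g * g' = 1\<^sub>m n \<and> g' * g = 1\<^sub>m n \<and>
    c 1 = 1 \<and> (\<forall>x y. c (x + y) = c x + c y) \<and> (\<forall>x y. c (x * y) = c x * c y) \<and>
    (\<forall>i j x. i < n \<longrightarrow> j < n \<longrightarrow> i \<noteq> j \<longrightarrow> \<rho> (elem n i j x) = g * elem n i j (c x) * g')"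

context diag_rep
begin

lemma mult_unit_row:
  assumes "X \<in> carrier_mat n n" "Y \<in> carrier_mat n n" "k < n" "m < n"
    and "\<And>q. q < n \<Longrightarrow> X $$ (k, q) = (if k = q then 1 else 0 :: 'b)"
  shows "(X * Y) $$ (k, m) = Y $$ (k, m)"
  using assms by (subst entry_mult_diag) auto

lemma mult_unit_rows:
  assumes "X \<in> carrier_mat n n" "Y \<in> carrier_mat n n" "k < n" "m < n"
    and "\<And>q. q < n \<Longrightarrow> X $$ (k, q) \<noteq> 0 \<Longrightarrow> Y $$ (q, m) = (if q = m then 1 else 0 :: 'b)"
  shows "(X * Y) $$ (k, m) = X $$ (k, m)"
proof -
  have "(X * Y) $$ (k, m) = (\<Sum>q<n. X $$ (k, q) * Y $$ (q, m))"
    by (rule index_mult_mat_sum[OF assms(1-4)])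
  also have "\<dots> = (\<Sum>q<n. if q = m then X $$ (k, q) else 0)"
    using assms(5) by (intro sum.cong) force+
  finally show ?thesis using assms(4) by simp
qed

lemma pair_block_disjoint_commute:
  assumes X: "pair_block a b X" and Y: "pair_block c d Y" and disj: "{a, b} \<inter> {c, d} = {}"
  shows "X * Y = Y * X"
proof (rule eq_matI)
  have cX: "X \<in> carrier_mat n n" and cY: "Y \<in> carrier_mat n n" using X Y by (auto simp: pair_block_def)
  have x: "X $$ (k, l) = (if k = l then 1 else 0)" if "k < n" "l < n" "k \<notin> {a, b} \<or> l \<notin> {a, b}" for k l
    using X that unfolding pair_block_def by blast
  have y: "Y $$ (k, l) = (if k = l then 1 else 0)" if "k < n" "l < n" "k \<notin> {c, d} \<or> l \<notin> {c, d}" for k l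
    using Y that unfolding pair_block_def by blast
  fix k m assume "k < dim_row (Y * X)" "m < dim_col (Y * X)"
  then have km: "k < n" "m < n" using cX cY by auto
  show "(X * Y) $$ (k, m) = (Y * X) $$ (k, m)"
  proof (cases "k \<in> {a, b}")
    case True
    have "(X * Y) $$ (k, m) = X $$ (k, m)"
    proof (rule mult_unit_rows[OF cX cY km])
      fix q assume q: "q < n" "X $$ (k, q) \<noteq> 0"
      have "q \<in> {a, b}" using x[OF km(1) q(1)] True q(2) by metis
      then show "Y $$ (q, m) = (if q = m then 1 else 0)" using y[OF q(1) km(2)] disj by blast
    qed
    moreover have "(Y * X) $$ (k, m) = X $$ (k, m)"
      by (rule mult_unit_row[OF cY cX km]) (use y[OF km(1)] True disj in blast)
    ultimately show ?thesis by simp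
  next
    case False
    have 1: "(X * Y) $$ (k, m) = Y $$ (k, m)"
      by (rule mult_unit_row[OF cX cY km]) (use x[OF km(1)] False in blast)
    have "(Y * X) $$ (k, m) = Y $$ (k, m)"
    proof (rule mult_unit_rows[OF cY cX km])
      fix q assume q: "q < n" "Y $$ (k, q) \<noteq> 0"
      have "q \<in> {c, d} \<or> q = k" using y[OF km(1) q(1)] q(2) by metis
      then show "X $$ (q, m) = (if q = m then 1 else 0)" using x[OF q(1) km(2)] disj False by blast
    qed
    then show ?thesis using 1 by simp
  qed
qed (use X Y in \<open>auto simp: pair_block_def\<close>)

lemma pair_block_mult_row:
  assumes X: "pair_block a b X" and Y: "Y \<in> carrier_mat n n" "m < n"
  shows "(X * Y) $$ (a, m) = X $$ (a, a) * Y $$ (a, m) + X $$ (a, b) * Y $$ (b, m)"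
proof -
  have x: "X $$ (a, q) = 0" if "q < n" "q \<noteq> a" "q \<noteq> b" for q
    using X that unfolding pair_block_def by force
  have c: "X \<in> carrier_mat n n" and ab: "a < n" "b < n" "a \<noteq> b" using X by (auto simp: pair_block_def)
  show ?thesis
    unfolding index_mult_mat_sum[OF c Y(1) ab(1) Y(2)]
    by (rule sum_supp_two) (use ab x in auto)
qed

text \<open>Comparing the entries of both products in the rows \<open>a\<close>, \<open>b\<close>, \<open>c\<close> forces both blocks to be unipotent and triangular of the same type: both matrices change only row \<open>a\<close>, or both change only column \<open>a\<close>.\<close>

lemma pair_block_commute:
  assumes X: "pair_block a b X" and Y: "pair_block a c Y" and bc: "b \<noteq> c" and eq: "X * Y = Y * X"
    and nX: "X $$ (a, b) \<noteq> 0 \<or> X $$ (b, a) \<noteq> 0" and nY: "Y $$ (a, c) \<noteq> 0 \<or> Y $$ (c, a) \<noteq> 0"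
  shows "X $$ (a, a) = 1 \<and> Y $$ (a, a) = 1 \<and>
    (X $$ (b, a) = 0 \<and> Y $$ (c, a) = 0 \<or> X $$ (a, b) = 0 \<and> Y $$ (a, c) = 0)"
proof -
  have cX: "X \<in> carrier_mat n n" and cY: "Y \<in> carrier_mat n n"
    and lt: "a < n" "b < n" "c < n" and ne: "a \<noteq> b" "a \<noteq> c"
    and d: "X $$ (a, a) = X $$ (b, b)" "Y $$ (a, a) = Y $$ (c, c)"
    using X Y by (auto simp: pair_block_def)
  have x: "X $$ (k, l) = (if k = l then 1 else 0)" if "k < n" "l < n" "k \<notin> {a, b} \<or> l \<notin> {a, b}" for k l
    using X that unfolding pair_block_def by blast
  have y: "Y $$ (k, l) = (if k = l then 1 else 0)" if "k < n" "l < n" "k \<notin> {a, c} \<or> l \<notin> {a, c}" for k l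
    using Y that unfolding pair_block_def by blast
  have Xa: "(X * Y) $$ (a, m) = X $$ (a, a) * Y $$ (a, m) + X $$ (a, b) * Y $$ (b, m)"
    and Xb: "(X * Y) $$ (b, m) = X $$ (b, b) * Y $$ (b, m) + X $$ (b, a) * Y $$ (a, m)"
    and Xc: "(X * Y) $$ (c, m) = Y $$ (c, m)"
    and Ya: "(Y * X) $$ (a, m) = Y $$ (a, a) * X $$ (a, m) + Y $$ (a, c) * X $$ (c, m)"
    and Yc: "(Y * X) $$ (c, m) = Y $$ (c, c) * X $$ (c, m) + Y $$ (c, a) * X $$ (a, m)"
    and Yb: "(Y * X) $$ (b, m) = X $$ (b, m)" if "m < n" for m
    using pair_block_mult_row[OF X cY that] pair_block_mult_row[OF pair_block_sym[OF X] cY that]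
      pair_block_mult_row[OF Y cX that] pair_block_mult_row[OF pair_block_sym[OF Y] cX that]
      mult_unit_row[OF cX cY lt(3) that] mult_unit_row[OF cY cX lt(2) that] x[OF lt(3)] y[OF lt(2)] bc ne
    by simp_all
  have z: "X $$ (a, c) = 0" "X $$ (b, c) = 0" "X $$ (c, a) = 0" "X $$ (c, b) = 0" "X $$ (c, c) = 1"
    "Y $$ (a, b) = 0" "Y $$ (c, b) = 0" "Y $$ (b, a) = 0" "Y $$ (b, c) = 0" "Y $$ (b, b) = 1"
    using x y lt ne bc by auto
  have "X $$ (a, b) = Y $$ (a, a) * X $$ (a, b)"
    using Xa[OF lt(2)] Ya[OF lt(2)] eq z by simp
  moreover have "X $$ (a, a) * Y $$ (a, c) = Y $$ (a, c)"
    using Xa[OF lt(3)] Ya[OF lt(3)] eq z by simp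
  moreover have "X $$ (b, a) * Y $$ (a, a) = X $$ (b, a)"
    using Xb[OF lt(1)] Yb[OF lt(1)] eq z by simp
  moreover have "X $$ (b, a) * Y $$ (a, c) = 0"
    using Xb[OF lt(3)] Yb[OF lt(3)] eq z by simp
  moreover have "Y $$ (c, a) = Y $$ (c, a) * X $$ (a, a)"
    using Xc[OF lt(1)] Yc[OF lt(1)] eq z by simp
  moreover have "Y $$ (c, a) * X $$ (a, b) = 0"
    using Xc[OF lt(2)] Yc[OF lt(2)] eq z by simp
  ultimately show ?thesis using nX nY by (auto simp: mult.commute)
qed

lemma pair_block_elem:
  assumes X: "pair_block a b X" and "X $$ (a, a) = 1" "X $$ (b, a) = 0"
  shows "X = elem n a b (X $$ (a, b))"
proof (rule eq_matI)
  fix k l assume "k < dim_row (elem n a b (X $$ (a, b)))" "l < dim_col (elem n a b (X $$ (a, b)))"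
  then have kl: "k < n" "l < n" by auto
  have x: "X $$ (k, l) = (if k = l then 1 else 0)" if "k \<notin> {a, b} \<or> l \<notin> {a, b}"
    using X that kl unfolding pair_block_def by blast
  have "X $$ (b, b) = 1" "a \<noteq> b" using X assms(2) by (auto simp: pair_block_def)
  then show "X $$ (k, l) = elem n a b (X $$ (a, b)) $$ (k, l)"
    using kl x assms by (cases "k \<in> {a, b} \<and> l \<in> {a, b}") (auto simp: elem_index)
qed (use X in \<open>auto simp: pair_block_def\<close>)

text \<open>A diagonal block has entries \<open>\<plusminus>1\<close>, so the image would have order at most two.\<close>

lemma pair_block_rep_nonzero:
  assumes ij: "i < n" "j < n" "i \<noteq> j" and X: "pair_block a b (\<rho> (elem n i j 4))"
  shows "\<rho> (elem n i j 4) $$ (a, b) \<noteq> 0 \<or> \<rho> (elem n i j 4) $$ (b, a) \<noteq> 0"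
proof (rule ccontr)
  let ?X = "\<rho> (elem n i j 4)"
  assume "\<not> ?thesis"
  then have z: "?X $$ (a, b) = 0" "?X $$ (b, a) = 0" by auto
  have c: "?X \<in> carrier_mat n n" using ij by simp
  have x: "?X $$ (k, l) = (if k = l then 1 else 0)" if "k < n" "l < n" "k \<notin> {a, b} \<or> l \<notin> {a, b}" for k l
    using X that unfolding pair_block_def by blast
  have d: "?X $$ (a, a) * ?X $$ (a, a) = 1" "?X $$ (b, b) * ?X $$ (b, b) = 1"
    using X z unfolding pair_block_def by auto
  have off: "?X $$ (k, l) = 0" if "k < n" "l < n" "k \<noteq> l" for k l
    using x[of k l] z that by (cases "k \<in> {a, b} \<and> l \<in> {a, b}") auto
  have sq: "?X $$ (k, k) * ?X $$ (k, k) = 1" if "k < n" for k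
    using x[of k k] d that by (cases "k \<in> {a, b}") auto
  have "?X * ?X = 1\<^sub>m n"
  proof (rule eq_matI)
    fix k l assume "k < dim_row (1\<^sub>m n :: 'b mat)" "l < dim_col (1\<^sub>m n :: 'b mat)"
    then have kl: "k < n" "l < n" by auto
    have "(?X * ?X) $$ (k, l) = ?X $$ (k, k) * ?X $$ (k, l)"
      using off kl by (intro entry_mult_diag[OF c _ _ c]) auto
    then show "(?X * ?X) $$ (k, l) = 1\<^sub>m n $$ (k, l)" using off sq kl by (cases "k = l") auto
  qed (use c in auto)
  then have "\<rho> (elem n i j 8) = \<rho> (elem n i j 0)" using rep_elem_add[OF ij, of 4 4] by (simp add: rep_one)
  then have "elem n i j (8 :: 'a) = elem n i j 0" using ij by (intro rep_inj) auto
  then have "(8 :: 'a) = 0" by (rule elem_inj[OF ij(1,2)])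
  moreover have "(8 :: 'a) = 2 * (2 * 2)" by simp
  ultimately show False using two_dom no_zero_divisors by metis
qed

lemma rep_commute_iff:
  assumes "A \<in> special n" "B \<in> special n"
  shows "\<rho> A * \<rho> B = \<rho> B * \<rho> A \<longleftrightarrow> A * B = B * A"
  using assms by (metis rep_mult rep_inj special_mult)

lemma four_nz: "(4 :: 'a) * 4 \<noteq> 0" "(4 :: 'a) \<noteq> 0"
proof -
  have "(4 :: 'a) = 2 * 2" by simp
  then show "(4 :: 'a) \<noteq> 0" using two_dom no_zero_divisors by metis
  then show "(4 :: 'a) * 4 \<noteq> 0" using no_zero_divisors by blast
qed

lemma pair_block_meet:
  assumes "i < n" "j < n" "k < n" "i \<noteq> j" "j \<noteq> k"
    and "pair_block a b (\<rho> (elem n i j 4))" "pair_block c d (\<rho> (elem n j k 4))"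
  shows "{a, b} \<inter> {c, d} \<noteq> {}"
proof
  assume "{a, b} \<inter> {c, d} = {}"
  then have "\<rho> (elem n i j 4) * \<rho> (elem n j k 4) = \<rho> (elem n j k 4) * \<rho> (elem n i j 4)"
    using pair_block_disjoint_commute assms(6,7) by blast
  then have "elem n i j 4 * elem n j k 4 = elem n j k 4 * elem n i j (4 :: 'a)"
    using assms by (subst (asm) rep_commute_iff) auto
  then show False using elem_not_commute[OF assms(1-5) four_nz(1)] by blast
qed

text \<open>The elementary matrices at \<open>(0, j)\<close> and \<open>(j, 0)\<close> have the same weight and do not commute. So their pairs meet, and two pairs of the same weight that meet are equal.\<close>

lemma block_form_opposite:
  assumes j: "j < n" "0 < j"
  shows "\<exists>a b. realizes a b 0 j \<and> pair_block a b (\<rho> (elem n 0 j 4)) \<and> pair_block a b (\<rho> (elem n j 0 4))"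
proof -
  have n: "0 < n" using n3 by simp
  obtain a b where ab: "realizes a b 0 j" "pair_block a b (\<rho> (elem n 0 j 4))" using block_form[of 0 j] j n by auto
  obtain c d where cd: "realizes c d j 0" "pair_block c d (\<rho> (elem n j 0 4))" using block_form[of j 0] j n by auto
  have "{a, b} \<inter> {c, d} \<noteq> {}" using pair_block_meet[OF n j(1) n _ _ ab(2) cd(2)] j by simp
  moreover have lt: "a < n" "b < n" "c < n" "d < n" using ab(2) cd(2) by (auto simp: pair_block_def)
  moreover have "realizes c d 0 j" using realizes_sym'[OF cd(1)] .
  moreover have "b = d" if "a = c" "realizes c d 0 j" using realizes_match[OF ab(1), of d] that lt by blast
  moreover have "b = c" if "a = d" "realizes c d 0 j" using realizes_match[OF ab(1), of c] realizes_sym that lt by blast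
  moreover have "a = d" if "b = c" "realizes c d 0 j" using realizes_match[OF realizes_sym[OF ab(1)], of d] that lt by blast
  moreover have "a = c" if "b = d" "realizes c d 0 j" using realizes_match[OF realizes_sym[OF ab(1)], of c] realizes_sym that lt by blast
  ultimately have "c = a \<and> d = b \<or> c = b \<and> d = a" by blast
  then have "pair_block a b (\<rho> (elem n j 0 4))" using cd(2) pair_block_sym by blast
  then show ?thesis using ab by blast
qed

text \<open>The images of the elementary matrices at \<open>(0, j)\<close> and \<open>(0, k)\<close> sit in a common row \<open>a\<close>, those at \<open>(j, 0)\<close> and \<open>(k, 0)\<close> in the column \<open>a\<close>.\<close>

definition row_pair :: "nat \<Rightarrow> nat \<Rightarrow> nat \<Rightarrow> nat \<Rightarrow> nat \<Rightarrow> bool" where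
  "row_pair j k a b c \<longleftrightarrow> (\<exists>q q' r r'. q \<noteq> 0 \<and> q' \<noteq> 0 \<and> r \<noteq> 0 \<and> r' \<noteq> 0 \<and>
    \<rho> (elem n 0 j 4) = elem n a b q \<and> \<rho> (elem n 0 k 4) = elem n a c q' \<and>
    \<rho> (elem n j 0 4) = elem n b a r \<and> \<rho> (elem n k 0 4) = elem n c a r')"

text \<open>The transposed situation, which occurs for the inverse transpose representation.\<close>

definition col_pair :: "nat \<Rightarrow> nat \<Rightarrow> nat \<Rightarrow> nat \<Rightarrow> nat \<Rightarrow> bool" where
  "col_pair j k a b c \<longleftrightarrow> (\<exists>q q' r r'. q \<noteq> 0 \<and> q' \<noteq> 0 \<and> r \<noteq> 0 \<and> r' \<noteq> 0 \<and>
    \<rho> (elem n 0 j 4) = elem n b a q \<and> \<rho> (elem n 0 k 4) = elem n c a q' \<and>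
    \<rho> (elem n j 0 4) = elem n a b r \<and> \<rho> (elem n k 0 4) = elem n a c r')"

text \<open>The elementary matrices at \<open>(0, j)\<close> and \<open>(k, 0)\<close> do not commute, so the pairs of \<open>j\<close> and \<open>k\<close> meet; their weights differ, so they meet in a single coordinate \<open>a\<close>. Both the matrices at \<open>(0, j)\<close>, \<open>(0, k)\<close> and those at \<open>(j, 0)\<close>, \<open>(k, 0)\<close> commute, which makes each of these couples of row type or of column type at \<open>a\<close>. The types are opposite, because the matrices at \<open>(0, j)\<close> and \<open>(j, 0)\<close> do not commute.\<close>

lemma row_or_col_pair:
  assumes jk: "j < n" "k < n" "0 < j" "0 < k" "j \<noteq> k"
  shows "\<exists>a b c. a < n \<and> b < n \<and> c < n \<and> a \<noteq> b \<and> a \<noteq> c \<and> b \<noteq> c \<and> (row_pair j k a b c \<or> col_pair j k a b c)"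
proof -
  have n: "0 < n" using n3 by simp
  obtain a0 b0 where ab0: "realizes a0 b0 0 j" "pair_block a0 b0 (\<rho> (elem n 0 j 4))" "pair_block a0 b0 (\<rho> (elem n j 0 4))"
    using block_form_opposite jk by blast
  obtain c0 d0 where cd0: "realizes c0 d0 0 k" "pair_block c0 d0 (\<rho> (elem n 0 k 4))" "pair_block c0 d0 (\<rho> (elem n k 0 4))"
    using block_form_opposite jk by blast
  have meet: "{a0, b0} \<inter> {c0, d0} \<noteq> {}"
    using pair_block_meet[OF jk(1) n jk(2) _ _ ab0(3) cd0(2)] jk by simp
  have "\<not> realizes a0 b0 0 k"
  proof
    assume "realizes a0 b0 0 k"
    then have "same_side 0 j 0 j = same_side 0 k 0 j" using realizes_determines_same_side ab0(1) n jk by blast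
    then show False using jk by (auto simp: same_side_def)
  qed
  then have ne: "{a0, b0} \<noteq> {c0, d0}" using cd0(1) realizes_sym by (metis doubleton_eq_iff)
  obtain a where a: "a \<in> {a0, b0}" "a \<in> {c0, d0}" using meet by blast
  obtain b where b: "{a0, b0} = {a, b}" using a(1) by (metis insertE insert_commute singletonD)
  obtain c where c: "{c0, d0} = {a, c}" using a(2) by (metis insertE insert_commute singletonD)
  have abc: "b \<noteq> c" "{a0, b0} = {a, b}" "{c0, d0} = {a, c}" using b c ne by auto
  have X: "pair_block a b (\<rho> (elem n 0 j 4))" "pair_block a b (\<rho> (elem n j 0 4))"
    and Y: "pair_block a c (\<rho> (elem n 0 k 4))" "pair_block a c (\<rho> (elem n k 0 4))"
    using ab0 cd0 abc pair_block_sym by (metis doubleton_eq_iff)+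
  have lt: "a < n" "b < n" "c < n" "a \<noteq> b" "a \<noteq> c" using X Y by (auto simp: pair_block_def)
  let ?X = "\<rho> (elem n 0 j 4)" and ?Y = "\<rho> (elem n 0 k 4)" and ?X' = "\<rho> (elem n j 0 4)" and ?Y' = "\<rho> (elem n k 0 4)"
  have nz: "?X $$ (a, b) \<noteq> 0 \<or> ?X $$ (b, a) \<noteq> 0" "?Y $$ (a, c) \<noteq> 0 \<or> ?Y $$ (c, a) \<noteq> 0"
    "?X' $$ (a, b) \<noteq> 0 \<or> ?X' $$ (b, a) \<noteq> 0" "?Y' $$ (a, c) \<noteq> 0 \<or> ?Y' $$ (c, a) \<noteq> 0"
    using pair_block_rep_nonzero X Y n jk by simp_all
  have "?X * ?Y = ?Y * ?X"
    using elem_commute[of 0 n j 0 k 4 4] jk n by (subst rep_commute_iff) auto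
  note c1 = pair_block_commute[OF X(1) Y(1) abc(1) this nz(1,2)]
  have "?X' * ?Y' = ?Y' * ?X'"
    using elem_commute[of j n 0 k 0 4 4] jk n by (subst rep_commute_iff) auto
  note c2 = pair_block_commute[OF X(2) Y(2) abc(1) this nz(3,4)]
  have nc: "?X * ?X' \<noteq> ?X' * ?X"
    using elem_not_commute[of 0 n j 0 4 "4 :: 'a"] jk n four_nz by (subst rep_commute_iff) auto
  have diag1: "?X $$ (b, b) = 1" "?Y $$ (c, c) = 1" "?X' $$ (b, b) = 1" "?Y' $$ (c, c) = 1"
    using c1 c2 X Y by (auto simp: pair_block_def)
  have row: "?X = elem n a b (?X $$ (a, b)) \<and> ?Y = elem n a c (?Y $$ (a, c))"
    if "?X $$ (b, a) = 0 \<and> ?Y $$ (c, a) = 0"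
    using pair_block_elem X(1) Y(1) c1 that by blast
  have col: "?X = elem n b a (?X $$ (b, a)) \<and> ?Y = elem n c a (?Y $$ (c, a))"
    if "?X $$ (a, b) = 0 \<and> ?Y $$ (a, c) = 0"
    using pair_block_elem[OF pair_block_sym[OF X(1)]] pair_block_elem[OF pair_block_sym[OF Y(1)]] diag1 that by blast
  have row': "?X' = elem n a b (?X' $$ (a, b)) \<and> ?Y' = elem n a c (?Y' $$ (a, c))"
    if "?X' $$ (b, a) = 0 \<and> ?Y' $$ (c, a) = 0"
    using pair_block_elem X(2) Y(2) c2 that by blast
  have col': "?X' = elem n b a (?X' $$ (b, a)) \<and> ?Y' = elem n c a (?Y' $$ (c, a))"
    if "?X' $$ (a, b) = 0 \<and> ?Y' $$ (a, c) = 0"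
    using pair_block_elem[OF pair_block_sym[OF X(2)]] pair_block_elem[OF pair_block_sym[OF Y(2)]] diag1 that by blast
  have comm: "elem n u v x * elem n u v y = elem n u v y * elem n u v (x :: 'b)" if "u < n" "v < n" "u \<noteq> v" for u v x y
    using that by (simp add: elem_commute)
  consider "?X $$ (b, a) = 0 \<and> ?Y $$ (c, a) = 0" "?X' $$ (b, a) = 0 \<and> ?Y' $$ (c, a) = 0"
    | "?X $$ (b, a) = 0 \<and> ?Y $$ (c, a) = 0" "?X' $$ (a, b) = 0 \<and> ?Y' $$ (a, c) = 0"
    | "?X $$ (a, b) = 0 \<and> ?Y $$ (a, c) = 0" "?X' $$ (b, a) = 0 \<and> ?Y' $$ (c, a) = 0"
    | "?X $$ (a, b) = 0 \<and> ?Y $$ (a, c) = 0" "?X' $$ (a, b) = 0 \<and> ?Y' $$ (a, c) = 0"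
    using c1 c2 by blast
  then have "row_pair j k a b c \<or> col_pair j k a b c"
  proof cases
    case 1
    then have False using nc row row' comm lt by metis
    then show ?thesis ..
  next
    case 2 then show ?thesis using row col' nz unfolding row_pair_def by blast
  next
    case 3 then show ?thesis using col row' nz unfolding col_pair_def by blast
  next
    case 4
    then have False using nc col col' comm lt by metis
    then show ?thesis ..
  qed
  then show ?thesis using lt abc(1) by blast
qed

end

section \<open>Images of elementary matrices under a row type representation\<close>

lemma smult_smult_times: "a \<cdot>\<^sub>m (b \<cdot>\<^sub>m A) = (a * b :: 'a::comm_ring_1) \<cdot>\<^sub>m A"
  by (rule eq_matI) (auto simp: mult.assoc)

lemma one_smult_mat [simp]: "(1 :: 'a::comm_ring_1) \<cdot>\<^sub>m A = A"
  by (rule eq_matI) auto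

context diag_rep
begin

text \<open>Comparison of any \<open>j\<close> with 1 and with 2 shows that row type propagates: were \<open>j\<close> of column type with respect to both, the image at \<open>(0, j)\<close> would sit both in column \<open>b\<close> and in column \<open>c\<close>. The permutation sends 0 to the common row and \<open>j\<close> to the column of the image at \<open>(0, j)\<close>; places \<open>(i, j)\<close> with \<open>i, j \<noteq> 0\<close> follow by a commutator.\<close>

lemma row_case:
  assumes abc: "a < n" "b < n" "c < n" "a \<noteq> b" "a \<noteq> c" "b \<noteq> c" and row: "row_pair 1 2 a b c"
  shows "\<exists>\<pi>. inj_on \<pi> {..<n} \<and> \<pi> ` {..<n} \<subseteq> {..<n} \<and>
    (\<forall>i<n. \<forall>j<n. i \<noteq> j \<longrightarrow> (\<exists>m q. q \<noteq> 0 \<and> \<rho> (elem n i j m) = elem n (\<pi> i) (\<pi> j) q))"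
proof -
  have n: "0 < n" "1 < n" "2 < n" using n3 by auto
  obtain q1 q2 r1 r2 where q: "q1 \<noteq> 0" "q2 \<noteq> 0" "r1 \<noteq> 0" "r2 \<noteq> 0"
    and X1: "\<rho> (elem n 0 1 4) = elem n a b q1" "\<rho> (elem n 1 0 4) = elem n b a r1"
    and X2: "\<rho> (elem n 0 2 4) = elem n a c q2" "\<rho> (elem n 2 0 4) = elem n c a r2"
    using row unfolding row_pair_def by blast
  have "\<exists>d q r. d < n \<and> d \<noteq> a \<and> q \<noteq> 0 \<and> r \<noteq> 0 \<and>
      \<rho> (elem n 0 j 4) = elem n a d q \<and> \<rho> (elem n j 0 4) = elem n d a r" if j: "0 < j" "j < n" for j
  proof -
    consider "j = 1" | "j = 2" | "j \<noteq> 1" "j \<noteq> 2" by blast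
    then show ?thesis
    proof cases
      case 1 then show ?thesis using X1 q abc by metis
    next
      case 2 then show ?thesis using X2 q abc by metis
    next
      case 3
      obtain a' b' c' where lt': "a' < n" "b' < n" "c' < n" "a' \<noteq> b'" "a' \<noteq> c'" "b' \<noteq> c'"
        and p': "row_pair 1 j a' b' c' \<or> col_pair 1 j a' b' c'"
        using row_or_col_pair[of 1 j] j n 3 by auto
      obtain a'' b'' c'' where lt'': "a'' < n" "b'' < n" "c'' < n" "a'' \<noteq> b''" "a'' \<noteq> c''" "b'' \<noteq> c''"
        and p'': "row_pair 2 j a'' b'' c'' \<or> col_pair 2 j a'' b'' c''"
        using row_or_col_pair[of 2 j] j n 3 by auto
      consider "row_pair 1 j a' b' c'" | "row_pair 2 j a'' b'' c''"
        | "col_pair 1 j a' b' c'" "col_pair 2 j a'' b'' c''" using p' p'' by blast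
      then show ?thesis
      proof cases
        case 1
        then obtain s s' t' where "\<rho> (elem n 0 1 4) = elem n a' b' s" "s' \<noteq> 0" "t' \<noteq> 0"
          "\<rho> (elem n 0 j 4) = elem n a' c' s'" "\<rho> (elem n j 0 4) = elem n c' a' t'"
          unfolding row_pair_def by blast
        moreover from this have "a = a'" using elem_unique[of n a b q1] X1 q abc by metis
        ultimately show ?thesis using lt' by metis
      next
        case 2
        then obtain s s' t' where "\<rho> (elem n 0 2 4) = elem n a'' b'' s" "s' \<noteq> 0" "t' \<noteq> 0"
          "\<rho> (elem n 0 j 4) = elem n a'' c'' s'" "\<rho> (elem n j 0 4) = elem n c'' a'' t'"
          unfolding row_pair_def by blast
        moreover from this have "a = a''" using elem_unique[of n a c q2] X2 q abc by metis
        ultimately show ?thesis using lt'' by metis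
      next
        case 3
        obtain s s' where s: "\<rho> (elem n 0 1 4) = elem n b' a' s" "\<rho> (elem n 0 j 4) = elem n c' a' s'" "s' \<noteq> 0"
          using 3(1) unfolding col_pair_def by blast
        obtain t t' where t: "\<rho> (elem n 0 2 4) = elem n b'' a'' t" "\<rho> (elem n 0 j 4) = elem n c'' a'' t'"
          using 3(2) unfolding col_pair_def by blast
        have "b = a'" using elem_unique[of n a b q1] X1 q abc s(1) by metis
        moreover have "c = a''" using elem_unique[of n a c q2] X2 q abc t(1) by metis
        moreover have "a' = a''" using elem_unique[of n c' a' s'] s(2,3) t(2) lt' by metis
        ultimately show ?thesis using abc by simp
      qed
    qed
  qed
  then obtain d q r where d: "\<And>j. 0 < j \<Longrightarrow> j < n \<Longrightarrow> d j < n \<and> d j \<noteq> a \<and> q j \<noteq> 0 \<and> r j \<noteq> 0 \<and>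
      \<rho> (elem n 0 j 4) = elem n a (d j) (q j) \<and> \<rho> (elem n j 0 4) = elem n (d j) a (r j)"
    by metis
  \<comment> \<open>\<open>d j\<close> is the column of the image of the elementary matrix at \<open>(0, j)\<close>.\<close>
  define \<pi> where "\<pi> j = (if j = 0 then a else d j)" for j
  have dinj: "d j \<noteq> d k" if jk: "0 < j" "j < n" "0 < k" "k < n" "j \<noteq> k" for j k
  proof -
    obtain a' b' c' where lt': "a' < n" "b' < n" "c' < n" "a' \<noteq> b'" "a' \<noteq> c'" "b' \<noteq> c'"
      and p': "row_pair j k a' b' c' \<or> col_pair j k a' b' c'"
      using row_or_col_pair[of j k] jk by auto
    from p' show ?thesis
    proof
      assume "row_pair j k a' b' c'"
      then obtain s s' where "\<rho> (elem n 0 j 4) = elem n a' b' s" "\<rho> (elem n 0 k 4) = elem n a' c' s'"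
        unfolding row_pair_def by blast
      then have "d j = b'" "d k = c'"
        using elem_unique[of n a "d j" "q j"] elem_unique[of n a "d k" "q k"] d jk abc by metis+
      then show ?thesis using lt' by simp
    next
      assume "col_pair j k a' b' c'"
      then obtain s s' where "\<rho> (elem n 0 j 4) = elem n b' a' s" "\<rho> (elem n 0 k 4) = elem n c' a' s'"
        unfolding col_pair_def by blast
      then have "a = b'" "a = c'"
        using elem_unique[of n a "d j" "q j"] elem_unique[of n a "d k" "q k"] d jk abc by metis+
      then show ?thesis using lt' by simp
    qed
  qed
  have "inj_on \<pi> {..<n}"
    by (rule inj_onI) (use d dinj in \<open>auto simp: \<pi>_def split: if_splits; metis\<close>)
  moreover have "\<pi> ` {..<n} \<subseteq> {..<n}" using d abc by (auto simp: \<pi>_def)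
  moreover have "\<exists>m q. q \<noteq> 0 \<and> \<rho> (elem n i j m) = elem n (\<pi> i) (\<pi> j) q" if ij: "i < n" "j < n" "i \<noteq> j" for i j
  proof -
    consider "i = 0" "0 < j" | "j = 0" "0 < i" | "0 < i" "0 < j" using ij by fastforce
    then show ?thesis
    proof cases
      case 1 then show ?thesis using d[of j] ij unfolding \<pi>_def by (intro exI[of _ 4] exI[of _ "q j"]) auto
    next
      case 2 then show ?thesis using d[of i] ij unfolding \<pi>_def by (intro exI[of _ 4] exI[of _ "r i"]) auto
    next
      case 3
      let ?U = "elem n i 0 4 :: 'a mat" and ?V = "elem n 0 j 4 :: 'a mat" and ?W = "elem n i j (4 * 4) :: 'a mat"
      let ?u = "elem n (d i) a (r i)" and ?v = "elem n a (d j) (q j)" and ?w = "elem n (d i) (d j) (r i * q j)"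
      have S: "?U \<in> special n" "?V \<in> special n" "?W \<in> special n" using ij n 3 by auto
      have D: "d i < n" "d j < n" "d i \<noteq> a" "d j \<noteq> a" "d i \<noteq> d j" using d ij 3 dinj by auto
      have "\<rho> (?U * ?V) = \<rho> (?W * (?V * ?U))"
        using elem_commutator[of i n 0 j "4 :: 'a" 4] ij n 3 by simp
      then have "\<rho> ?U * \<rho> ?V = \<rho> ?W * (\<rho> ?V * \<rho> ?U)" using S by (simp add: rep_mult)
      then have "\<rho> ?W * (?v * ?u) = ?w * (?v * ?u)"
        using d[of i] d[of j] ij 3 elem_commutator[of "d i" n a "d j" "r i" "q j"] D abc by simp
      moreover have "(?v * ?u) * (elem n (d i) a (- r i) * elem n a (d j) (- q j)) = 1\<^sub>m n"
      proof -
        have "(?v * ?u) * (elem n (d i) a (- r i) * elem n a (d j) (- q j))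
            = ?v * (?u * elem n (d i) a (- r i)) * elem n a (d j) (- q j)"
          by (simp add: assoc_mult_mat[of _ n n _ n _ n])
        then show ?thesis using D abc by (simp add: elem_inverse)
      qed
      ultimately have "\<rho> ?W = ?w"
        using S(3) mult_right_cancel_mat[of "\<rho> ?W" n ?w "?v * ?u" "elem n (d i) a (- r i) * elem n a (d j) (- q j)"]
        by simp
      moreover have "r i * q j \<noteq> 0" using d ij 3 by simp
      ultimately show ?thesis
        using 3 unfolding \<pi>_def by (intro exI[of _ "4 * 4"] exI[of _ "r i * q j"]) simp
    qed
  qed
  ultimately show ?thesis by blast
qed

text \<open>The image commutes with \<open>1 + q E(\<pi> k, \<pi> l)\<close> for all \<open>k \<noteq> j\<close> and \<open>l \<noteq> i\<close>, because \<open>1 + x E(i, j)\<close> commutes with the elementary matrices at \<open>(k, l)\<close>. This kills all entries except the diagonal, which is constant, and the one at \<open>(\<pi> i, \<pi> j)\<close>.\<close>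

lemma perm_case_scalar:
  assumes \<pi>: "inj_on \<pi> {..<n}" "\<pi> ` {..<n} \<subseteq> {..<n}"
    and m: "\<And>i j. i < n \<Longrightarrow> j < n \<Longrightarrow> i \<noteq> j \<Longrightarrow> \<exists>m q. q \<noteq> 0 \<and> \<rho> (elem n i j m) = elem n (\<pi> i) (\<pi> j) q"
    and ij: "i < n" "j < n" "i \<noteq> j"
  shows "\<exists>z c. z \<noteq> 0 \<and> \<rho> (elem n i j x) = z \<cdot>\<^sub>m elem n (\<pi> i) (\<pi> j) c"
proof -
  let ?Z = "\<rho> (elem n i j x)"
  have Z: "?Z \<in> carrier_mat n n" using ij by simp
  have surj: "\<pi> ` {..<n} = {..<n}" using endo_inj_surj[of "{..<n}" \<pi>] \<pi> by auto
  have p: "\<pi> k < n" if "k < n" for k using \<pi>(2) that by auto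
  have pne: "\<pi> k \<noteq> \<pi> l" if "k < n" "l < n" "k \<noteq> l" for k l using inj_onD[OF \<pi>(1)] that by auto
  have comm: "(\<forall>u<n. u \<noteq> \<pi> k \<longrightarrow> ?Z $$ (u, \<pi> k) = 0) \<and> (\<forall>u<n. u \<noteq> \<pi> l \<longrightarrow> ?Z $$ (\<pi> l, u) = 0)
      \<and> ?Z $$ (\<pi> k, \<pi> k) = ?Z $$ (\<pi> l, \<pi> l)"
    if kl: "k < n" "l < n" "k \<noteq> l" "k \<noteq> j" "l \<noteq> i" for k l
  proof -
    obtain m q where mq: "q \<noteq> 0" "\<rho> (elem n k l m) = elem n (\<pi> k) (\<pi> l) q" using m kl by blast
    have "?Z * \<rho> (elem n k l m) = \<rho> (elem n k l m) * ?Z"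
      using elem_commute[of i n j k l x m] ij kl by (subst rep_commute_iff) auto
    then show ?thesis
      using commute_elem_entries[OF Z p[OF kl(1)] p[OF kl(2)] mq(1)] mq(2) by auto
  qed
  define z where "z = ?Z $$ (\<pi> i, \<pi> i)"
  define w where "w = ?Z $$ (\<pi> i, \<pi> j)"
  have third: "\<exists>l<n. l \<noteq> u \<and> l \<noteq> v" for u v using not_in_two[of u v] by metis
  have zz: "?Z $$ (\<pi> l, \<pi> l) = z" if "l < n" for l
    using comm[of i l] ij that unfolding z_def by (cases "l = i") auto
  have off: "?Z $$ (\<pi> k, \<pi> l) = 0" if kl: "k < n" "l < n" "k \<noteq> l" "\<not> (k = i \<and> l = j)" for k l
  proof (cases "l = j")
    case False
    obtain l' where "l' < n" "l' \<noteq> l" "l' \<noteq> i" using third by blast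
    then show ?thesis using comm[of l l'] False kl p pne by auto
  next
    case True
    then have "k \<noteq> i" using kl by auto
    obtain k' where "k' < n" "k' \<noteq> k" "k' \<noteq> j" using third by blast
    then show ?thesis using comm[of k' k] \<open>k \<noteq> i\<close> kl p pne by auto
  qed
  have "z \<noteq> 0"
  proof
    assume "z = 0"
    have jn: "?Z $$ (\<pi> j, u) = 0" if "u < n" for u
    proof -
      have "u \<in> \<pi> ` {..<n}" using that surj by simp
      then obtain l where l: "u = \<pi> l" "l < n" by blast
      show ?thesis
        unfolding l(1) using zz[OF l(2)] off[OF ij(2) l(2)] ij(3) \<open>z = 0\<close> by metis
    qed
    have c': "\<rho> (elem n i j (- x)) \<in> carrier_mat n n" using ij by simp
    have "(?Z * \<rho> (elem n i j (- x))) $$ (\<pi> j, \<pi> j) = 1"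
      using rep_elem_add[OF ij, of x "- x", symmetric] p ij by (simp add: rep_one)
    moreover have "(?Z * \<rho> (elem n i j (- x))) $$ (\<pi> j, \<pi> j) = 0"
      unfolding index_mult_mat_sum[OF Z c' p[OF ij(2)] p[OF ij(2)]]
      by (rule sum.neutral) (use jn in simp)
    ultimately show False by simp
  qed
  moreover have "?Z = z \<cdot>\<^sub>m elem n (\<pi> i) (\<pi> j) (w / z)"
  proof (rule eq_matI)
    fix u v assume "u < dim_row (z \<cdot>\<^sub>m elem n (\<pi> i) (\<pi> j) (w / z))" "v < dim_col (z \<cdot>\<^sub>m elem n (\<pi> i) (\<pi> j) (w / z))"
    then have uv: "u < n" "v < n" by auto
    have "u \<in> \<pi> ` {..<n}" "v \<in> \<pi> ` {..<n}" using uv surj by simp_all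
    then obtain k l where kl: "u = \<pi> k" "k < n" "v = \<pi> l" "l < n" by blast
    have eq: "\<pi> k = \<pi> i \<longleftrightarrow> k = i" "\<pi> l = \<pi> j \<longleftrightarrow> l = j" "\<pi> k = \<pi> l \<longleftrightarrow> k = l"
      using pne kl ij by blast+
    show "?Z $$ (u, v) = (z \<cdot>\<^sub>m elem n (\<pi> i) (\<pi> j) (w / z)) $$ (u, v)"
      using uv zz[OF kl(2)] off[OF kl(2,4)] \<open>z \<noteq> 0\<close> ij unfolding kl
      by (auto simp: elem_index eq w_def)
  qed (use Z in auto)
  ultimately show ?thesis by blast
qed

text \<open>Scalar factors cancel in a commutator.\<close>

lemma perm_case_commutator:
  assumes \<pi>: "inj_on \<pi> {..<n}" "\<pi> ` {..<n} \<subseteq> {..<n}"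
    and m: "\<And>i j. i < n \<Longrightarrow> j < n \<Longrightarrow> i \<noteq> j \<Longrightarrow> \<exists>m q. q \<noteq> 0 \<and> \<rho> (elem n i j m) = elem n (\<pi> i) (\<pi> j) q"
    and ijk: "i < n" "j < n" "k < n" "i \<noteq> j" "j \<noteq> k" "i \<noteq> k"
    and z: "z \<noteq> 0" "\<rho> (elem n i j x) = z \<cdot>\<^sub>m elem n (\<pi> i) (\<pi> j) c"
    and z': "z' \<noteq> 0" "\<rho> (elem n j k y) = z' \<cdot>\<^sub>m elem n (\<pi> j) (\<pi> k) d"
  shows "\<rho> (elem n i k (x * y)) = elem n (\<pi> i) (\<pi> k) (c * d)"
proof -
  have p: "\<pi> k < n" if "k < n" for k using \<pi>(2) that by auto
  have pne: "\<pi> k \<noteq> \<pi> l" if "k < n" "l < n" "k \<noteq> l" for k l using inj_onD[OF \<pi>(1)] that by auto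
  let ?U = "elem n i j x" and ?V = "elem n j k y" and ?W = "elem n i k (x * y)"
  let ?u = "elem n (\<pi> i) (\<pi> j) c" and ?v = "elem n (\<pi> j) (\<pi> k) d" and ?w = "elem n (\<pi> i) (\<pi> k) (c * d)"
  have S: "?U \<in> special n" "?V \<in> special n" "?W \<in> special n" using ijk by auto
  have D: "\<pi> i < n" "\<pi> j < n" "\<pi> k < n" "\<pi> i \<noteq> \<pi> j" "\<pi> j \<noteq> \<pi> k" "\<pi> i \<noteq> \<pi> k" using p pne ijk by auto
  have C: "?u \<in> carrier_mat n n" "?v \<in> carrier_mat n n" "?w \<in> carrier_mat n n" "\<rho> ?W \<in> carrier_mat n n"
    using S by auto
  have "\<rho> (?U * ?V) = \<rho> (?W * (?V * ?U))"
    using elem_commutator[of i n j k x y] ijk by simp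
  then have "\<rho> ?U * \<rho> ?V = \<rho> ?W * (\<rho> ?V * \<rho> ?U)" using S by (simp add: rep_mult)
  then have "(z * z') \<cdot>\<^sub>m (?u * ?v) = (z * z') \<cdot>\<^sub>m (\<rho> ?W * (?v * ?u))"
    unfolding z z' using C
    by (simp add: mult_smult_assoc_mat[of _ n n _ n] mult_smult_distrib[of _ n n _ n] smult_smult_times mult.commute)
  then have "inverse (z * z') \<cdot>\<^sub>m ((z * z') \<cdot>\<^sub>m (?u * ?v)) = inverse (z * z') \<cdot>\<^sub>m ((z * z') \<cdot>\<^sub>m (\<rho> ?W * (?v * ?u)))"
    by simp
  then have "\<rho> ?W * (?v * ?u) = ?u * ?v"
    using z(1) z'(1) left_inverse[of "z * z'"] unfolding smult_smult_times
    by (simp del: inverse_mult_distrib)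
  also have "\<dots> = ?w * (?v * ?u)" by (rule elem_commutator[OF D])
  finally have "\<rho> ?W * (?v * ?u) = ?w * (?v * ?u)" .
  moreover have "(?v * ?u) * (elem n (\<pi> i) (\<pi> j) (- c) * elem n (\<pi> j) (\<pi> k) (- d)) = 1\<^sub>m n"
  proof -
    have "(?v * ?u) * (elem n (\<pi> i) (\<pi> j) (- c) * elem n (\<pi> j) (\<pi> k) (- d))
        = ?v * (?u * elem n (\<pi> i) (\<pi> j) (- c)) * elem n (\<pi> j) (\<pi> k) (- d)"
      by (simp add: assoc_mult_mat[of _ n n _ n _ n])
    then show ?thesis using D by (simp add: elem_inverse)
  qed
  ultimately show ?thesis
    using C mult_right_cancel_mat[of "\<rho> ?W" n ?w "?v * ?u" "elem n (\<pi> i) (\<pi> j) (- c) * elem n (\<pi> j) (\<pi> k) (- d)"]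
    by simp
qed

end

section \<open>Standard form of a faithful representation\<close>

lemma mat_cancel:
  assumes "P * P' = 1\<^sub>m n" "P \<in> carrier_mat n n" "P' \<in> carrier_mat n n" "X \<in> carrier_mat n n"
  shows "P * (P' * X) = (X :: 'a::comm_ring_1 mat)"
  using assms assoc_mult_mat[OF assms(2-4)] by simp

context diag_rep
begin

text \<open>The coefficients \<open>C i j x\<close> satisfy \<open>C i k (x y) = C i j x * C j k y\<close>. Rescaling the basis by \<open>t\<close> makes \<open>C i j 1 = 1\<close>, and then this relation says that \<open>C\<close> is independent of the place and multiplicative.\<close>

lemma perm_case_std:
  assumes \<pi>: "inj_on \<pi> {..<n}" "\<pi> ` {..<n} \<subseteq> {..<n}"
    and m: "\<And>i j. i < n \<Longrightarrow> j < n \<Longrightarrow> i \<noteq> j \<Longrightarrow> \<exists>m q. q \<noteq> 0 \<and> \<rho> (elem n i j m) = elem n (\<pi> i) (\<pi> j) q"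
  shows "\<exists>g g' c. std_form n \<rho> g g' c"
proof -
  have surj: "\<pi> ` {..<n} = {..<n}" using endo_inj_surj[of "{..<n}" \<pi>] \<pi> by auto
  have p: "\<pi> k < n" if "k < n" for k using \<pi>(2) that by auto
  have pne: "\<pi> k \<noteq> \<pi> l" if "k < n" "l < n" "k \<noteq> l" for k l using inj_onD[OF \<pi>(1)] that by auto
  have third: "\<exists>l<n. l \<noteq> u \<and> l \<noteq> v" for u v using not_in_two[of u v] by metis
  define C where "C i j x = \<rho> (elem n i j x) $$ (\<pi> i, \<pi> j)" for i j x
  have C_val: "C i j x = c" if "\<rho> (elem n i j x) = elem n (\<pi> i) (\<pi> j) c" "i < n" "j < n" "i \<noteq> j" for i j x c
    using that p pne by (simp add: C_def elem_index)
  have C: "\<rho> (elem n i j x) = elem n (\<pi> i) (\<pi> j) (C i j x)" if ij: "i < n" "j < n" "i \<noteq> j" for i j x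
  proof -
    obtain k where k: "k < n" "k \<noteq> i" "k \<noteq> j" using third by blast
    obtain z c where zc: "z \<noteq> 0" "\<rho> (elem n i k x) = z \<cdot>\<^sub>m elem n (\<pi> i) (\<pi> k) c"
      using perm_case_scalar[OF \<pi> m ij(1) k(1)] k(2) by metis
    obtain z' c' where zc': "z' \<noteq> 0" "\<rho> (elem n k j 1) = z' \<cdot>\<^sub>m elem n (\<pi> k) (\<pi> j) c'"
      using perm_case_scalar[OF \<pi> m k(1) ij(2) k(3)] by metis
    have "\<rho> (elem n i j (x * 1)) = elem n (\<pi> i) (\<pi> j) (c * c')"
      by (rule perm_case_commutator[OF \<pi> m ij(1) k(1) ij(2) _ _ ij(3) zc zc']) (use k in auto)
    then show ?thesis using C_val ij by simp
  qed
  have C_mult: "C i k (x * y) = C i j x * C j k y"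
    if ijk: "i < n" "j < n" "k < n" "i \<noteq> j" "j \<noteq> k" "i \<noteq> k" for i j k x y
  proof -
    have one: "X = 1 \<cdot>\<^sub>m X" for X :: "'b mat" by simp
    have "\<rho> (elem n i k (x * y)) = elem n (\<pi> i) (\<pi> k) (C i j x * C j k y)"
      by (rule perm_case_commutator[OF \<pi> m ijk one_neq_zero _ one_neq_zero])
        (use C ijk in \<open>auto simp flip: one\<close>)
    then show ?thesis using C_val ijk by simp
  qed
  have C_add: "C i j (x + y) = C i j x + C i j y" if ij: "i < n" "j < n" "i \<noteq> j" for i j x y
  proof -
    have "\<rho> (elem n i j (x + y)) = elem n (\<pi> i) (\<pi> j) (C i j x + C i j y)"
      using rep_elem_add[OF ij] C[OF ij] p pne ij by (simp add: elem_add)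
    then show ?thesis using C_val ij by simp
  qed
  have C_nz: "C i j 1 \<noteq> 0" if ij: "i < n" "j < n" "i \<noteq> j" for i j
  proof
    assume "C i j 1 = 0"
    then have "\<rho> (elem n i j 1) = \<rho> (elem n i j 0)" using C[OF ij, of 1] by (simp add: rep_one)
    then have "elem n i j (1 :: 'a) = elem n i j 0" using ij by (intro rep_inj) auto
    then have "(1 :: 'a) = 0" by (rule elem_inj[OF ij(1,2)])
    then show False by simp
  qed
  have n: "0 < n" "1 < n" "2 < n" using n3 by auto
  \<comment> \<open>The scaling that turns all \<open>C i j 1\<close> into 1.\<close>
  define t where "t j = (if j = 0 then 1 else C 0 j 1)" for j
  have t_nz: "t j \<noteq> 0" if "j < n" for j using C_nz[of 0 j] that n by (auto simp: t_def)
  have Ct: "C i j 1 * t i = t j" if ij: "i < n" "j < n" "i \<noteq> j" for i j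
  proof -
    consider "i = 0" | "0 < i" "0 < j" | "0 < i" "j = 0" by auto
    then show ?thesis
    proof cases
      case 1 then show ?thesis using ij by (simp add: t_def)
    next
      case 2 then show ?thesis using C_mult[of 0 i j 1 1] n ij by (simp add: t_def mult.commute)
    next
      case 3
      obtain k where k: "k < n" "k \<noteq> 0" "k \<noteq> i" using third by blast
      have "C 0 k 1 = C 0 i 1 * C i k 1" "C i k 1 = C i 0 1 * C 0 k 1"
        using C_mult[of 0 i k 1 1] C_mult[of i 0 k 1 1] n ij 3 k by auto
      then have "C 0 k 1 * (C i 0 1 * C 0 i 1) = C 0 k 1 * 1" by (simp add: algebra_simps)
      then have "C i 0 1 * C 0 i 1 = 1" using C_nz[of 0 k] n k by (simp del: mult_1_right)
      then show ?thesis using 3 by (simp add: t_def)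
    qed
  qed
  define D where "D i j x = C i j x * t i / t j" for i j x
  \<comment> \<open>Two places with a common row or a common column have the same rescaled coefficient function; all places are linked to \<open>(0, 1)\<close> in this way.\<close>
  have D_right: "D i k x = D i j x" and D_left: "D i k x = D j k x"
    if ijk: "i < n" "j < n" "k < n" "i \<noteq> j" "j \<noteq> k" "i \<noteq> k" for i j k x
  proof -
    have "C i k x = C i j x * C j k 1" "C j k 1 * t j = t k"
      using C_mult[OF ijk, of x 1] Ct[of j k] ijk by auto
    then show "D i k x = D i j x" using t_nz ijk by (simp add: D_def field_simps)
    have "C i k x = C i j 1 * C j k x" "C i j 1 * t i = t j"
      using C_mult[OF ijk, of 1 x] Ct[of i j] ijk by auto
    then have "C i k x * t i = t j * C j k x" by (metis mult.assoc mult.commute)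
    then show "D i k x = D j k x" by (simp add: D_def mult.commute)
  qed
  define c where "c = D 0 1"
  have D0: "D 0 j x = c x" if "j < n" "j \<noteq> 0" for j x
    using D_right[of 0 1 j x] that n by (cases "j = 1") (auto simp: c_def)
  have Dj: "D i j x = c x" if ij: "i < n" "j < n" "i \<noteq> j" "j \<noteq> 0" for i j x
    using D_left[of 0 i j x] D0[of j x] ij n by (cases "i = 0") auto
  have D: "D i j x = c x" if ij: "i < n" "j < n" "i \<noteq> j" for i j x
  proof (cases "j = 0")
    case True
    obtain k where k: "k < n" "k \<noteq> 0" "k \<noteq> i" using third by blast
    then show ?thesis using D_right[of i k j x] Dj[of i k x] ij True by auto
  next
    case False then show ?thesis using Dj ij by blast
  qed
  have Cc: "C i j x = c x * t j / t i" if ij: "i < n" "j < n" "i \<noteq> j" for i j x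
    using D[OF ij, of x, symmetric] t_nz ij by (simp add: D_def)
  define g where "g = mat n n (\<lambda>(k, l). if k = \<pi> l then 1 / t l else 0)"
  define g' where "g' = mat n n (\<lambda>(k, l). if l = \<pi> k then t k else 0)"
  have contra: "g \<in> carrier_mat n n" "g' \<in> carrier_mat n n" by (auto simp: g_def g'_def)
  have g'g: "g' * g = 1\<^sub>m n"
  proof (rule eq_matI)
    fix k m assume "k < dim_row (1\<^sub>m n :: 'b mat)" "m < dim_col (1\<^sub>m n :: 'b mat)"
    then have km: "k < n" "m < n" by auto
    have "(g' * g) $$ (k, m) = (\<Sum>l<n. g' $$ (k, l) * g $$ (l, m))"
      by (rule index_mult_mat_sum[OF contra(2,1) km])
    also have "\<dots> = g' $$ (k, \<pi> k) * g $$ (\<pi> k, m)"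
      by (rule sum_supp_one) (use p km in \<open>auto simp: g'_def\<close>)
    also have "\<dots> = (if k = m then 1 else 0)"
      using km p pne t_nz by (auto simp: g_def g'_def)
    finally show "(g' * g) $$ (k, m) = 1\<^sub>m n $$ (k, m)" using km by simp
  qed (auto simp: g_def g'_def)
  have gg': "g * g' = 1\<^sub>m n" using mat_mult_left_right_inverse[OF contra(2,1) g'g] .
  have "\<rho> (elem n i j x) = g * elem n i j (c x) * g'" if ij: "i < n" "j < n" "i \<noteq> j" for i j x
  proof -
    let ?e = "elem n (\<pi> i) (\<pi> j) (C i j x)"
    have "g * elem n i j (c x) = ?e * g"
    proof (rule eq_matI)
      fix k l assume "k < dim_row (?e * g)" "l < dim_col (?e * g)"
      then have kl: "k < n" "l < n" by (auto simp: g_def)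
      have eq: "\<pi> j = \<pi> l \<longleftrightarrow> j = l" using pne kl ij by blast
      show "(g * elem n i j (c x)) $$ (k, l) = (?e * g) $$ (k, l)"
        unfolding mult_elem_index[OF contra(1) kl ij(1)] elem_mult_index[OF contra(1) kl p[OF ij(2)]]
        using kl ij p t_nz by (auto simp: g_def eq Cc)
    qed (auto simp: g_def)
    then have "g * elem n i j (c x) * g' = ?e * (g * g')"
      using assoc_mult_mat[OF elem_carrier contra, of "\<pi> i" "\<pi> j" "C i j x"] by simp
    then show ?thesis using C[OF ij] gg' by simp
  qed
  moreover have "c 1 = 1" using t_nz[of 1] n by (simp add: c_def D_def t_def)
  moreover have "c (x + y) = c x + c y" for x y
    using C_add[of 0 1 x y] n by (simp add: c_def D_def add_divide_distrib distrib_right)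
  moreover have "c (x * y) = c x * c y" for x y
  proof -
    have "C 0 2 (x * y) = C 0 1 x * C 1 2 y" using C_mult[of 0 1 2 x y] n by simp
    then show ?thesis using n t_nz[of 0] t_nz[of 1] t_nz[of 2] by (simp add: Cc field_simps)
  qed
  ultimately have "std_form n \<rho> g g' c" using contra gg' g'g unfolding std_form_def by blast
  then show ?thesis by blast
qed

lemma diag_row_std:
  assumes "a < n" "b < n" "c < n" "a \<noteq> b" "a \<noteq> c" "b \<noteq> c" "row_pair 1 2 a b c"
  shows "\<exists>g g' c. std_form n \<rho> g g' c"
proof -
  obtain \<pi> where "inj_on \<pi> {..<n}" "\<pi> ` {..<n} \<subseteq> {..<n}"
    "\<forall>i<n. \<forall>j<n. i \<noteq> j \<longrightarrow> (\<exists>m q. q \<noteq> 0 \<and> \<rho> (elem n i j m) = elem n (\<pi> i) (\<pi> j) q)"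
    using row_case[OF assms] by blast
  then show ?thesis by (intro perm_case_std) blast+
qed

end

text \<open>The inverse transpose of \<open>\<rho>\<close>; on determinant one matrices the adjugate is the inverse.\<close>

definition dual_rep :: "('a::comm_ring_1 mat \<Rightarrow> 'f mat) \<Rightarrow> 'a mat \<Rightarrow> 'f mat" where
  "dual_rep \<rho> A = transpose_mat (\<rho> (adj_mat A))"

lemma special_inverse_unique:
  assumes "A \<in> special n" "B \<in> carrier_mat n n" "A * B = 1\<^sub>m n"
  shows "adj_mat A = B"
proof -
  note a = special_adj[OF assms(1)]
  have c: "adj_mat A \<in> carrier_mat n n" "A \<in> carrier_mat n n" using a(1) assms(1) by simp_all
  have "adj_mat A * A * B = adj_mat A"
    using assoc_mult_mat[OF c assms(2)] assms(3) c by simp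
  then show ?thesis using a(3) assms(2) by simp
qed

lemma adj_mat_mult:
  assumes "A \<in> special n" "B \<in> special n"
  shows "adj_mat (A * B) = adj_mat B * adj_mat A"
proof (rule special_inverse_unique[where n = n])
  have c: "A \<in> carrier_mat n n" "B \<in> carrier_mat n n" "adj_mat A \<in> carrier_mat n n" "adj_mat B \<in> carrier_mat n n"
    using assms special_adj(1) special_carrier by blast+
  have "A * B * (adj_mat B * adj_mat A) = A * (B * adj_mat B) * adj_mat A"
    using c by (simp add: assoc_mult_mat[of _ n n _ n _ n])
  then show "A * B * (adj_mat B * adj_mat A) = 1\<^sub>m n"
    using c special_adj(2)[OF assms(1)] special_adj(2)[OF assms(2)] by simp
  show "adj_mat B * adj_mat A \<in> carrier_mat n n" using c by simp
qed (use assms in simp)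

lemma adj_mat_adj_mat: "A \<in> special n \<Longrightarrow> adj_mat (adj_mat A) = A"
  using special_inverse_unique special_adj special_carrier by blast

lemma adj_mat_elem: "i < n \<Longrightarrow> j < n \<Longrightarrow> i \<noteq> j \<Longrightarrow> adj_mat (elem n i j a) = elem n i j (- a)"
  by (rule special_inverse_unique[where n = n]) (auto simp: elem_inverse)

context faithful_rep
begin

lemma dual_faithful_rep: "faithful_rep n (dual_rep \<rho>)"
proof
  show "dual_rep \<rho> A \<in> carrier_mat n n" if "A \<in> special n" for A
    using special_adj(1)[OF that] by (simp add: dual_rep_def)
  show "dual_rep \<rho> (A * B) = dual_rep \<rho> A * dual_rep \<rho> B" if "A \<in> special n" "B \<in> special n" for A B
    using special_adj(1)[OF that(1)] special_adj(1)[OF that(2)]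
    by (simp add: dual_rep_def adj_mat_mult[OF that] rep_mult transpose_mult[of _ n n _ n])
  have "adj_mat (1\<^sub>m n :: 'a mat) = 1\<^sub>m n" by (rule special_inverse_unique[where n = n]) auto
  then show "dual_rep \<rho> (1\<^sub>m n) = 1\<^sub>m n" by (simp add: dual_rep_def rep_one)
  show "A = B" if "A \<in> special n" "B \<in> special n" "dual_rep \<rho> A = dual_rep \<rho> B" for A B
  proof -
    have "\<rho> (adj_mat A) = \<rho> (adj_mat B)" using that(3) unfolding dual_rep_def by (metis transpose_transpose)
    then have "adj_mat A = adj_mat B" using special_adj(1) that(1,2) by (intro rep_inj) auto
    then show ?thesis using adj_mat_adj_mat that(1,2) by metis
  qed
qed (use n3 two_dom two_fld in auto)

lemma conj_faithful_rep:
  assumes P: "P \<in> carrier_mat n n" "P' \<in> carrier_mat n n" "P * P' = 1\<^sub>m n" "P' * P = 1\<^sub>m n"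
  shows "faithful_rep n (\<lambda>A. P' * \<rho> A * P)"
proof -
  have unconj: "P * (P' * X * P) * P' = X" if X: "X \<in> carrier_mat n n" for X
  proof -
    show ?thesis
      using P X by (simp add: assoc_mult_mat[of _ n n _ n _ n] mat_cancel[OF P(3)])
  qed
  show ?thesis
  proof
    show "P' * \<rho> A * P \<in> carrier_mat n n" if "A \<in> special n" for A
      using that P by simp
    show "P' * \<rho> (A * B) * P = P' * \<rho> A * P * (P' * \<rho> B * P)" if AB: "A \<in> special n" "B \<in> special n" for A B
    proof -
      have "P' * \<rho> A * P * (P' * \<rho> B * P) = P' * (\<rho> A * \<rho> B) * P"
        using P AB by (simp add: assoc_mult_mat[of _ n n _ n _ n] mat_cancel[OF P(3)])
      then show ?thesis using AB by (simp add: rep_mult)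
    qed
    show "P' * \<rho> (1\<^sub>m n) * P = 1\<^sub>m n" using P by (simp add: rep_one)
    show "A = B" if "A \<in> special n" "B \<in> special n" "P' * \<rho> A * P = P' * \<rho> B * P" for A B
      using unconj[of "\<rho> A"] unconj[of "\<rho> B"] that by (metis rep_carrier rep_inj)
  qed (use n3 two_dom two_fld in auto)
qed

lemma std_form_conj:
  assumes P: "P \<in> carrier_mat n n" "P' \<in> carrier_mat n n" "P * P' = 1\<^sub>m n" "P' * P = 1\<^sub>m n"
    and s: "std_form n (\<lambda>A. P' * \<rho> A * P) g g' c"
  shows "std_form n \<rho> (P * g) (g' * P') c"
proof -
  have g: "g \<in> carrier_mat n n" "g' \<in> carrier_mat n n" "g * g' = 1\<^sub>m n" "g' * g = 1\<^sub>m n"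
    using s by (auto simp: std_form_def)
  have *: "P * g * (g' * P') = 1\<^sub>m n" "g' * P' * (P * g) = 1\<^sub>m n"
    using P g by (simp_all add: assoc_mult_mat[of _ n n _ n _ n] mat_cancel[OF g(3)] mat_cancel[OF P(4)])
  have "\<rho> (elem n i j x) = P * g * elem n i j (c x) * (g' * P')" if ij: "i < n" "j < n" "i \<noteq> j" for i j x
  proof -
    have X: "\<rho> (elem n i j x) \<in> carrier_mat n n" using ij by simp
    have "\<rho> (elem n i j x) = P * (P' * \<rho> (elem n i j x) * P) * P'"
      using P X by (simp add: assoc_mult_mat[of _ n n _ n _ n] mat_cancel[OF P(3)])
    also have "\<dots> = P * (g * elem n i j (c x) * g') * P'" using s ij unfolding std_form_def by simp
    also have "\<dots> = P * g * elem n i j (c x) * (g' * P')"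
      using P g by (simp add: assoc_mult_mat[of _ n n _ n _ n])
    finally show ?thesis .
  qed
  then show ?thesis using s P g * unfolding std_form_def by simp
qed

text \<open>After diagonalising the sign matrices, either the representation or its dual is of row type.\<close>

theorem faithful_rep_standard:
  "\<exists>g g' c. std_form n \<rho> g g' c \<or> std_form n (dual_rep \<rho>) g g' c"
proof -
  let ?A = "(\<lambda>v. \<rho> (sign_mat n 0 v)) ` {..<n}"
  have n: "0 < n" "1 < n" "2 < n" using n3 by auto
  have sp: "sign_mat n 0 v \<in> special n" if "v < n" for v using that n by simp
  have car: "A \<in> carrier_mat n n" if "A \<in> ?A" for A using that sp by auto
  have inv: "\<rho> (sign_mat n 0 v) * \<rho> (sign_mat n 0 v) = 1\<^sub>m n" if "v < n" for v
    using rep_mult[OF sp[OF that] sp[OF that]] by (simp add: sign_mat_sq rep_one)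
  have com: "\<rho> (sign_mat n 0 v) * \<rho> (sign_mat n 0 w) = \<rho> (sign_mat n 0 w) * \<rho> (sign_mat n 0 v)" if "v < n" "w < n" for v w
    using rep_mult[OF sp[OF that(1)] sp[OF that(2)]] rep_mult[OF sp[OF that(2)] sp[OF that(1)]]
      sign_mat_commute[of n 0 v 0 w] by metis
  have inv': "A * A = 1\<^sub>m n" if "A \<in> ?A" for A using that inv by blast
  have com': "A * B = B * A" if "A \<in> ?A" "B \<in> ?A" for A B using that com by blast
  obtain P P' where P: "P \<in> carrier_mat n n" "P' \<in> carrier_mat n n" "P * P' = 1\<^sub>m n" "P' * P = 1\<^sub>m n"
    and d: "\<And>A k l. A \<in> ?A \<Longrightarrow> k < n \<Longrightarrow> l < n \<Longrightarrow> k \<noteq> l \<Longrightarrow> (P' * A * P) $$ (k, l) = 0"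
    using commuting_involutions_diagonal[where \<A> = ?A and n = n,
        OF two_fld finite_imageI[OF finite_lessThan] car inv' com'] by blast
  let ?\<psi> = "\<lambda>A. P' * \<rho> A * P"
  interpret \<psi>: faithful_rep n ?\<psi> by (rule conj_faithful_rep[OF P])
  have dg0: "sign_mat n u v = sign_mat n 0 u * sign_mat n 0 v" for u v :: nat
    unfolding sign_mat_def mat_diag_diag by (rule arg_cong[where f = "mat_diag n"]) (auto simp: sign_vec_def)
  have diag: "?\<psi> (sign_mat n u v) $$ (k, l) = 0" if uv: "u < n" "v < n" and kl: "k < n" "l < n" "k \<noteq> l" for u v k l
  proof -
    have "?\<psi> (sign_mat n u v) = ?\<psi> (sign_mat n 0 u) * ?\<psi> (sign_mat n 0 v)"
      unfolding dg0[of u v] by (rule \<psi>.rep_mult[OF sp[OF uv(1)] sp[OF uv(2)]])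
    moreover have "(?\<psi> (sign_mat n 0 u) * ?\<psi> (sign_mat n 0 v)) $$ (k, l) = ?\<psi> (sign_mat n 0 u) $$ (k, k) * ?\<psi> (sign_mat n 0 v) $$ (k, l)"
      unfolding index_mult_mat_sum[OF \<psi>.rep_carrier[OF sp[OF uv(1)]] \<psi>.rep_carrier[OF sp[OF uv(2)]] kl(1,2)]
      by (rule sum_supp_one) (use kl uv d in auto)
    ultimately show ?thesis using d uv kl by simp
  qed
  interpret \<psi>: diag_rep n ?\<psi> by unfold_locales (rule diag)
  interpret \<psi>d: faithful_rep n "dual_rep ?\<psi>" by (rule \<psi>.dual_faithful_rep)
  have adj_sign_mat: "adj_mat (sign_mat n u v) = (sign_mat n u v :: 'a mat)" if "u < n" "v < n" for u v
    using that by (intro special_inverse_unique[where n = n]) (auto simp: sign_mat_sq)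
  interpret \<psi>d: diag_rep n "dual_rep ?\<psi>"
    by unfold_locales (use diag \<psi>.rep_dim[OF sign_mat_special] in \<open>simp add: dual_rep_def adj_sign_mat\<close>)
  obtain a b c where abc: "a < n" "b < n" "c < n" "a \<noteq> b" "a \<noteq> c" "b \<noteq> c"
    and rc: "\<psi>.row_pair 1 2 a b c \<or> \<psi>.col_pair 1 2 a b c"
    using \<psi>.row_or_col_pair[of 1 2] n by auto
  from rc show ?thesis
  proof
    assume "\<psi>.row_pair 1 2 a b c"
    then obtain g g' c where "std_form n ?\<psi> g g' c" using \<psi>.diag_row_std abc by blast
    then show ?thesis using std_form_conj[OF P] by blast
  next
    assume "\<psi>.col_pair 1 2 a b c"
    then obtain q q' r r' where q: "q \<noteq> 0" "q' \<noteq> 0" "r \<noteq> 0" "r' \<noteq> 0"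
      "?\<psi> (elem n 0 1 4) = elem n b a q" "?\<psi> (elem n 0 2 4) = elem n c a q'"
      "?\<psi> (elem n 1 0 4) = elem n a b r" "?\<psi> (elem n 2 0 4) = elem n a c r'"
      unfolding \<psi>.col_pair_def by blast
    have inv: "?\<psi> (elem n i j (- 4)) = elem n u v (- s)"
      if s: "?\<psi> (elem n i j 4) = elem n u v s" "i < n" "j < n" "i \<noteq> j" "u < n" "v < n" "u \<noteq> v" for i j u v s
    proof -
      have sp: "elem n i j (- 4) \<in> special n" "elem n i j 4 \<in> special n" using s by auto
      have "?\<psi> (elem n i j (- 4)) * ?\<psi> (elem n i j 4) = 1\<^sub>m n"
        using \<psi>.rep_mult[OF sp] s elem_inverse(2)[of i n j "4 :: 'a"] \<psi>.rep_one by simp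
      then have "?\<psi> (elem n i j (- 4)) * elem n u v s = elem n u v (- s) * elem n u v s"
        using s elem_inverse(2)[of u n v s] by simp
      then show ?thesis
        using mult_right_cancel_mat[OF \<psi>.rep_carrier[OF sp(1)] elem_carrier elem_carrier elem_carrier]
          elem_inverse(1)[of u n v s] s by blast
    qed
    have "dual_rep ?\<psi> (elem n i j 4) = elem n v u (- s)"
      if s: "?\<psi> (elem n i j 4) = elem n u v s" "i < n" "j < n" "i \<noteq> j" "u < n" "v < n" "u \<noteq> v" for i j u v s
      using inv[OF s] s by (simp add: dual_rep_def adj_mat_elem transpose_elem)
    then have "\<psi>d.row_pair 1 2 a b c"
      unfolding \<psi>d.row_pair_def using q abc n
      by (intro exI[of _ "- q"] exI[of _ "- q'"] exI[of _ "- r"] exI[of _ "- r'"]) simp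
    then obtain g g' c where s: "std_form n (dual_rep ?\<psi>) g g' c" using \<psi>d.diag_row_std abc by blast
    interpret d: faithful_rep n "dual_rep \<rho>" by (rule dual_faithful_rep)
    have tP: "transpose_mat P' \<in> carrier_mat n n" "transpose_mat P \<in> carrier_mat n n"
      "transpose_mat P' * transpose_mat P = 1\<^sub>m n" "transpose_mat P * transpose_mat P' = 1\<^sub>m n"
      using P(1,2) unfolding transpose_mult[OF P(1,2), symmetric] transpose_mult[OF P(2,1), symmetric] P(3,4)
      by simp_all
    have "dual_rep ?\<psi> A = transpose_mat P * dual_rep \<rho> A * transpose_mat P'" if "A \<in> special n" for A
      using rep_carrier[OF special_adj(1)[OF that]] P
      by (simp add: dual_rep_def transpose_mult[of _ n n _ n] assoc_mult_mat[of _ n n _ n _ n])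
    then have "std_form n (\<lambda>A. transpose_mat P * dual_rep \<rho> A * transpose_mat P') g g' c"
      using s unfolding std_form_def by auto
    then show ?thesis using d.std_form_conj[OF tP] by blast
  qed
qed

end

section \<open>The group generated by elementary matrices\<close>

text \<open>Closure under products suffices to obtain the group generated by the elementary matrices, whose inverses are elementary again.\<close>

inductive_set elementary :: "nat \<Rightarrow> 'a::comm_ring_1 mat set" for n where
  elementary_one: "1\<^sub>m n \<in> elementary n"
| elementary_step: "A \<in> elementary n \<Longrightarrow> i < n \<Longrightarrow> j < n \<Longrightarrow> i \<noteq> j \<Longrightarrow> elem n i j a * A \<in> elementary n"

lemma elementary_special: "A \<in> elementary n \<Longrightarrow> A \<in> special n"
  by (induction rule: elementary.induct) auto

lemma elementary_carrier [simp]: "A \<in> elementary n \<Longrightarrow> A \<in> carrier_mat n n"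
  using elementary_special special_carrier by blast

lemma elementary_elem: "i < n \<Longrightarrow> j < n \<Longrightarrow> i \<noteq> j \<Longrightarrow> elem n i j a \<in> elementary n"
  using elementary_step[OF elementary_one, of i n j a] by simp

lemma elementary_mult: "A \<in> elementary n \<Longrightarrow> B \<in> elementary n \<Longrightarrow> A * B \<in> elementary n"
proof (induction rule: elementary.induct)
  case elementary_one then show ?case using left_mult_one_mat[OF elementary_carrier] by metis
next
  case (elementary_step A i j a)
  then show ?case using elementary.elementary_step[of "A * B" n i j a] by (simp add: assoc_mult_mat[of _ n n _ n _ n])
qed

lemma elementary_transpose: "A \<in> elementary n \<Longrightarrow> transpose_mat A \<in> elementary n"
proof (induction rule: elementary.induct)
  case elementary_one then show ?case by (simp add: elementary.elementary_one)
next
  case (elementary_step A i j a)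
  then show ?case
    using elementary_mult[OF _ elementary_elem[of j n i a]] by (simp add: transpose_mult[of _ n n _ n] transpose_elem)
qed

lemma elementary_inverse: "A \<in> elementary n \<Longrightarrow> adj_mat A \<in> elementary n"
proof (induction rule: elementary.induct)
  case elementary_one
  have "adj_mat (1\<^sub>m n) = (1\<^sub>m n :: 'a mat)" by (rule special_inverse_unique[where n = n]) auto
  then show ?case by (simp add: elementary.elementary_one)
next
  case (elementary_step A i j a)
  then show ?case
    using elementary_mult[OF _ elementary_elem[of i n j "- a"]]
    by (simp add: adj_mat_mult[of _ n] adj_mat_elem elementary_special)
qed

lemma dyadic_cong: "(\<And>k. k < n \<Longrightarrow> u k = u' k) \<Longrightarrow> (\<And>k. k < n \<Longrightarrow> v k = v' k) \<Longrightarrow> dyadic n u v = dyadic n u' v'"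
  by (rule eq_matI) (auto simp: dyadic_index)

lemma dyadic_zero [simp]: "dyadic n (\<lambda>_. 0) v = 1\<^sub>m n" "dyadic n u (\<lambda>_. 0) = 1\<^sub>m n"
  by (rule eq_matI; simp add: dyadic_index)+

lemma transpose_dyadic: "transpose_mat (dyadic n u v) = dyadic n v u"
  by (rule eq_matI) (auto simp: dyadic_index)

lemma dyadic_mult_dyadic:
  assumes "(\<Sum>m<n. v m * u' m) = 0" "k < n" "l < n"
  shows "(dyadic n u v * dyadic n u' v') $$ (k, l) = (if k = l then 1 else 0) + u k * v l + u' k * v' l"
proof -
  have "(\<Sum>m<n. v m * dyadic n u' v' $$ (m, l)) = (\<Sum>m<n. ((if l = m then 1 else 0) + v' l * u' m) * v m)"
    using assms(3) by (intro sum.cong) (auto simp: dyadic_index algebra_simps)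
  also have "\<dots> = v l + v' l * (\<Sum>m<n. u' m * v m)" by (rule sum_delta_left[OF assms(3)])
  also have "\<dots> = v l" using assms(1) by (simp add: mult.commute)
  finally show ?thesis unfolding dyadic_mult_index[OF dyadic_carrier assms(2,3)] using assms by (simp add: dyadic_index)
qed

lemma dyadic_add_right:
  assumes "(\<Sum>m<n. v m * u m) = 0"
  shows "dyadic n u v * dyadic n u v' = dyadic n u (\<lambda>k. v k + v' k)"
  by (rule eq_matI) (auto simp: dyadic_mult_dyadic[OF assms] dyadic_index algebra_simps)

lemma dyadic_add_left:
  assumes "(\<Sum>m<n. v m * u' m) = 0"
  shows "dyadic n u v * dyadic n u' v = dyadic n (\<lambda>k. u k + u' k) v"
  by (rule eq_matI) (auto simp: dyadic_mult_dyadic[OF assms] dyadic_index algebra_simps)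

definition unit_fun :: "nat \<Rightarrow> nat \<Rightarrow> 'a::comm_ring_1" where
  "unit_fun k = (\<lambda>l. if l = k then 1 else 0)"

lemma sum_unit_fun [simp]: "k < n \<Longrightarrow> (\<Sum>m<n. unit_fun k m * f m) = f k" "k < n \<Longrightarrow> (\<Sum>m<n. f m * unit_fun k m) = f k"
  by (subst sum_supp_one[of k]; simp add: unit_fun_def)+

lemma dyadic_unit_left_elementary:
  assumes "k < n" "z k = 0"
  shows "dyadic n (unit_fun k) z \<in> elementary n"
proof -
  have "dyadic n (unit_fun k) (\<lambda>l. if l \<in> I then z l else 0) \<in> elementary n" if "finite I" "I \<subseteq> {..<n} - {k}" for I
    using that
  proof (induction I rule: finite_induct)
    case empty then show ?case by (simp add: elementary_one)
  next
    case (insert i I)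
    then have i: "i < n" "i \<noteq> k" by auto
    have "dyadic n (unit_fun k) (\<lambda>l. if l \<in> insert i I then z l else 0)
        = elem n k i (z i) * dyadic n (unit_fun k) (\<lambda>l. if l \<in> I then z l else 0)"
      by (rule eq_matI) (use insert.hyps i assms in \<open>auto simp: elem_mult_index dyadic_index unit_fun_def\<close>)
    then show ?case using elementary_step[of _ n k i] insert i assms(1) by auto
  qed
  from this[of "{..<n} - {k}"] have "dyadic n (unit_fun k) (\<lambda>l. if l \<in> {..<n} - {k} then z l else 0) \<in> elementary n"
    by simp
  moreover have "dyadic n (unit_fun k) (\<lambda>l. if l \<in> {..<n} - {k} then z l else 0) = dyadic n (unit_fun k) z"
    by (rule dyadic_cong) (use assms in auto)
  ultimately show ?thesis by simp
qed

lemma dyadic_unit_right_elementary: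
  assumes "k < n" "z k = 0"
  shows "dyadic n z (unit_fun k) \<in> elementary n"
  using elementary_transpose[OF dyadic_unit_left_elementary[where z = z, OF assms]] by (simp add: transpose_dyadic)

text \<open>It is the commutator of \<open>1 + u e\<^sub>k\<^sup>T\<close> and \<open>1 + e\<^sub>k w\<^sup>T\<close>.\<close>

lemma dyadic_both_zero_elementary:
  assumes k: "k < n" "u k = 0" "w k = 0" and uw: "(\<Sum>m<n. w m * u m) = 0"
  shows "dyadic n u w \<in> elementary n"
proof -
  let ?A = "dyadic n u (unit_fun k)" and ?A' = "dyadic n (\<lambda>m. - u m) (unit_fun k)"
  let ?B = "dyadic n (unit_fun k) w" and ?B' = "dyadic n (unit_fun k) (\<lambda>m. - w m)"
  have AA: "?A * ?A' = 1\<^sub>m n" using k by (subst dyadic_add_left) (auto simp: sum_negf)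
  have BB: "?B * ?B' = 1\<^sub>m n" using k by (subst dyadic_add_right) auto
  have BA: "(?B * ?A) $$ (i, l) = (if i = l then 1 else 0) + unit_fun k i * w l + u i * unit_fun k l"
    if "i < n" "l < n" for i l by (rule dyadic_mult_dyadic[OF uw that])
  have eq: "dyadic n u w * (?B * ?A) = ?A * ?B"
  proof (rule eq_matI)
    fix i l assume "i < dim_row (?A * ?B)" "l < dim_col (?A * ?B)"
    then have il: "i < n" "l < n" by auto
    have 1: "(\<Sum>m<n. w m * (?B * ?A) $$ (m, l)) = w l"
    proof -
      have "(\<Sum>m<n. w m * (?B * ?A) $$ (m, l))
          = (\<Sum>m<n. ((if l = m then 1 else 0) + w l * unit_fun k m) * w m + unit_fun k l * (w m * u m))"
        using il by (intro sum.cong) (auto simp: BA algebra_simps)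
      also have "\<dots> = (\<Sum>m<n. ((if l = m then 1 else 0) + w l * unit_fun k m) * w m) + unit_fun k l * (\<Sum>m<n. w m * u m)"
        by (simp add: sum.distrib sum_distrib_left)
      also have "\<dots> = w l + w l * (\<Sum>m<n. unit_fun k m * w m)"
        using uw il by (subst sum_delta_left) auto
      finally show ?thesis using k by simp
    qed
    have 2: "(\<Sum>m<n. unit_fun k m * ?B $$ (m, l)) = unit_fun k l + w l"
      using k il by (simp add: dyadic_index) (simp add: unit_fun_def)
    have "(dyadic n u w * (?B * ?A)) $$ (i, l) = (?B * ?A) $$ (i, l) + u i * w l"
      by (subst dyadic_mult_index[OF mult_carrier_square[OF dyadic_carrier dyadic_carrier] il]) (simp only: 1)
    moreover have "(?A * ?B) $$ (i, l) = ?B $$ (i, l) + u i * (unit_fun k l + w l)"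
      by (subst dyadic_mult_index[OF dyadic_carrier il]) (simp only: 2)
    ultimately show "(dyadic n u w * (?B * ?A)) $$ (i, l) = (?A * ?B) $$ (i, l)"
      using il by (simp add: BA[OF il] dyadic_index algebra_simps)
  qed auto
  have "(?B * ?A) * (?A' * ?B') = ?B * (?A * ?A') * ?B'" by (simp add: assoc_mult_mat[of _ n n _ n _ n])
  then have "(?B * ?A) * (?A' * ?B') = 1\<^sub>m n" using AA BB by simp
  then have "dyadic n u w = dyadic n u w * ((?B * ?A) * (?A' * ?B'))" by simp
  also have "\<dots> = (?A * ?B) * (?A' * ?B')"
    unfolding eq[symmetric] by (simp add: assoc_mult_mat[of _ n n _ n _ n])
  also have "\<dots> \<in> elementary n"
    using k by (intro elementary_mult dyadic_unit_left_elementary dyadic_unit_right_elementary) auto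
  finally show ?thesis .
qed

text \<open>Splitting \<open>u\<close> into its \<open>k\<close>-th coordinate and the rest reduces this to \<open>dyadic_unit_left_elementary\<close> and \<open>dyadic_both_zero_elementary\<close>; the rest is still orthogonal to \<open>w\<close>, because \<open>w k = 0\<close>.\<close>

lemma dyadic_zero_coord_elementary:
  assumes k: "k < n" "w k = 0" and uw: "(\<Sum>m<n. w m * u m) = 0"
  shows "dyadic n u w \<in> elementary n"
proof -
  let ?u = "\<lambda>m. if m = k then 0 else u m"
  have "(\<Sum>m<n. w m * ?u m) = (\<Sum>m<n. w m * u m)" by (rule sum.cong) (use k in auto)
  then have 0: "(\<Sum>m<n. w m * ?u m) = 0" using uw by simp
  have "dyadic n u w = dyadic n (unit_fun k) (\<lambda>m. u k * w m) * dyadic n ?u w"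
  proof (rule eq_matI)
    fix i l assume "i < dim_row (dyadic n (unit_fun k) (\<lambda>m. u k * w m) * dyadic n ?u w)" "l < dim_col (dyadic n (unit_fun k) (\<lambda>m. u k * w m) * dyadic n ?u w)"
    then have il: "i < n" "l < n" by auto
    have "(\<Sum>m<n. u k * w m * ?u m) = u k * (\<Sum>m<n. w m * ?u m)"
      unfolding sum_distrib_left by (rule sum.cong) (auto simp: mult.assoc)
    then have "(\<Sum>m<n. u k * w m * ?u m) = 0" using 0 by simp
    from dyadic_mult_dyadic[OF this il, of "unit_fun k" w]
    show "dyadic n u w $$ (i, l) = (dyadic n (unit_fun k) (\<lambda>m. u k * w m) * dyadic n ?u w) $$ (i, l)"
      using il by (simp add: dyadic_index unit_fun_def)
  qed auto
  also have "\<dots> \<in> elementary n"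
    using k 0 by (intro elementary_mult dyadic_unit_left_elementary dyadic_both_zero_elementary[of k]) auto
  finally show ?thesis .
qed

text \<open>For \<open>p \<cdot> u = 1\<close> and \<open>v \<cdot> u = 0\<close> one has \<open>v = \<Sum>\<^sub>i\<^sub>j v\<^sub>i p\<^sub>j (u\<^sub>j e\<^sub>i - u\<^sub>i e\<^sub>j)\<close>. Every summand is orthogonal to \<open>u\<close>, so the transvection is a product of transvections in these directions, and as \<open>n \<ge> 3\<close> each of them has a zero coordinate.\<close>

lemma transvection_elementary:
  assumes n3: "n \<ge> 3" and vu: "(\<Sum>m<n. v m * u m) = 0" and pu: "(\<Sum>m<n. p m * u m) = 1"
  shows "dyadic n u v \<in> elementary n"
proof -
  \<comment> \<open>The summation runs over all ordered pairs \<open>(i, j)\<close>, including \<open>i = j\<close>, where the summand vanishes.\<close>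
  define w where "w i j l = v i * p j * (u j * unit_fun i l - u i * unit_fun j l)" for i j l
  have wu: "(\<Sum>m<n. w i j m * u m) = 0" if "i < n" "j < n" for i j
  proof -
    have "(\<Sum>m<n. w i j m * u m) = v i * p j * (u j * (\<Sum>m<n. unit_fun i m * u m) - u i * (\<Sum>m<n. unit_fun j m * u m))"
      by (simp only: w_def sum_distrib_left sum_subtractf[symmetric]) (rule sum.cong; simp add: algebra_simps)
    then show ?thesis using that by (simp add: mult.commute)
  qed
  have "dyadic n u (\<lambda>l. \<Sum>(i, j)\<in>I. w i j l) \<in> elementary n" if "finite I" "I \<subseteq> {..<n} \<times> {..<n}" for I
    using that
  proof (induction I rule: finite_induct)
    case empty then show ?case by (simp add: elementary_one)
  next
    case (insert x I)
    obtain i j where x: "x = (i, j)" "i < n" "j < n" using insert.prems by auto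
    have "\<exists>k<3. k \<noteq> i \<and> k \<noteq> j" by presburger
    then obtain k where k: "k < n" "k \<noteq> i" "k \<noteq> j" using n3 by (meson less_le_trans)
    have "dyadic n u (w i j) \<in> elementary n"
      by (rule dyadic_zero_coord_elementary[OF k(1) _ wu[OF x(2,3)]]) (use k in \<open>simp add: w_def unit_fun_def\<close>)
    moreover have "dyadic n u (\<lambda>l. \<Sum>(i, j)\<in>insert x I. w i j l) = dyadic n u (w i j) * dyadic n u (\<lambda>l. \<Sum>(i, j)\<in>I. w i j l)"
      unfolding dyadic_add_right[OF wu[OF x(2,3)]] using insert.hyps x by simp
    ultimately show ?case using insert elementary_mult by simp
  qed
  from this[of "{..<n} \<times> {..<n}"]
  have "dyadic n u (\<lambda>l. \<Sum>(i, j)\<in>{..<n} \<times> {..<n}. w i j l) \<in> elementary n" by simp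
  moreover have "dyadic n u (\<lambda>l. \<Sum>(i, j)\<in>{..<n} \<times> {..<n}. w i j l) = dyadic n u v"
  proof (rule dyadic_cong)
    fix l assume l: "l < n"
    have "(\<Sum>(i, j)\<in>{..<n} \<times> {..<n}. w i j l) = (\<Sum>i<n. \<Sum>j<n. w i j l)"
      by (simp add: sum.cartesian_product)
    also have "\<dots> = (\<Sum>i<n. (v i * unit_fun i l) * (\<Sum>j<n. p j * u j) - (v i * u i) * (\<Sum>j<n. p j * unit_fun j l))"
      by (simp only: w_def sum_distrib_left sum_subtractf[symmetric])
        (intro sum.cong refl; simp add: algebra_simps)
    also have "\<dots> = (\<Sum>i<n. v i * unit_fun i l) - (\<Sum>i<n. v i * u i) * (\<Sum>j<n. p j * unit_fun j l)"
      by (simp add: pu sum_subtractf sum_distrib_right)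
    also have "(\<Sum>i<n. v i * unit_fun i l) = (\<Sum>i<n. v i * unit_fun l i)" by (rule sum.cong) (auto simp: unit_fun_def)
    finally show "(\<Sum>(i, j)\<in>{..<n} \<times> {..<n}. w i j l) = v l" using vu l by simp
  qed simp
  ultimately show ?thesis by simp
qed

text \<open>The conjugate is \<open>1 + a u v\<^sup>T\<close> for a column \<open>u\<close> of \<open>C'\<close> and a row \<open>v\<close> of \<open>C\<close>; another row of \<open>C\<close> shows that \<open>u\<close> is unimodular.\<close>

lemma conj_elem_elementary:
  assumes n3: "n \<ge> 3" and C: "C \<in> carrier_mat n n" "C' \<in> carrier_mat n n" "C * C' = 1\<^sub>m n" "C' * C = 1\<^sub>m n"
    and ij: "i < n" "j < n" "i \<noteq> j"
  shows "C' * elem n i j a * C \<in> elementary n"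
proof -
  let ?u = "\<lambda>k. C' $$ (k, i)" and ?v = "\<lambda>l. a * C $$ (j, l)" and ?p = "\<lambda>l. C $$ (i, l)"
  have cc: "(\<Sum>m<n. C $$ (k, m) * C' $$ (m, l)) = (if k = l then 1 else 0)" if "k < n" "l < n" for k l
    using index_mult_mat_sum[OF C(1,2) that] C(3) that by simp
  have cc': "(\<Sum>m<n. C' $$ (k, m) * C $$ (m, l)) = (if k = l then 1 else 0)" if "k < n" "l < n" for k l
    using index_mult_mat_sum[OF C(2,1) that] C(4) that by simp
  have "(\<Sum>m<n. ?v m * ?u m) = a * (\<Sum>m<n. C $$ (j, m) * C' $$ (m, i))"
    unfolding sum_distrib_left by (rule sum.cong) (auto simp: mult.assoc)
  then have vu: "(\<Sum>m<n. ?v m * ?u m) = 0" using cc ij by simp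
  have pu: "(\<Sum>m<n. ?p m * ?u m) = 1" using cc ij by simp
  have "C' * elem n i j a * C = dyadic n ?u ?v"
  proof (rule eq_matI)
    fix k l assume "k < dim_row (dyadic n ?u ?v)" "l < dim_col (dyadic n ?u ?v)"
    then have kl: "k < n" "l < n" by auto
    have "(C' * elem n i j a * C) $$ (k, l) = (\<Sum>m<n. (C' * elem n i j a) $$ (k, m) * C $$ (m, l))"
      using C kl by (intro index_mult_mat_sum) auto
    also have "\<dots> = (\<Sum>m<n. C' $$ (k, m) * C $$ (m, l) + (if m = j then C' $$ (k, i) * a * C $$ (m, l) else 0))"
      using C(2) kl ij by (intro sum.cong) (auto simp: mult_elem_index algebra_simps)
    also have "\<dots> = (if k = l then 1 else 0) + C' $$ (k, i) * a * C $$ (j, l)"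
      using cc' kl ij by (simp add: sum.distrib)
    finally show "(C' * elem n i j a * C) $$ (k, l) = dyadic n ?u ?v $$ (k, l)"
      using kl by (simp add: dyadic_index mult.assoc)
  qed (use C in auto)
  then show ?thesis using transvection_elementary[OF n3 vu pu] by simp
qed

definition mtrace :: "'a::comm_ring_1 mat \<Rightarrow> 'a" where
  "mtrace A = (\<Sum>i<dim_row A. A $$ (i, i))"

lemma mtrace_mult_commute:
  assumes "A \<in> carrier_mat n n" "B \<in> carrier_mat n n"
  shows "mtrace (A * B) = mtrace (B * A)"
proof -
  have "mtrace (A * B) = (\<Sum>i<n. \<Sum>k<n. A $$ (i, k) * B $$ (k, i))"
    using assms unfolding mtrace_def by (auto simp: index_mult_mat_sum[of _ n] intro!: sum.cong)
  also have "\<dots> = (\<Sum>k<n. \<Sum>i<n. B $$ (k, i) * A $$ (i, k))"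
    by (subst sum.swap) (simp add: mult.commute)
  also have "\<dots> = mtrace (B * A)"
    using assms unfolding mtrace_def by (auto simp: index_mult_mat_sum[of _ n] intro!: sum.cong)
  finally show ?thesis .
qed

lemma mtrace_conj:
  assumes "g \<in> carrier_mat n n" "g' \<in> carrier_mat n n" "X \<in> carrier_mat n n" "g' * g = 1\<^sub>m n"
  shows "mtrace (g * X * g') = mtrace X"
proof -
  have "mtrace (g * X * g') = mtrace (g' * (g * X))" by (rule mtrace_mult_commute[of _ n]) (use assms in auto)
  then show ?thesis using mat_cancel[OF assms(4,2,1,3)] by simp
qed

lemma mtrace_transpose: "A \<in> carrier_mat n n \<Longrightarrow> mtrace (transpose_mat A) = mtrace A"
  by (auto simp: mtrace_def)

lemma mtrace_elem: "i \<noteq> j \<Longrightarrow> mtrace (elem n i j a) = of_nat n"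
proof -
  assume "i \<noteq> j"
  then have "mtrace (elem n i j a) = (\<Sum>k<n. 1)" unfolding mtrace_def by (intro sum.cong) (auto simp: elem_index)
  then show ?thesis by simp
qed

lemma mtrace_elem_mult:
  assumes "A \<in> carrier_mat n n" "i < n" "j < n"
  shows "mtrace (elem n i j a * A) = mtrace A + a * A $$ (j, i)"
proof -
  have "mtrace (elem n i j a * A) = (\<Sum>k<n. A $$ (k, k) + (if k = i then a * A $$ (j, k) else 0))"
    using assms unfolding mtrace_def by (auto simp: elem_mult_index intro!: sum.cong)
  then show ?thesis using assms by (simp add: sum.distrib mtrace_def)
qed

section \<open>Automorphisms of linear groups on elementary matrices\<close>

interpretation fract_hom: inj_comm_ring_hom "to_fract :: 'a::idom \<Rightarrow> 'a fract"
  by unfold_locales auto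

lemma to_fract_of_nat: "to_fract (of_nat k) = of_nat k"
  by (induction k) auto

lemma to_fract_of_int: "to_fract (of_int k) = of_int k"
  by (cases k) (auto simp: to_fract_of_nat)

abbreviation emb :: "'a::idom mat \<Rightarrow> 'a fract mat" where
  "emb \<equiv> map_mat to_fract"

lemma mtrace_map: "(\<And>x y. h (x + y) = h x + h y) \<Longrightarrow> h 0 = 0 \<Longrightarrow> A \<in> carrier_mat n n \<Longrightarrow>
    mtrace (map_mat h A) = h (mtrace (A :: 'a::comm_ring_1 mat))"
proof -
  assume h: "\<And>x y. h (x + y) = h x + h y" "h 0 = 0" and A: "A \<in> carrier_mat n n"
  have "h (sum f I) = (\<Sum>i\<in>I. h (f i))" if "finite I" for f and I :: "nat set"
    using that by (induction I rule: finite_induct) (auto simp: h)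
  then show ?thesis using A by (auto simp: mtrace_def)
qed

lemma map_mat_elem: "h 0 = 0 \<Longrightarrow> h 1 = 1 \<Longrightarrow> (\<And>x y. h (x + y) = h x + h y) \<Longrightarrow>
    map_mat h (elem n i j x) = elem n i j (h x)"
  by (rule eq_matI) (auto simp: elem_index)

definition ring_endo :: "('a::comm_ring_1 \<Rightarrow> 'a) \<Rightarrow> bool" where
  "ring_endo \<sigma> \<longleftrightarrow> \<sigma> 1 = 1 \<and> (\<forall>x y. \<sigma> (x + y) = \<sigma> x + \<sigma> y) \<and> (\<forall>x y. \<sigma> (x * y) = \<sigma> x * \<sigma> y)"

lemma ring_endo_hom: "ring_endo \<sigma> \<Longrightarrow> comm_ring_hom \<sigma>"
proof -
  assume r: "ring_endo \<sigma>"
  then have "\<sigma> 0 + \<sigma> 0 = \<sigma> 0" unfolding ring_endo_def by (metis add_0)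
  then have "\<sigma> 0 = 0" by simp
  then show ?thesis using r unfolding ring_endo_def by unfold_locales auto
qed

text \<open>What the general and the special linear group have in common for the argument.\<close>

locale linear_group =
  fixes n :: nat and G :: "'a::idom mat monoid" (structure)
  assumes n3: "n \<ge> 3" and char0: "inj (of_int :: int \<Rightarrow> 'a)" and grp: "group G"
    and carrier_dim: "A \<in> carrier G \<Longrightarrow> A \<in> carrier_mat n n"
    and mult_eq: "A \<otimes> B = A * B" and one_eq: "\<one> = 1\<^sub>m n"
    and special_sub: "A \<in> special n \<Longrightarrow> A \<in> carrier G"
    and transpose_closed: "A \<in> carrier G \<Longrightarrow> transpose_mat A \<in> carrier G"
begin

lemma two_nz: "(2 :: 'a) \<noteq> 0" "(2 :: 'a fract) \<noteq> 0"
proof -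
  have "(of_int 2 :: 'a) \<noteq> of_int 0" using injD[OF char0, of 2 0] by auto
  then show a: "(2 :: 'a) \<noteq> 0" by simp
  have "(2 :: 'a fract) = to_fract 2"
    using to_fract_add[of "1 :: 'a" 1] by (simp only: one_add_one to_fract_1)
  then show "(2 :: 'a fract) \<noteq> 0" using a fract_hom.hom_0_iff[of "2 :: 'a"] by metis
qed

lemma mult_closed [simp]: "A \<in> carrier G \<Longrightarrow> B \<in> carrier G \<Longrightarrow> A * B \<in> carrier G"
  using group.is_monoid[OF grp] monoid.m_closed mult_eq by metis

lemma elementary_G: "A \<in> elementary n \<Longrightarrow> A \<in> carrier G"
  using elementary_special special_sub by blast

definition minv :: "'a mat \<Rightarrow> 'a mat" where "minv A = inv A"

lemma minv [simp]:
  assumes "A \<in> carrier G"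
  shows "minv A \<in> carrier G" "A * minv A = 1\<^sub>m n" "minv A * A = 1\<^sub>m n"
  using group.inv_closed[OF grp assms] group.r_inv[OF grp assms] group.l_inv[OF grp assms]
  by (simp_all add: minv_def mult_eq one_eq)

lemma minv_mult: "A \<in> carrier G \<Longrightarrow> B \<in> carrier G \<Longrightarrow> minv (A * B) = minv B * minv A"
  using group.inv_mult_group[OF grp] by (simp add: minv_def mult_eq)

lemma minv_special: "A \<in> special n \<Longrightarrow> minv A = adj_mat A"
  using special_inverse_unique[of A n "minv A"] special_sub minv carrier_dim by metis

lemma minv_minv: "A \<in> carrier G \<Longrightarrow> minv (minv A) = A"
  unfolding minv_def using group.inv_inv[OF grp] .

lemma minv_elementary: "A \<in> elementary n \<Longrightarrow> minv A \<in> elementary n"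
  by (simp add: minv_special elementary_special elementary_inverse)

lemma minv_elem: "i < n \<Longrightarrow> j < n \<Longrightarrow> i \<noteq> j \<Longrightarrow> minv (elem n i j x) = elem n i j (- x)"
  by (simp add: minv_special adj_mat_elem)

text \<open>The identity or the inverse transpose, so that both types of automorphisms are treated by one formula.\<close>

definition contra :: "bool \<Rightarrow> 'a mat \<Rightarrow> 'a mat" where
  "contra b A = (if b then A else transpose_mat (minv A))"

lemma contra_closed: "A \<in> carrier G \<Longrightarrow> contra b A \<in> carrier G"
  by (simp add: contra_def transpose_closed)

lemma contra_carrier [simp]: "A \<in> carrier G \<Longrightarrow> contra b A \<in> carrier_mat n n"
  using contra_closed carrier_dim by blast

lemma contra_mult: "A \<in> carrier G \<Longrightarrow> B \<in> carrier G \<Longrightarrow> contra b (A * B) = contra b A * contra b B"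
  using carrier_dim[OF minv(1)] by (simp add: contra_def minv_mult transpose_mult[of _ n n _ n])

lemma contra_one: "contra b (1\<^sub>m n) = 1\<^sub>m n"
  using group.is_monoid[OF grp] by (simp add: contra_def minv_def monoid.inv_one flip: one_eq) (simp add: one_eq)

lemma contra_elem: "i < n \<Longrightarrow> j < n \<Longrightarrow> i \<noteq> j \<Longrightarrow>
    contra b (elem n i j x) = (if b then elem n i j x else elem n j i (- x))"
  by (simp add: contra_def minv_elem transpose_elem)

text \<open>The expected image of \<open>A\<close> under an automorphism of standard form.\<close>

definition std_image :: "bool \<Rightarrow> 'a fract mat \<Rightarrow> 'a fract mat \<Rightarrow> ('a \<Rightarrow> 'a) \<Rightarrow> 'a mat \<Rightarrow> 'a fract mat" where
  "std_image b g g' \<sigma> A = g * emb (map_mat \<sigma> (contra b A)) * g'"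

definition standard :: "('a mat \<Rightarrow> 'a mat) \<Rightarrow> bool \<Rightarrow> 'a fract mat \<Rightarrow> 'a fract mat \<Rightarrow> ('a \<Rightarrow> 'a) \<Rightarrow> bool" where
  "standard \<phi> b g g' \<sigma> \<longleftrightarrow> \<phi> \<in> hom G G \<and> g \<in> carrier_mat n n \<and> g' \<in> carrier_mat n n \<and>
    g * g' = 1\<^sub>m n \<and> g' * g = 1\<^sub>m n \<and> ring_endo \<sigma> \<and> (\<forall>A\<in>elementary n. emb (\<phi> A) = std_image b g g' \<sigma> A)"

lemma conj_mult:
  assumes "g \<in> carrier_mat n n" "g' \<in> carrier_mat n n" "g' * g = 1\<^sub>m n"
    and "X \<in> carrier_mat n n" "Y \<in> carrier_mat n n"
  shows "g * (X * Y) * g' = (g * X * g') * (g * Y * (g' :: 'b::comm_ring_1 mat))"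
  using assms by (simp add: assoc_mult_mat[of _ n n _ n _ n] mat_cancel[OF assms(3)])

lemma std_image_carrier [simp]:
  "g \<in> carrier_mat n n \<Longrightarrow> g' \<in> carrier_mat n n \<Longrightarrow> A \<in> carrier G \<Longrightarrow> std_image b g g' \<sigma> A \<in> carrier_mat n n"
  by (simp add: std_image_def)

lemma std_image_mult:
  assumes "g \<in> carrier_mat n n" "g' \<in> carrier_mat n n" "g' * g = 1\<^sub>m n" "ring_endo \<sigma>"
    and AB: "A \<in> carrier G" "B \<in> carrier G"
  shows "std_image b g g' \<sigma> (A * B) = std_image b g g' \<sigma> A * std_image b g g' \<sigma> B"
proof -
  interpret \<sigma>: comm_ring_hom \<sigma> using ring_endo_hom assms(4) .
  show ?thesis unfolding std_image_def
    using assms by (simp add: contra_mult \<sigma>.mat_hom_mult[of _ n n _ n] fract_hom.mat_hom_mult[of _ n n _ n] conj_mult)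
qed

lemma std_image_one:
  assumes "g \<in> carrier_mat n n" "g' \<in> carrier_mat n n" "g * g' = 1\<^sub>m n" "ring_endo \<sigma>"
  shows "std_image b g g' \<sigma> (1\<^sub>m n) = 1\<^sub>m n"
proof -
  interpret \<sigma>: comm_ring_hom \<sigma> using ring_endo_hom assms(4) .
  show ?thesis using assms by (simp add: std_image_def contra_one \<sigma>.mat_hom_one fract_hom.mat_hom_one)
qed

lemma emb_mult: "A \<in> carrier G \<Longrightarrow> B \<in> carrier G \<Longrightarrow> emb (A * B) = emb A * emb B"
  using carrier_dim fract_hom.mat_hom_mult by blast

lemma hom_facts:
  assumes "\<phi> \<in> hom G G"
  shows "A \<in> carrier G \<Longrightarrow> \<phi> A \<in> carrier G"
    and "A \<in> carrier G \<Longrightarrow> B \<in> carrier G \<Longrightarrow> \<phi> (A * B) = \<phi> A * \<phi> B"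
    and "\<phi> (1\<^sub>m n) = 1\<^sub>m n"
    and "A \<in> carrier G \<Longrightarrow> \<phi> (minv A) = minv (\<phi> A)"
proof -
  interpret h: group_hom G G \<phi> using assms grp by (simp add: group_hom_def group_hom_axioms_def)
  show "A \<in> carrier G \<Longrightarrow> \<phi> A \<in> carrier G" by simp
  show "A \<in> carrier G \<Longrightarrow> B \<in> carrier G \<Longrightarrow> \<phi> (A * B) = \<phi> A * \<phi> B"
    using h.hom_mult by (simp add: mult_eq)
  show "\<phi> (1\<^sub>m n) = 1\<^sub>m n" using h.hom_one by (simp add: one_eq)
  show "A \<in> carrier G \<Longrightarrow> \<phi> (minv A) = minv (\<phi> A)" by (simp add: minv_def)
qed

text \<open>The trace of the image of \<open>(1 + x E(0, 1)) (1 + E(1, 0))\<close> is \<open>n + c x\<close>. It lies in the domain, so \<open>c\<close> does not leave it.\<close>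

lemma standardI:
  assumes \<phi>: "\<phi> \<in> hom G G" and g: "g \<in> carrier_mat n n" "g' \<in> carrier_mat n n" "g * g' = 1\<^sub>m n" "g' * g = 1\<^sub>m n"
    and c: "c 1 = 1" "\<And>x y. c (x + y) = c x + c y" "\<And>x y. c (x * y) = c x * c y"
    and eqs: "\<And>i j x. i < n \<Longrightarrow> j < n \<Longrightarrow> i \<noteq> j \<Longrightarrow>
      emb (\<phi> (elem n i j x)) = g * (if b then elem n i j (c x) else elem n j i (- c x)) * g'"
  shows "\<exists>\<sigma>. standard \<phi> b g g' \<sigma>"
proof -
  have n: "0 < n" "1 < n" using n3 by auto
  define T where "T x = \<phi> (elem n 0 1 x * elem n 1 0 1)" for x :: 'a
  have T_G: "T x \<in> carrier_mat n n" for x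
    unfolding T_def using n by (intro carrier_dim hom_facts(1)[OF \<phi>]) (simp add: special_sub)
  have c0: "c 0 = 0" by (metis add.right_neutral add_left_imp_eq c(2))
  have trT: "to_fract (mtrace (T x)) = of_nat n + c x" for x
  proof -
    have G: "elem n 0 1 x \<in> carrier G" "elem n 1 0 1 \<in> carrier G" using n by (auto intro: special_sub)
    have "emb (T x) = g * ((if b then elem n 0 1 (c x) else elem n 1 0 (- c x)) *
        (if b then elem n 1 0 (c 1) else elem n 0 1 (- c 1))) * g'"
      using hom_facts[OF \<phi>] G eqs n g unfolding T_def by (simp add: emb_mult conj_mult)
    then have "mtrace (emb (T x)) = mtrace ((if b then elem n 0 1 (c x) else elem n 1 0 (- c x)) *
        (if b then elem n 1 0 (c 1) else elem n 0 1 (- c 1)))"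
      using g by (simp add: mtrace_conj[of _ n])
    also have "\<dots> = of_nat n + c x"
      using n c by (auto simp: mtrace_elem_mult mtrace_elem elem_index)
    finally show ?thesis using mtrace_map[of to_fract "T x" n] T_G by simp
  qed
  define \<sigma> where "\<sigma> x = mtrace (T x) - of_nat n" for x
  have \<sigma>: "to_fract (\<sigma> x) = c x" for x
    using trT[of x] by (simp add: \<sigma>_def to_fract_of_nat)
  have "ring_endo \<sigma>"
    unfolding ring_endo_def
  proof (intro conjI allI)
    have "to_fract (\<sigma> 1) = to_fract 1" by (simp add: \<sigma> c)
    then show "\<sigma> 1 = 1" by (simp only: to_fract_eq_iff)
    fix x y
    have "to_fract (\<sigma> (x + y)) = to_fract (\<sigma> x + \<sigma> y)" by (simp add: \<sigma> c)
    then show "\<sigma> (x + y) = \<sigma> x + \<sigma> y" by (simp only: to_fract_eq_iff)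
    have "to_fract (\<sigma> (x * y)) = to_fract (\<sigma> x * \<sigma> y)" by (simp add: \<sigma> c)
    then show "\<sigma> (x * y) = \<sigma> x * \<sigma> y" by (simp only: to_fract_eq_iff)
  qed
  then interpret \<sigma>: comm_ring_hom \<sigma> by (rule ring_endo_hom)
  have "emb (\<phi> A) = std_image b g g' \<sigma> A" if "A \<in> elementary n" for A
    using that
  proof (induction rule: elementary.induct)
    case elementary_one
    then show ?case using std_image_one[OF g(1-3) \<open>ring_endo \<sigma>\<close>] hom_facts(3)[OF \<phi>] fract_hom.mat_hom_one by simp
  next
    case (elementary_step A i j x)
    have G: "A \<in> carrier G" "elem n i j x \<in> carrier G" using elementary_step by (auto intro: elementary_G special_sub)
    have "emb (\<phi> (elem n i j x)) = std_image b g g' \<sigma> (elem n i j x)"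
      using elementary_step(2-4) unfolding std_image_def eqs[OF elementary_step(2-4)]
      by (simp add: contra_elem map_mat_elem hom_distribs \<sigma>)
    then show ?case
      using elementary_step G hom_facts[OF \<phi>] std_image_mult[OF g(1,2,4) \<open>ring_endo \<sigma>\<close>] by (simp add: emb_mult)
  qed
  then show ?thesis unfolding standard_def using \<phi> g \<open>ring_endo \<sigma>\<close> by blast
qed

lemma standard_exists:
  assumes "\<phi> \<in> iso G G"
  shows "\<exists>b g g' \<sigma>. standard \<phi> b g g' \<sigma>"
proof -
  have \<phi>: "\<phi> \<in> hom G G" and bij: "inj_on \<phi> (carrier G)" using assms by (auto simp: iso_def bij_betw_def)
  let ?\<rho> = "\<lambda>A. emb (\<phi> A)"
  interpret faithful_rep n ?\<rho>
  proof
    fix A B :: "'a mat" assume AB: "A \<in> special n"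
    show "?\<rho> A \<in> carrier_mat n n" using AB hom_facts(1)[OF \<phi>] special_sub carrier_dim by simp
    assume B: "B \<in> special n"
    show "?\<rho> (A * B) = ?\<rho> A * ?\<rho> B" using AB B hom_facts[OF \<phi>] special_sub emb_mult by simp
    assume "?\<rho> A = ?\<rho> B"
    then have "\<phi> A = \<phi> B" using fract_hom.mat_hom_inj by blast
    then show "A = B" using bij AB B special_sub inj_onD by metis
  qed (use n3 two_nz hom_facts(3)[OF \<phi>] in \<open>auto simp: fract_hom.mat_hom_one\<close>)
  obtain g g' c where "std_form n ?\<rho> g g' c \<or> std_form n (dual_rep ?\<rho>) g g' c"
    using faithful_rep_standard by blast
  then show ?thesis
  proof
    assume s: "std_form n ?\<rho> g g' c"
    then have "\<exists>\<sigma>. standard \<phi> True g g' \<sigma>"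
      by (intro standardI[OF \<phi>, where c = c]) (auto simp: std_form_def)
    then show ?thesis by blast
  next
    assume s: "std_form n (dual_rep ?\<rho>) g g' c"
    then have g: "g \<in> carrier_mat n n" "g' \<in> carrier_mat n n" "g * g' = 1\<^sub>m n" "g' * g = 1\<^sub>m n"
      and c: "c 1 = 1" "\<And>x y. c (x + y) = c x + c y" "\<And>x y. c (x * y) = c x * c y"
      and eqs: "\<And>i j x. i < n \<Longrightarrow> j < n \<Longrightarrow> i \<noteq> j \<Longrightarrow> dual_rep ?\<rho> (elem n i j x) = g * elem n i j (c x) * g'"
      by (auto simp: std_form_def)
    have "c 0 = 0" by (metis add.right_neutral add_left_imp_eq c(2))
    then have cm: "c (- x) = - c x" for x using c(2)[of x "- x"] by (simp add: eq_neg_iff_add_eq_0 add.commute)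
    have "\<exists>\<sigma>. standard \<phi> False (transpose_mat g') (transpose_mat g) \<sigma>"
    proof (rule standardI[OF \<phi>, where c = c])
      show "transpose_mat g' * transpose_mat g = 1\<^sub>m n" "transpose_mat g * transpose_mat g' = 1\<^sub>m n"
        unfolding transpose_mult[OF g(1,2), symmetric] transpose_mult[OF g(2,1), symmetric] g(3,4) by simp_all
      fix i j x assume ij: "i < n" "j < n" "i \<noteq> j"
      have "emb (\<phi> (elem n i j x)) = transpose_mat (dual_rep ?\<rho> (elem n i j (- x)))"
        using ij by (simp add: dual_rep_def adj_mat_elem)
      also have "\<dots> = transpose_mat g' * (transpose_mat (elem n i j (- c x)) * transpose_mat g)"
        unfolding eqs[OF ij] cm using g by (simp add: transpose_mult[of _ n n _ n])
      finally show "emb (\<phi> (elem n i j x)) =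
          transpose_mat g' * (if False then elem n i j (c x) else elem n j i (- c x)) * transpose_mat g"
        using g by (simp add: transpose_elem assoc_mult_mat[of _ n n _ n _ n])
    qed (use g c in auto)
    then show ?thesis by blast
  qed
qed

end

section \<open>Automorphisms of linear groups up to scalars, and their powers\<close>

lemma commute_all_elem_scalar:
  fixes Z :: "'a::idom mat"
  assumes Z: "Z \<in> carrier_mat n n" and n: "0 < n" and q: "q \<noteq> 0"
    and comm: "\<And>i j. i < n \<Longrightarrow> j < n \<Longrightarrow> i \<noteq> j \<Longrightarrow> Z * elem n i j q = elem n i j q * Z"
  shows "Z = Z $$ (0, 0) \<cdot>\<^sub>m 1\<^sub>m n"
proof (rule eq_matI)
  fix i j assume "i < dim_row (Z $$ (0, 0) \<cdot>\<^sub>m 1\<^sub>m n)" "j < dim_col (Z $$ (0, 0) \<cdot>\<^sub>m 1\<^sub>m n)"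
  then have ij: "i < n" "j < n" by auto
  have "Z $$ (i, j) = 0" if "i \<noteq> j"
    using commute_elem_entries(1)[OF Z ij(2,1) q comm[OF ij(2,1)]] that ij by auto
  moreover have "Z $$ (i, i) = Z $$ (0, 0)"
    using commute_elem_entries(3)[OF Z ij(1) n q comm[OF ij(1) n]] by (cases "i = 0") auto
  ultimately show "Z $$ (i, j) = (Z $$ (0, 0) \<cdot>\<^sub>m 1\<^sub>m n) $$ (i, j)" using ij by auto
qed (use Z in auto)

context linear_group
begin

context
  fixes \<phi> b g g' \<sigma>
  assumes st: "standard \<phi> b g g' \<sigma>"
begin

lemma standardD:
  shows "\<phi> \<in> hom G G" "g \<in> carrier_mat n n" "g' \<in> carrier_mat n n" "g * g' = 1\<^sub>m n" "g' * g = 1\<^sub>m n"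
    "ring_endo \<sigma>" "A \<in> elementary n \<Longrightarrow> emb (\<phi> A) = std_image b g g' \<sigma> A"
  using st by (auto simp: standard_def)

lemma image_mult: "A \<in> carrier G \<Longrightarrow> B \<in> carrier G \<Longrightarrow> emb (\<phi> (A * B)) = emb (\<phi> A) * emb (\<phi> B)"
  using hom_facts[OF standardD(1)] emb_mult by simp

lemma image_carrier: "A \<in> carrier G \<Longrightarrow> emb (\<phi> A) \<in> carrier_mat n n"
  using hom_facts[OF standardD(1)] carrier_dim by simp

lemmas M_mult = std_image_mult[OF standardD(2,3,5,6)]
lemmas M_one = std_image_one[OF standardD(2-4,6)]
lemmas M_carrier = std_image_carrier[OF standardD(2,3)]

text \<open>For \<open>e\<close> elementary, \<open>C e C\<^sup>-\<^sup>1\<close> is a product of elementary matrices, on which the image under \<open>\<phi>\<close> and the expected image agree. So the quotient of the actual and the expected image of \<open>C\<close> commutes with the expected images of all elementary matrices, and is scalar.\<close>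

lemma standard_up_to_scalar:
  assumes C: "C \<in> carrier G"
  shows "\<exists>\<chi>. \<chi> \<noteq> 0 \<and> emb (\<phi> C) = \<chi> \<cdot>\<^sub>m std_image b g g' \<sigma> C"
proof -
  let ?M = "std_image b g g' \<sigma>" and ?\<rho> = "\<lambda>A. emb (\<phi> A)" and ?C' = "minv C"
  interpret \<sigma>: comm_ring_hom \<sigma> using ring_endo_hom standardD(6) .
  note g = standardD(2-5)
  have C': "?C' \<in> carrier G" using C by simp
  have cM: "?M A \<in> carrier_mat n n" and c\<rho>: "?\<rho> A \<in> carrier_mat n n" if "A \<in> carrier G" for A
    using that M_carrier image_carrier by auto
  have n: "0 < n" using n3 by simp
  let ?T = "?M ?C' * ?\<rho> C"
  have cT: "?T \<in> carrier_mat n n" using cM[OF C'] c\<rho>[OF C] by simp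
  \<comment> \<open>Conjugating by \<open>g\<close> moves the quotient back to a matrix that commutes with genuine elementary matrices.\<close>
  let ?S = "g' * ?T * g"
  have cS: "?S \<in> carrier_mat n n" using g cT by simp
  have S: "?S * (if b then elem n i j 1 else elem n j i (- 1)) = (if b then elem n i j 1 else elem n j i (- 1)) * ?S"
    if ij: "i < n" "j < n" "i \<noteq> j" for i j
  proof -
    let ?e = "elem n i j 1 :: 'a mat" and ?X = "if b then elem n i j 1 else elem n j i (- 1) :: 'a fract mat"
    let ?e'' = "C * ?e * ?C'"
    have cX: "?X \<in> carrier_mat n n" by simp
    have e: "?e \<in> elementary n" "?e \<in> carrier G" using ij elementary_elem elementary_G by blast+
    have e'': "?e'' \<in> elementary n"
      using conj_elem_elementary[OF n3 carrier_dim[OF C'] carrier_dim[OF C] _ _ ij] C by simp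
    have e''G: "?e'' \<in> carrier G" using elementary_G[OF e''] .
    note d = carrier_dim[OF C] carrier_dim[OF C'] carrier_dim[OF e(2)]
    have r1: "C * ?e = ?e'' * C"
      using d C by (simp add: assoc_mult_mat[of _ n n _ n _ n])
    have r2: "?C' * ?e'' = ?e * ?C'"
      using d C mat_cancel[of ?C' C n "?e * ?C'"] by (simp add: assoc_mult_mat[of _ n n _ n _ n])
    have "?\<rho> C * ?M ?e = ?\<rho> (C * ?e)"
      unfolding image_mult[OF C e(2)] standardD(7)[OF e(1)] ..
    also have "\<dots> = ?\<rho> (?e'' * C)" using r1 by (rule arg_cong)
    also have "\<dots> = ?\<rho> ?e'' * ?\<rho> C" by (rule image_mult[OF e''G C])
    also have "?\<rho> ?e'' = ?M ?e''" by (rule standardD(7)[OF e''])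
    finally have 1: "?\<rho> C * ?M ?e = ?M ?e'' * ?\<rho> C" .
    have "?T * ?M ?e = ?M ?C' * (?\<rho> C * ?M ?e)"
      by (rule assoc_mult_mat[OF cM[OF C'] c\<rho>[OF C] cM[OF e(2)]])
    also have "\<dots> = ?M ?C' * ?M ?e'' * ?\<rho> C"
      unfolding 1 by (rule assoc_mult_mat[OF cM[OF C'] cM[OF e''G] c\<rho>[OF C], symmetric])
    also have "\<dots> = ?M ?e * ?M ?C' * ?\<rho> C"
      unfolding M_mult[OF C' e''G, symmetric] M_mult[OF e(2) C', symmetric] r2 ..
    also have "\<dots> = ?M ?e * ?T"
      by (rule assoc_mult_mat[OF cM[OF e(2)] cM[OF C'] c\<rho>[OF C]])
    finally have T: "?T * ?M ?e = ?M ?e * ?T" .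
    have Me: "?M ?e = g * ?X * g'"
      using ij by (simp add: std_image_def contra_elem map_mat_elem hom_distribs)
    have gX: "g * ?X = ?M ?e * g"
      unfolding Me using g cX by (simp add: assoc_mult_mat[of _ n n _ n _ n])
    have Xg: "g' * ?M ?e = ?X * g'"
      unfolding Me using g cX by (simp add: assoc_mult_mat[of _ n n _ n _ n] mat_cancel[OF g(4)])
    have "?S * ?X = g' * ?T * (g * ?X)" using g cT cX by (simp add: assoc_mult_mat[of _ n n _ n _ n])
    also have "\<dots> = g' * (?T * ?M ?e) * g"
      unfolding gX using g cT cM[OF e(2)] by (simp add: assoc_mult_mat[of _ n n _ n _ n])
    also have "\<dots> = (g' * ?M ?e) * ?T * g"
      unfolding T using g cT cM[OF e(2)] by (simp add: assoc_mult_mat[of _ n n _ n _ n])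
    also have "\<dots> = ?X * ?S" unfolding Xg using g cT cX by (simp add: assoc_mult_mat[of _ n n _ n _ n])
    finally show ?thesis .
  qed
  define \<chi> where "\<chi> = ?S $$ (0, 0)"
  have Sx: "?S = \<chi> \<cdot>\<^sub>m 1\<^sub>m n"
  proof (cases b)
    case True
    then show ?thesis unfolding \<chi>_def
      using S by (intro commute_all_elem_scalar[OF cS n, of 1]) auto
  next
    case False
    then show ?thesis unfolding \<chi>_def
      using S by (intro commute_all_elem_scalar[OF cS n, of "- 1"]) auto
  qed
  have "X = g * (g' * X * g) * g'" if "X \<in> carrier_mat n n" for X
    using g that by (simp add: assoc_mult_mat[of _ n n _ n _ n] mat_cancel[OF g(3)])
  from this[OF cT] have "?T = g * ?S * g'" .
  also have "\<dots> = \<chi> \<cdot>\<^sub>m 1\<^sub>m n"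
    unfolding Sx using g by (simp add: mult_smult_assoc_mat[of _ n n _ n] mult_smult_distrib[of _ n n _ n])
  finally have T: "?T = \<chi> \<cdot>\<^sub>m 1\<^sub>m n" .
  have MM: "?M C * ?M ?C' = 1\<^sub>m n" using M_mult[OF C C'] M_one C by simp
  have "?\<rho> C = ?M C * ?T" using mat_cancel[OF MM cM[OF C] cM[OF C'] c\<rho>[OF C]] by simp
  also have "\<dots> = \<chi> \<cdot>\<^sub>m ?M C" unfolding T using cM[OF C] by (simp add: mult_smult_distrib[of _ n n _ n])
  finally have eq: "?\<rho> C = \<chi> \<cdot>\<^sub>m ?M C" .
  have "\<chi> \<noteq> 0"
  proof
    assume "\<chi> = 0"
    then have z: "?\<rho> C = 0\<^sub>m n n" using eq cM[OF C] by (auto intro!: eq_matI)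
    have "?\<rho> C * ?\<rho> ?C' = 1\<^sub>m n"
      using image_mult[OF C C', symmetric] C hom_facts(3)[OF standardD(1)] fract_hom.mat_hom_one[of n] by simp
    then have "(0\<^sub>m n n :: 'a fract mat) = 1\<^sub>m n" using z c\<rho>[OF C'] by simp
    then have "(0\<^sub>m n n :: 'a fract mat) $$ (0, 0) = 1\<^sub>m n $$ (0, 0)" by simp
    then show False using n by simp
  qed
  then show ?thesis using eq by blast
qed

text \<open>The scalars of \<open>standard_up_to_scalar\<close> are the values of a homomorphism into a commutative group, so they are trivial on commutators.\<close>

lemma standard_commutator:
  assumes B: "B1 \<in> carrier G" "B2 \<in> carrier G" "B \<in> carrier G" and eq: "B1 * B2 = B * (B2 * B1)"
  shows "emb (\<phi> B) = std_image b g g' \<sigma> B"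
proof -
  let ?M = "std_image b g g' \<sigma>"
  have cM: "?M A \<in> carrier_mat n n" if "A \<in> carrier G" for A using that M_carrier by blast
  obtain x1 where x1: "x1 \<noteq> 0" "emb (\<phi> B1) = x1 \<cdot>\<^sub>m ?M B1" using standard_up_to_scalar B by blast
  obtain x2 where x2: "x2 \<noteq> 0" "emb (\<phi> B2) = x2 \<cdot>\<^sub>m ?M B2" using standard_up_to_scalar B by blast
  obtain x where x: "x \<noteq> 0" "emb (\<phi> B) = x \<cdot>\<^sub>m ?M B" using standard_up_to_scalar B by blast
  have "emb (\<phi> B1) * emb (\<phi> B2) = emb (\<phi> B) * (emb (\<phi> B2) * emb (\<phi> B1))"
    using eq image_mult B by (metis mult_closed)
  then have "(x1 * x2) \<cdot>\<^sub>m (?M B1 * ?M B2) = (x * x1 * x2) \<cdot>\<^sub>m (?M B * (?M B2 * ?M B1))"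
    unfolding x1 x2 x using cM[OF B(1)] cM[OF B(2)] cM[OF B(3)]
    by (simp add: mult_smult_assoc_mat[of _ n n _ n] mult_smult_distrib[of _ n n _ n] smult_smult_times ac_simps)
  moreover have "?M B1 * ?M B2 = ?M B * (?M B2 * ?M B1)"
    using eq M_mult B by (metis mult_closed)
  ultimately have "(x1 * x2) \<cdot>\<^sub>m ?M (B1 * B2) = (x * x1 * x2) \<cdot>\<^sub>m ?M (B1 * B2)" using M_mult B by simp
  then have s: "(x1 * x2) \<cdot>\<^sub>m ?M (B1 * B2) * ?M (minv (B1 * B2)) = (x * x1 * x2) \<cdot>\<^sub>m ?M (B1 * B2) * ?M (minv (B1 * B2))"
    by simp
  have G: "B1 * B2 \<in> carrier G" using B by simp
  have "?M (B1 * B2) * ?M (minv (B1 * B2)) = 1\<^sub>m n"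
    using M_mult[OF G minv(1)[OF G]] G M_one by simp
  then have "(x1 * x2) \<cdot>\<^sub>m (1\<^sub>m n :: 'a fract mat) = (x * x1 * x2) \<cdot>\<^sub>m 1\<^sub>m n"
    using s cM[OF G] cM[OF minv(1)[OF G]] by (simp add: mult_smult_assoc_mat[of _ n n _ n])
  then have "((x1 * x2) \<cdot>\<^sub>m (1\<^sub>m n :: 'a fract mat)) $$ (0, 0) = ((x * x1 * x2) \<cdot>\<^sub>m 1\<^sub>m n) $$ (0, 0)" by simp
  then have "x1 * x2 = x * x1 * x2" using n3 by simp
  then have "x = 1" using x1 x2 by simp
  then show ?thesis using x by simp
qed

text \<open>Elementary matrices are commutators, and so are their images under a homomorphism, even if these are no products of elementary matrices.\<close>

lemma standard_image_elementary:
  assumes \<phi>2: "\<phi>2 \<in> hom G G" and A: "A \<in> elementary n"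
  shows "emb (\<phi> (\<phi>2 A)) = std_image b g g' \<sigma> (\<phi>2 A)"
  using A
proof (induction rule: elementary.induct)
  case elementary_one
  then show ?case using hom_facts(3)[OF \<phi>2] hom_facts(3)[OF standardD(1)] M_one fract_hom.mat_hom_one[of n] by simp
next
  case (elementary_step A i j x)
  have "\<exists>k<3. k \<noteq> i \<and> k \<noteq> j" by presburger
  then obtain k where k: "k < n" "k \<noteq> i" "k \<noteq> j" using n3 by (meson less_le_trans)
  have G: "A \<in> carrier G" "elem n i j x \<in> carrier G" "elem n i k x \<in> carrier G" "elem n k j 1 \<in> carrier G"
    using elementary_step k by (auto intro: elementary_G elementary_elem)
  note h = hom_facts[OF \<phi>2]
  have "elem n i k x * elem n k j 1 = elem n i j x * (elem n k j 1 * elem n i k x)"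
    using elem_commutator[of i n k j x 1] elementary_step k by simp
  then have "\<phi>2 (elem n i k x) * \<phi>2 (elem n k j 1) = \<phi>2 (elem n i j x) * (\<phi>2 (elem n k j 1) * \<phi>2 (elem n i k x))"
    using h(2) G by (metis mult_closed)
  then have "emb (\<phi> (\<phi>2 (elem n i j x))) = std_image b g g' \<sigma> (\<phi>2 (elem n i j x))"
    using standard_commutator h(1) G by blast
  then show ?case using elementary_step h G image_mult M_mult by simp
qed

lemma standard_trace:
  assumes B: "B \<in> carrier G" and eq: "emb (\<phi> B) = std_image b g g' \<sigma> B"
  shows "mtrace (\<phi> B) = \<sigma> (mtrace (contra b B))"
proof -
  interpret \<sigma>: comm_ring_hom \<sigma> using ring_endo_hom standardD(6) .
  have c: "contra b B \<in> carrier_mat n n" "\<phi> B \<in> carrier_mat n n"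
    using B carrier_dim hom_facts(1)[OF standardD(1)] by auto
  have "to_fract (mtrace (\<phi> B)) = mtrace (emb (\<phi> B))" using mtrace_map[of to_fract "\<phi> B" n] c by simp
  also have "\<dots> = mtrace (emb (map_mat \<sigma> (contra b B)))"
    unfolding eq std_image_def using c by (intro mtrace_conj[OF standardD(2,3) _ standardD(5)]) simp
  also have "\<dots> = to_fract (mtrace (map_mat \<sigma> (contra b B)))"
    using c by (intro mtrace_map[of _ _ n]) auto
  also have "mtrace (map_mat \<sigma> (contra b B)) = \<sigma> (mtrace (contra b B))"
    using c by (intro mtrace_map[of _ _ n]) (auto simp: \<sigma>.hom_add)
  finally show ?thesis by simp
qed

end

lemma mtrace_contra: "B \<in> carrier G \<Longrightarrow> mtrace (contra b B) = (if b then mtrace B else mtrace (minv B))"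
  using mtrace_transpose[OF carrier_dim[OF minv(1)]] by (simp add: contra_def)

text \<open>Both this matrix and its inverse have trace \<open>n + x\<close>, so the trace of its image reveals \<open>\<sigma> x\<close> whatever the type of the automorphism is.\<close>

definition sigma_probe :: "'a \<Rightarrow> 'a mat" where "sigma_probe x = elem n 0 1 x * elem n 1 0 1"

lemma sigma_probe: "sigma_probe x \<in> elementary n" "mtrace (sigma_probe x) = of_nat n + x" "mtrace (minv (sigma_probe x)) = of_nat n + x"
proof -
  have n: "0 < n" "1 < n" using n3 by auto
  show "sigma_probe x \<in> elementary n" using n unfolding sigma_probe_def by (intro elementary_mult elementary_elem) auto
  show "mtrace (sigma_probe x) = of_nat n + x" using n by (simp add: sigma_probe_def mtrace_elem_mult mtrace_elem elem_index)
  have "minv (sigma_probe x) = elem n 1 0 (- 1) * elem n 0 1 (- x)"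
    using n unfolding sigma_probe_def by (subst minv_mult) (auto simp: minv_elem intro!: elementary_G elementary_elem)
  then show "mtrace (minv (sigma_probe x)) = of_nat n + x" using n by (simp add: mtrace_elem_mult mtrace_elem elem_index)
qed

text \<open>A matrix whose trace differs from that of its inverse. It distinguishes the two types of automorphisms; no such product of elementary matrices exists for \<open>n = 2\<close>.\<close>

definition type_probe :: "'a mat" where "type_probe = elem n 0 1 1 * (elem n 1 2 1 * elem n 2 0 1)"

lemma type_probe: "type_probe \<in> elementary n" "mtrace type_probe = of_nat n + 1" "mtrace (minv type_probe) = of_nat n"
proof -
  have n: "0 < n" "1 < n" "2 < n" using n3 by auto
  show "type_probe \<in> elementary n" using n by (auto simp: type_probe_def intro!: elementary_mult elementary_elem)
  show "mtrace type_probe = of_nat n + 1" using n by (simp add: type_probe_def mtrace_elem_mult elem_mult_index mtrace_elem elem_index)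
  have "minv type_probe = elem n 2 0 (- 1) * elem n 1 2 (- 1) * elem n 0 1 (- 1)"
    using n unfolding type_probe_def by (simp add: minv_mult minv_elem elementary_G elementary_elem)
  also have "\<dots> = elem n 2 0 (- 1) * (elem n 1 2 (- 1) * elem n 0 1 (- 1))"
    by (rule assoc_mult_mat[of _ n n _ n _ n]) auto
  finally show "mtrace (minv type_probe) = of_nat n" using n by (simp add: mtrace_elem_mult elem_mult_index mtrace_elem elem_index)
qed

lemma sigma_trace:
  assumes "standard \<phi> b g g' \<sigma>"
  shows "mtrace (\<phi> (sigma_probe x)) = of_nat n + \<sigma> x" "mtrace (minv (\<phi> (sigma_probe x))) = of_nat n + \<sigma> x"
proof -
  note s = standardD[OF assms]
  interpret \<sigma>: comm_ring_hom \<sigma> using ring_endo_hom s(6) .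
  have G: "sigma_probe x \<in> carrier G" "minv (sigma_probe x) \<in> carrier G" using sigma_probe(1) elementary_G by auto
  show "mtrace (\<phi> (sigma_probe x)) = of_nat n + \<sigma> x"
    using standard_trace[OF assms G(1) s(7)] sigma_probe G by (simp add: mtrace_contra hom_distribs)
  have "mtrace (\<phi> (minv (sigma_probe x))) = of_nat n + \<sigma> x"
    using standard_trace[OF assms G(2) s(7)] sigma_probe minv_elementary[OF sigma_probe(1)] G by (simp add: mtrace_contra minv_minv hom_distribs)
  then show "mtrace (minv (\<phi> (sigma_probe x))) = of_nat n + \<sigma> x" using hom_facts(4)[OF s(1)] G by simp
qed

lemma comp_trace:
  assumes 1: "standard \<phi>1 b1 g1 g1' \<sigma>1" and 2: "standard \<phi>2 b2 g2 g2' \<sigma>2"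
  shows "mtrace (\<phi>1 (\<phi>2 (sigma_probe x))) = of_nat n + \<sigma>1 (\<sigma>2 x)"
proof -
  interpret \<sigma>: comm_ring_hom \<sigma>1 using ring_endo_hom standardD(6)[OF 1] .
  note h = standardD(1)[OF 2]
  have G: "\<phi>2 (sigma_probe x) \<in> carrier G" using hom_facts(1)[OF h] sigma_probe(1) elementary_G by blast
  show ?thesis
    using standard_trace[OF 1 G standard_image_elementary[OF 1 h sigma_probe(1)]] sigma_trace[OF 2] G
    by (simp add: mtrace_contra hom_distribs)
qed

lemma sigma_comp:
  assumes "standard \<phi>1 b1 g1 g1' \<sigma>1" "standard \<phi>2 b2 g2 g2' \<sigma>2" "standard (\<phi>1 \<circ> \<phi>2) b g g' \<sigma>"
  shows "\<sigma> = \<sigma>1 \<circ> \<sigma>2"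
proof
  fix x show "\<sigma> x = (\<sigma>1 \<circ> \<sigma>2) x"
    using comp_trace[OF assms(1,2), of x] sigma_trace(1)[OF assms(3), of x] by simp
qed

text \<open>The two inversions cancel.\<close>

lemma square_type:
  assumes 1: "standard \<phi> b g g' \<sigma>" and 2: "standard (\<phi> \<circ> \<phi>) b' h h' \<tau>"
  shows b'
proof (rule ccontr)
  assume nb: "\<not> b'"
  interpret \<sigma>: comm_ring_hom \<sigma> using ring_endo_hom standardD(6)[OF 1] .
  interpret \<tau>: comm_ring_hom \<tau> using ring_endo_hom standardD(6)[OF 2] .
  note s = standardD[OF 1]
  have G: "type_probe \<in> carrier G" "minv type_probe \<in> carrier G" "\<phi> type_probe \<in> carrier G"
    using type_probe(1) elementary_G hom_facts(1)[OF s(1)] by auto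
  have "mtrace (contra b (\<phi> type_probe)) = of_nat n + 1"
  proof (cases b)
    case True
    then show ?thesis
      using standard_trace[OF 1 G(1) s(7)] type_probe G by (simp add: mtrace_contra hom_distribs)
  next
    case False
    have "mtrace (\<phi> (minv type_probe)) = of_nat n + 1"
      using standard_trace[OF 1 G(2) s(7)] type_probe minv_elementary[OF type_probe(1)] G False
      by (simp add: mtrace_contra minv_minv hom_distribs)
    then show ?thesis using False G hom_facts(4)[OF s(1) G(1)] by (simp add: mtrace_contra)
  qed
  then have "mtrace (\<phi> (\<phi> type_probe)) = of_nat n + 1"
    using standard_trace[OF 1 G(3) standard_image_elementary[OF 1 s(1) type_probe(1)]] by (simp add: hom_distribs)
  moreover have "mtrace ((\<phi> \<circ> \<phi>) type_probe) = of_nat n"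
    using standard_trace[OF 2 G(1) standardD(7)[OF 2]] type_probe G nb by (simp add: mtrace_contra hom_distribs)
  ultimately show False by simp
qed

lemma iso_funpow: "\<phi> \<in> iso G G \<Longrightarrow> (\<phi> ^^ k) \<in> iso G G"
proof (induction k)
  case 0 then show ?case by (auto simp: iso_def hom_def bij_betw_def)
next
  case (Suc k)
  then show ?case using iso_set_trans[of "\<phi> ^^ k" G G \<phi> G] by (simp add: comp_def)
qed

lemma sigma_funpow:
  assumes \<phi>: "\<phi> \<in> iso G G" and 1: "standard \<phi> b g g' \<sigma>" and "standard (\<phi> ^^ k) b2 g2 g2' \<tau>"
  shows "\<tau> = \<sigma> ^^ k"
  using assms(3)
proof (induction k arbitrary: b2 g2 g2' \<tau>)
  case 0
  show ?case
  proof
    fix x show "\<tau> x = (\<sigma> ^^ 0) x" using sigma_trace(1)[OF 0, of x] sigma_probe(2)[of x] by simp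
  qed
next
  case (Suc k)
  obtain b3 g3 g3' \<tau>3 where 3: "standard (\<phi> ^^ k) b3 g3 g3' \<tau>3"
    using standard_exists[OF iso_funpow[OF \<phi>]] by blast
  then have "\<tau>3 = \<sigma> ^^ k" using Suc.IH by blast
  moreover have "\<tau> = \<sigma> \<circ> \<tau>3" using sigma_comp[OF 1 3] Suc.prems by (simp add: comp_def)
  ultimately show ?case by simp
qed

text \<open>The inverse automorphism has a standard form too, and the two ring endomorphisms are inverse to each other by the trace formula.\<close>

lemma sigma_bij:
  assumes \<phi>: "\<phi> \<in> iso G G" and 1: "standard \<phi> b g g' \<sigma>"
  shows "bij \<sigma>"
proof -
  let ?\<psi> = "inv_into (carrier G) \<phi>"
  have \<psi>: "?\<psi> \<in> iso G G" by (rule group.iso_set_sym[OF grp \<phi>])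
  have bij: "bij_betw \<phi> (carrier G) (carrier G)" using \<phi> by (simp add: iso_def)
  obtain b2 g2 g2' \<tau> where 2: "standard ?\<psi> b2 g2 g2' \<tau>" using standard_exists[OF \<psi>] by blast
  have G: "sigma_probe x \<in> carrier G" for x using sigma_probe(1) elementary_G by blast
  have "\<sigma> (\<tau> x) = x" for x
    using comp_trace[OF 1 2, of x] bij_betw_inv_into_right[OF bij G] sigma_probe(2)[of x] by simp
  moreover have "\<tau> (\<sigma> x) = x" for x
    using comp_trace[OF 2 1, of x] bij_betw_inv_into_left[OF bij G] sigma_probe(2)[of x] by simp
  ultimately show ?thesis by (metis bijI')
qed

text \<open>If \<open>\<sigma>\<close> has order \<open>m\<close> then \<open>\<phi>\<^sup>m\<close> acts trivially on the ring, and its square is not of inverse transpose type.\<close>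

lemma inner_power_exists:
  assumes tor: "torsion_group (ring_Aut TYPE('a))" and \<phi>: "\<phi> \<in> iso G G"
  shows "\<exists>L h h'. L > 0 \<and> standard (\<phi> ^^ L) True h h' id"
proof -
  obtain b g g' \<sigma> where 1: "standard \<phi> b g g' \<sigma>" using standard_exists[OF \<phi>] by blast
  have "ring_isom \<sigma>"
    unfolding ring_isom_iff using sigma_bij[OF \<phi> 1] standardD(6)[OF 1] by (simp add: ring_endo_def)
  then have "\<sigma> \<in> carrier (ring_Aut TYPE('a))" by (simp add: ring_Aut_def)
  then obtain m :: nat where m: "m > 0" "\<sigma> [^]\<^bsub>ring_Aut TYPE('a)\<^esub> m = \<one>\<^bsub>ring_Aut TYPE('a)\<^esub>"
    using tor unfolding torsion_group_def by blast
  have "\<sigma> [^]\<^bsub>ring_Aut TYPE('a)\<^esub> k = \<sigma> ^^ k" for k :: nat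
    by (induction k) (simp_all add: ring_Aut_def nat_pow_def funpow_Suc_right del: funpow.simps(2))
  then have \<sigma>m: "\<sigma> ^^ m = id" using m(2) by (simp add: ring_Aut_def)
  obtain b2 g2 g2' \<tau> where 2: "standard (\<phi> ^^ m) b2 g2 g2' \<tau>" using standard_exists[OF iso_funpow[OF \<phi>]] by blast
  obtain b3 g3 g3' \<tau>3 where 3: "standard (\<phi> ^^ (m + m)) b3 g3 g3' \<tau>3"
    using standard_exists[OF iso_funpow[OF \<phi>]] by blast
  have "\<tau>3 = \<sigma> ^^ (m + m)" using sigma_funpow[OF \<phi> 1 3] .
  then have "\<tau>3 = id" using \<sigma>m by (simp add: funpow_add)
  moreover have b3 using square_type[OF 2] 3 by (simp add: funpow_add)
  ultimately show ?thesis using 3 m(1) by (intro exI[of _ "m + m"]) auto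
qed

end

section \<open>Generic integral matrices and polynomial functions\<close>

lemma sum_coeff_monom:
  assumes "finite I" "inj_on h I" "r \<in> I"
  shows "(\<Sum>i\<in>I. coeff (monom (f i) (h i)) (h r)) = (f r :: 'f::comm_ring_1)"
proof -
  have "(\<Sum>i\<in>I. coeff (monom (f i) (h i)) (h r)) = (\<Sum>i\<in>I. if i = r then f r else 0)"
    using assms by (intro sum.cong) (auto dest: inj_onD)
  then show ?thesis using assms by simp
qed

text \<open>Column 0 of the integral test matrix.\<close>

definition omega :: "int \<Rightarrow> nat \<Rightarrow> int" where
  "omega s r = s ^ r"

text \<open>Row 1 of the inverse of the integral test matrix. The coordinate 0 is forced by orthogonality to \<open>omega\<close>.\<close>

definition zeta :: "nat \<Rightarrow> int \<Rightarrow> nat \<Rightarrow> int" where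
  "zeta n s r = (if r = 0 then - (\<Sum>m = 1..<n. s ^ (2 * m - 1)) else s ^ (r - 1))"

text \<open>The entries of \<open>omega\<close> are linearly independent polynomials in \<open>s\<close>.\<close>

lemma omega_poly:
  fixes R :: "nat \<Rightarrow> 'f::field"
  assumes "\<exists>r<n. R r \<noteq> 0"
  shows "\<exists>W. W \<noteq> 0 \<and> (\<forall>s. poly W (of_int s) = (\<Sum>r<n. R r * of_int (omega s r)))"
proof (intro exI conjI allI)
  let ?W = "\<Sum>r<n. monom (R r) r"
  obtain r where r: "r < n" "R r \<noteq> 0" using assms by blast
  have "coeff ?W r = R r" using sum_coeff_monom[of "{..<n}" id r R] r by (simp add: coeff_sum)
  then show "?W \<noteq> 0" using r by auto
  show "poly ?W (of_int s) = (\<Sum>r<n. R r * of_int (omega s r))" for s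
    by (simp add: poly_sum poly_monom omega_def)
qed

text \<open>The entries of \<open>zeta\<close> are linearly independent polynomials in \<open>s\<close>: those with positive index are distinct monomials of degree at most \<open>n - 2\<close>, and the one with index 0 has degree \<open>2 n - 3\<close>.\<close>

lemma zeta_poly:
  fixes R :: "nat \<Rightarrow> 'f::field"
  assumes n: "n \<ge> 2" and R: "\<exists>r<n. R r \<noteq> 0"
  shows "\<exists>Z. Z \<noteq> 0 \<and> (\<forall>s. poly Z (of_int s) = (\<Sum>r<n. R r * of_int (zeta n s r)))"
proof (intro exI conjI allI)
  let ?Z1 = "\<Sum>r = 1..<n. monom (R r) (r - 1)" and ?Z2 = "\<Sum>m = 1..<n. monom (R 0) (2 * m - 1)"
  have c1: "coeff ?Z1 k = (if k + 1 < n then R (k + 1) else 0)" for k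
  proof -
    have "coeff ?Z1 k = (\<Sum>r = 1..<n. if r = k + 1 then R r else 0)"
      unfolding coeff_sum by (rule sum.cong) auto
    then show ?thesis by simp
  qed
  show "?Z1 - ?Z2 \<noteq> 0"
  proof (cases "R 0 = 0")
    case True
    then obtain r where "0 < r" "r < n" "R r \<noteq> 0" using R by (metis gr0I)
    then have "coeff (?Z1 - ?Z2) (r - 1) \<noteq> 0" using c1[of "r - 1"] True by simp
    then show ?thesis by (metis coeff_0)
  next
    case False
    have "coeff ?Z2 (2 * (n - 1) - 1) = R 0"
      unfolding coeff_sum using n by (intro sum_coeff_monom) (auto intro!: inj_onI)
    then have "coeff (?Z1 - ?Z2) (2 * (n - 1) - 1) = - R 0" using c1[of "2 * (n - 1) - 1"] n by auto
    then show ?thesis using False by (metis coeff_0 neg_0_equal_iff_equal)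
  qed
  show "poly (?Z1 - ?Z2) (of_int s) = (\<Sum>r<n. R r * of_int (zeta n s r))" for s
  proof -
    have "(\<Sum>r<n. R r * of_int (zeta n s r)) = R 0 * of_int (zeta n s 0) + (\<Sum>r = 1..<n. R r * of_int (zeta n s r))"
      using n by (simp add: lessThan_atLeast0 sum.atLeast_Suc_lessThan)
    also have "(\<Sum>r = 1..<n. R r * of_int (zeta n s r)) = (\<Sum>r = 1..<n. R r * of_int s ^ (r - 1))"
      by (rule sum.cong) (auto simp: zeta_def)
    finally show ?thesis
      by (simp add: poly_sum poly_monom zeta_def sum_distrib_left)
  qed
qed

lemma generic_parameter:
  fixes \<R> :: "(nat \<Rightarrow> 'f::field) set"
  assumes char: "inj (of_int :: int \<Rightarrow> 'f)" and n: "n \<ge> 2" and fin: "finite \<R>"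
    and nz: "\<And>R. R \<in> \<R> \<Longrightarrow> \<exists>r<n. R r \<noteq> 0"
  shows "\<exists>s. \<forall>R\<in>\<R>. (\<Sum>r<n. R r * of_int (omega s r)) \<noteq> 0 \<and> (\<Sum>r<n. R r * of_int (zeta n s r)) \<noteq> 0"
proof -
  have "\<forall>R\<in>\<R>. \<exists>P. P \<noteq> 0 \<and> (\<forall>s. poly P (of_int s) =
      (\<Sum>r<n. R r * of_int (omega s r)) * (\<Sum>r<n. R r * of_int (zeta n s r)))"
  proof
    fix R assume "R \<in> \<R>"
    obtain W where W: "W \<noteq> 0" "\<forall>s. poly W (of_int s) = (\<Sum>r<n. R r * of_int (omega s r))"
      using omega_poly nz \<open>R \<in> \<R>\<close> by metis
    obtain Z where Z: "Z \<noteq> 0" "\<forall>s. poly Z (of_int s) = (\<Sum>r<n. R r * of_int (zeta n s r))"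
      using zeta_poly[OF n] nz \<open>R \<in> \<R>\<close> by metis
    show "\<exists>P. P \<noteq> 0 \<and> (\<forall>s. poly P (of_int s) =
        (\<Sum>r<n. R r * of_int (omega s r)) * (\<Sum>r<n. R r * of_int (zeta n s r)))"
      using W Z by (intro exI[of _ "W * Z"]) simp
  qed
  then obtain P where P: "\<And>R. R \<in> \<R> \<Longrightarrow> P R \<noteq> 0" "\<And>R s. R \<in> \<R> \<Longrightarrow> poly (P R) (of_int s) =
      (\<Sum>r<n. R r * of_int (omega s r)) * (\<Sum>r<n. R r * of_int (zeta n s r))"
    by metis
  have "(\<Prod>R\<in>\<R>. P R) \<noteq> 0" using P(1) fin by simp
  then have "finite {x. poly (\<Prod>R\<in>\<R>. P R) x = 0}" by (rule poly_roots_finite)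
  then have "finite (of_int -` {x. poly (\<Prod>R\<in>\<R>. P R) x = 0} :: int set)"
    using char by (rule finite_vimageI)
  then obtain s where "s \<notin> (of_int -` {x. poly (\<Prod>R\<in>\<R>. P R) x = 0} :: int set)"
    using ex_new_if_finite[OF infinite_UNIV_int] by blast
  then have "\<forall>R\<in>\<R>. poly (P R) (of_int s) \<noteq> 0" using fin by (simp add: poly_prod)
  then show ?thesis using P(2) by (intro exI[of _ s]) auto
qed

text \<open>The two factors are \<open>1 + a e\<^sub>0\<^sup>T\<close> and \<open>1 + e\<^sub>1 b\<^sup>T\<close>; the first determines column 0 of the product, and \<open>b\<close> is chosen to give row 1 of the inverse enough independent entries.\<close>

definition test_mat :: "nat \<Rightarrow> int \<Rightarrow> 'a::comm_ring_1 mat" where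
  "test_mat n s = dyadic n (\<lambda>m. if m = 0 then 0 else of_int s ^ m) (unit_fun 0) *
    dyadic n (unit_fun 1) (\<lambda>m. if m < 2 then 0 else - (of_int s ^ (m - 1)))"

definition test_inv :: "nat \<Rightarrow> int \<Rightarrow> 'a::comm_ring_1 mat" where
  "test_inv n s = dyadic n (unit_fun 1) (\<lambda>m. - (if m < 2 then 0 else - (of_int s ^ (m - 1)))) *
    dyadic n (\<lambda>m. - (if m = 0 then 0 else of_int s ^ m)) (unit_fun 0)"

lemma test_mat_elementary: "n \<ge> 2 \<Longrightarrow> test_mat n s \<in> elementary n"
  unfolding test_mat_def by (intro elementary_mult dyadic_unit_left_elementary dyadic_unit_right_elementary) auto

lemma test_inv_elementary: "n \<ge> 2 \<Longrightarrow> test_inv n s \<in> elementary n"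
  unfolding test_inv_def by (intro elementary_mult dyadic_unit_left_elementary dyadic_unit_right_elementary) auto

lemma test_mat_test_inv:
  assumes n: "n \<ge> 2"
  shows "test_mat n s * test_inv n s = (1\<^sub>m n :: 'a::comm_ring_1 mat)"
proof -
  let ?a = "\<lambda>m. if m = 0 then 0 else of_int s ^ m :: 'a" and ?b = "\<lambda>m. if m < 2 then 0 else - (of_int s ^ (m - 1)) :: 'a"
  have A: "dyadic n ?a (unit_fun 0) * dyadic n (\<lambda>m. - ?a m) (unit_fun 0) = 1\<^sub>m n" using n by (subst dyadic_add_left) (auto simp: sum_negf)
  have B: "dyadic n (unit_fun 1) ?b * dyadic n (unit_fun 1) (\<lambda>m. - ?b m) = 1\<^sub>m n" using n by (subst dyadic_add_right) auto
  have "test_mat n s * test_inv n s = dyadic n ?a (unit_fun 0) * (dyadic n (unit_fun 1) ?b * (dyadic n (unit_fun 1) (\<lambda>m. - ?b m) * dyadic n (\<lambda>m. - ?a m) (unit_fun 0)))"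
    unfolding test_mat_def test_inv_def by (simp add: assoc_mult_mat[of _ n n _ n _ n])
  then show ?thesis using A mat_cancel[OF B dyadic_carrier dyadic_carrier dyadic_carrier] by simp
qed

lemma test_mat_col: "n \<ge> 2 \<Longrightarrow> i < n \<Longrightarrow> test_mat n s $$ (i, 0) = (of_int (omega s i) :: 'a::comm_ring_1)"
proof -
  assume n: "n \<ge> 2" and i: "i < n"
  have "(\<Sum>m<n. unit_fun 0 m * unit_fun 1 m) = (0 :: 'a)" using n by (subst sum_unit_fun) (auto simp: unit_fun_def)
  then show ?thesis unfolding test_mat_def using n i by (subst dyadic_mult_dyadic) (auto simp: unit_fun_def omega_def)
qed

lemma test_inv_row:
  assumes n: "n \<ge> 2" and i: "i < n"
  shows "test_inv n s $$ (1, i) = (of_int (zeta n s i) :: 'a::comm_ring_1)"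
proof -
  let ?a = "\<lambda>m. if m = 0 then 0 else of_int s ^ m :: 'a" and ?b = "\<lambda>m. if m < 2 then 0 else - (of_int s ^ (m - 1)) :: 'a"
  have 1: "1 < n" using n by simp
  have "(\<Sum>m<n. - ?b m * dyadic n (\<lambda>m. - ?a m) (unit_fun 0) $$ (m, i))
      = (\<Sum>m<n. ((if i = m then 1 else 0) + unit_fun 0 i * (- ?a m)) * (- ?b m))"
    using i by (intro sum.cong) (auto simp: dyadic_index algebra_simps)
  also have "\<dots> = - ?b i + unit_fun 0 i * (\<Sum>m<n. - ?a m * - ?b m)" by (rule sum_delta_left[OF i])
  also have "(\<Sum>m<n. - ?a m * - ?b m) = - (\<Sum>m = 2..<n. of_int s ^ (2 * m - 1))"
  proof -
    have "(\<Sum>m<n. - ?a m * - ?b m) = (\<Sum>m = 2..<n. - ?a m * - ?b m)"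
      by (rule sum.mono_neutral_right) auto
    also have "\<dots> = (\<Sum>m = 2..<n. - (of_int s ^ (2 * m - 1)))"
    proof (rule sum.cong)
      fix m assume "m \<in> {2..<n}"
      then have "m + (m - 1) = 2 * m - 1" "2 \<le> m" by auto
      then show "- ?a m * - ?b m = - (of_int s ^ (2 * m - 1))" by (simp flip: power_add)
    qed simp
    finally show ?thesis by (simp add: sum_negf)
  qed
  finally have S: "(\<Sum>m<n. - ?b m * dyadic n (\<lambda>m. - ?a m) (unit_fun 0) $$ (m, i))
      = - ?b i + unit_fun 0 i * - (\<Sum>m = 2..<n. of_int s ^ (2 * m - 1))" .
  have "test_inv n s $$ (1, i) = dyadic n (\<lambda>m. - ?a m) (unit_fun 0) $$ (1, i) + unit_fun 1 1 *
      (\<Sum>m<n. - ?b m * dyadic n (\<lambda>m. - ?a m) (unit_fun 0) $$ (m, i))"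
    unfolding test_inv_def by (rule dyadic_mult_index[OF dyadic_carrier 1 i])
  also have "\<dots> = (if i = 1 then 1 else 0) - of_int s * unit_fun 0 i - ?b i
      - unit_fun 0 i * (\<Sum>m = 2..<n. of_int s ^ (2 * m - 1))"
    unfolding S using 1 i by (simp add: dyadic_index) (simp add: unit_fun_def)
  also have "\<dots> = of_int (zeta n s i)"
  proof -
    have "(\<Sum>m = 1..<n. of_int s ^ (2 * m - 1)) = of_int s + (\<Sum>m = 2..<n. of_int s ^ (2 * m - 1) :: 'a)"
      using 1 by (subst sum.atLeast_Suc_lessThan) (auto simp: numeral_2_eq_2)
    then show ?thesis by (cases "i = 0"; cases "i = 1") (auto simp: zeta_def unit_fun_def)
  qed
  finally show ?thesis .
qed

text \<open>A polynomial function on the integers of degree at most \<open>d\<close> with coefficient \<open>c\<close> at degree \<open>d\<close>, where \<open>c = 0\<close> is allowed.\<close>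

definition polyfun :: "nat \<Rightarrow> 'f::field \<Rightarrow> (int \<Rightarrow> 'f) \<Rightarrow> bool" where
  "polyfun d c f \<longleftrightarrow> (\<exists>p. degree p \<le> d \<and> coeff p d = c \<and> (\<forall>t. f t = poly p (of_int t)))"

lemma polyfun_const: "polyfun 0 c (\<lambda>_. c)"
  unfolding polyfun_def by (intro exI[of _ "[:c:]"]) auto

lemma polyfun_linear: "polyfun 1 c (\<lambda>t. b + of_int t * c)"
  unfolding polyfun_def by (intro exI[of _ "[:b, c:]"]) auto

lemma polyfun_mult:
  assumes "polyfun d c f" "polyfun d' c' f'"
  shows "polyfun (d + d') (c * c') (\<lambda>t. f t * f' t)"
proof -
  obtain p where p: "degree p \<le> d" "coeff p d = c" "\<forall>t. f t = poly p (of_int t)" using assms(1) polyfun_def by blast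
  obtain p' where p': "degree p' \<le> d'" "coeff p' d' = c'" "\<forall>t. f' t = poly p' (of_int t)" using assms(2) polyfun_def by blast
  have "coeff (p * p') (d + d') = c * c'"
  proof -
    have "coeff (p * p') (d + d') = (\<Sum>i\<le>d + d'. coeff p i * coeff p' (d + d' - i))" by (rule coeff_mult)
    also have "\<dots> = (\<Sum>i\<in>{d}. coeff p i * coeff p' (d + d' - i))"
    proof (rule sum.mono_neutral_right)
      show "\<forall>i\<in>{..d + d'} - {d}. coeff p i * coeff p' (d + d' - i) = 0"
      proof
        fix i assume "i \<in> {..d + d'} - {d}"
        then have "i > d \<or> d + d' - i > d'" by auto
        then show "coeff p i * coeff p' (d + d' - i) = 0"
          using p(1) p'(1) by (metis coeff_eq_0 le_less_trans mult_zero_left mult_zero_right)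
      qed
    qed auto
    finally show ?thesis using p p' by simp
  qed
  moreover have "degree (p * p') \<le> d + d'" using degree_mult_le[of p p'] p(1) p'(1) by linarith
  ultimately show ?thesis unfolding polyfun_def using p(3) p'(3) by (intro exI[of _ "p * p'"]) auto
qed

lemma polyfun_sum:
  assumes "\<And>i. i \<in> I \<Longrightarrow> polyfun d (c i) (f i)" "finite I"
  shows "polyfun d (\<Sum>i\<in>I. c i) (\<lambda>t. \<Sum>i\<in>I. f i t)"
proof -
  have "\<forall>i\<in>I. \<exists>p. degree p \<le> d \<and> coeff p d = c i \<and> (\<forall>t. f i t = poly p (of_int t))"
    using assms(1) by (auto simp: polyfun_def)
  then obtain p where p: "\<forall>i\<in>I. degree (p i) \<le> d \<and> coeff (p i) d = c i \<and> (\<forall>t. f i t = poly (p i) (of_int t))"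
    by metis
  then have "degree (\<Sum>i\<in>I. p i) \<le> d" using assms(2) by (intro degree_sum_le) auto
  then show ?thesis unfolding polyfun_def using p
    by (intro exI[of _ "\<Sum>i\<in>I. p i"]) (auto simp: coeff_sum poly_sum intro!: sum.cong)
qed

lemma polyfun_cmult: "polyfun d c f \<Longrightarrow> polyfun d (c * a) (\<lambda>t. f t * a)"
  using polyfun_mult[OF _ polyfun_const] by fastforce

lemma polyfun_infinite_range:
  fixes f :: "int \<Rightarrow> 'f::field"
  assumes char: "inj (of_int :: int \<Rightarrow> 'f)" and f: "polyfun d c f" "d > 0" "c \<noteq> 0" and n: "n > 0"
  shows "infinite (range (\<lambda>t. f t ^ n))"
proof
  assume fin: "finite (range (\<lambda>t. f t ^ n))"
  obtain p where p: "degree p \<le> d" "coeff p d = c" "\<forall>t. f t = poly p (of_int t)" using f(1) polyfun_def by blast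
  have deg: "degree p = d" using p f(3) le_degree[of p d] by auto
  have fv: "finite ((\<lambda>t. f t ^ n) -` {v})" for v
  proof -
    have "p ^ n \<noteq> [:v:]"
    proof
      assume "p ^ n = [:v:]"
      then have "degree (p ^ n) = 0" by simp
      moreover have "degree (p ^ n) = n * d" using deg f by (subst degree_power_eq) auto
      ultimately show False using f n by simp
    qed
    then have "p ^ n - [:v:] \<noteq> 0" by simp
    then have "finite {x. poly (p ^ n - [:v:]) x = 0}" by (rule poly_roots_finite)
    then have "finite (of_int -` {x. poly (p ^ n - [:v:]) x = 0} :: int set)"
      using char by (rule finite_vimageI)
    moreover have "(\<lambda>t. f t ^ n) -` {v} \<subseteq> of_int -` {x. poly (p ^ n - [:v:]) x = 0}"
      using p(3) by auto
    ultimately show ?thesis by (rule rev_finite_subset)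
  qed
  have "(UNIV :: int set) = (\<Union>v\<in>range (\<lambda>t. f t ^ n). (\<lambda>t. f t ^ n) -` {v})" by auto
  also have "finite \<dots>" using fin fv by blast
  finally show False by simp
qed

section \<open>Infinitely many twisted conjugacy classes\<close>

text \<open>The product \<open>x \<phi>(x) \<dots> \<phi>\<^sup>k\<^sup>-\<^sup>1(x)\<close>.\<close>

primrec twisted_norm :: "nat \<Rightarrow> ('a::comm_ring_1 mat \<Rightarrow> 'a mat) \<Rightarrow> nat \<Rightarrow> 'a mat \<Rightarrow> 'a mat" where
  "twisted_norm n \<phi> 0 x = 1\<^sub>m n"
| "twisted_norm n \<phi> (Suc k) x = twisted_norm n \<phi> k x * (\<phi> ^^ k) x"

text \<open>Entries of the product of the rank one matrices \<open>p\<^sub>k q\<^sub>k\<^sup>T\<close>.\<close>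

primrec lead_entry :: "nat \<Rightarrow> (nat \<Rightarrow> nat \<Rightarrow> 'f::field) \<Rightarrow> (nat \<Rightarrow> nat \<Rightarrow> 'f) \<Rightarrow> nat \<Rightarrow> nat \<Rightarrow> nat \<Rightarrow> 'f" where
  "lead_entry n p q 0 i j = (if i = j then 1 else 0)"
| "lead_entry n p q (Suc K) i j = (\<Sum>m<n. lead_entry n p q K i m * (p K m * q K j))"

lemma lead_entry_Suc:
  assumes "i < n" "j < n"
  shows "lead_entry n p q (Suc K) i j = p 0 i * (\<Prod>k<K. \<Sum>m<n. q k m * p (Suc k) m) * q K j"
  using assms(2)
proof (induction K arbitrary: j)
  case 0
  have "(\<Sum>m<n. (if i = m then 1 else 0) * (p 0 m * q 0 j)) = (\<Sum>m<n. if m = i then p 0 m * q 0 j else 0)"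
    by (rule sum.cong) auto
  then show ?case using assms(1) by simp
next
  case (Suc K)
  have "lead_entry n p q (Suc (Suc K)) i j
      = (\<Sum>m<n. p 0 i * (\<Prod>k<K. \<Sum>m<n. q k m * p (Suc k) m) * q K m * (p (Suc K) m * q (Suc K) j))"
    using Suc.IH unfolding lead_entry.simps(2)[of n p q "Suc K"] by (intro sum.cong) auto
  also have "\<dots> = p 0 i * (\<Prod>k<K. \<Sum>m<n. q k m * p (Suc k) m) * (\<Sum>m<n. q K m * p (Suc K) m) * q (Suc K) j"
    unfolding sum_distrib_left sum_distrib_right by (rule sum.cong) (auto simp: mult_ac)
  finally show ?case by (simp add: mult_ac)
qed

lemma sandwich_rank_one:
  assumes g: "g \<in> carrier_mat n n" "g' \<in> carrier_mat n n" and B: "B \<in> carrier_mat n n" "N \<in> carrier_mat n n"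
    and N: "\<And>i j. i < n \<Longrightarrow> j < n \<Longrightarrow> N $$ (i, j) = B $$ (i, j) + \<tau> * (U i * unit_fun v j)"
    and v: "v < n" and ij: "i < n" "j < n"
  shows "(g * N * g') $$ (i, j) = (g * B * g') $$ (i, j)
    + \<tau> * ((\<Sum>m<n. g $$ (i, m) * U m) * g' $$ (v, j) :: 'f::comm_ring_1)"
proof -
  have gN: "(g * N) $$ (i, l) = (g * B) $$ (i, l) + \<tau> * (\<Sum>m<n. g $$ (i, m) * U m) * unit_fun v l" if "l < n" for l
    unfolding index_mult_mat_sum[OF g(1) B(1) ij(1) that] index_mult_mat_sum[OF g(1) B(2) ij(1) that]
      sum_distrib_left sum_distrib_right sum.distrib[symmetric]
    by (rule sum.cong) (use N that in \<open>auto simp: algebra_simps\<close>)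
  have "(g * N * g') $$ (i, j) = (\<Sum>l<n. (g * N) $$ (i, l) * g' $$ (l, j))"
    using g B ij by (intro index_mult_mat_sum) auto
  also have "\<dots> = (\<Sum>l<n. (g * B) $$ (i, l) * g' $$ (l, j)
      + \<tau> * (\<Sum>m<n. g $$ (i, m) * U m) * (unit_fun v l * g' $$ (l, j)))"
    by (rule sum.cong) (auto simp: gN algebra_simps)
  also have "\<dots> = (\<Sum>l<n. (g * B) $$ (i, l) * g' $$ (l, j)) + \<tau> * (\<Sum>m<n. g $$ (i, m) * U m) * g' $$ (v, j)"
    using v by (simp add: sum.distrib flip: sum_distrib_left)
  also have "(\<Sum>l<n. (g * B) $$ (i, l) * g' $$ (l, j)) = (g * B * g') $$ (i, j)"
    using g B ij by (intro index_mult_mat_sum[symmetric]) auto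
  finally show ?thesis by (simp add: mult.assoc)
qed

lemma invertible_row_nonzero:
  assumes "M \<in> carrier_mat n n" "M' \<in> carrier_mat n n" "M * M' = (1\<^sub>m n :: 'f::field mat)" "v < n"
  shows "\<exists>r<n. M $$ (v, r) \<noteq> 0"
proof (rule ccontr)
  assume "\<not> ?thesis"
  then have "(M * M') $$ (v, v) = 0"
    unfolding index_mult_mat_sum[OF assms(1,2,4,4)] by (intro sum.neutral) auto
  then show False using assms by simp
qed

lemma sum_row_mult:
  assumes "A \<in> carrier_mat n n" "B \<in> carrier_mat n n" "v < n"
  shows "(\<Sum>m<n. A $$ (v, m) * (\<Sum>r<n. B $$ (m, r) * U r)) = (\<Sum>r<n. (A * B) $$ (v, r) * (U r :: 'f::comm_ring_1))"
proof -
  have "(\<Sum>m<n. A $$ (v, m) * (\<Sum>r<n. B $$ (m, r) * U r)) = (\<Sum>m<n. \<Sum>r<n. A $$ (v, m) * B $$ (m, r) * U r)"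
    by (simp add: sum_distrib_left mult.assoc)
  also have "\<dots> = (\<Sum>r<n. \<Sum>m<n. A $$ (v, m) * B $$ (m, r) * U r)" by (rule sum.swap)
  also have "\<dots> = (\<Sum>r<n. (A * B) $$ (v, r) * U r)"
    by (rule sum.cong) (use assms in \<open>simp_all add: index_mult_mat_sum[OF assms(1,2)] sum_distrib_right\<close>)
  finally show ?thesis .
qed

lemma fract_char0: "inj (of_int :: int \<Rightarrow> 'a::idom) \<Longrightarrow> inj (of_int :: int \<Rightarrow> 'a fract)"
  by (metis injI injD to_fract_of_int to_fract_eq_iff)

context linear_group
begin

lemma twisted_norm_closed:
  assumes "\<phi> \<in> iso G G" "x \<in> carrier G" shows "twisted_norm n \<phi> k x \<in> carrier G"
proof (induction k)
  case 0 then show ?case by (simp add: special_sub)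
next
  case (Suc k)
  have "(\<phi> ^^ k) x \<in> carrier G"
    using iso_funpow[OF assms(1), of k] assms(2) hom_facts(1) by (auto simp: iso_def)
  then show ?case using Suc by simp
qed

text \<open>The inner factors telescope.\<close>

lemma twisted_norm_conj:
  assumes \<phi>: "\<phi> \<in> iso G G" and c: "c \<in> carrier G" and y: "y \<in> carrier G" and x: "x = c * y * \<phi> (minv c)"
  shows "twisted_norm n \<phi> k x = c * twisted_norm n \<phi> k y * (\<phi> ^^ k) (minv c)"
proof (induction k)
  case 0 then show ?case using c carrier_dim[OF c] by simp
next
  case (Suc k)
  have h: "\<phi> ^^ k \<in> hom G G" using iso_funpow[OF \<phi>] by (simp add: iso_def)
  have h1: "\<phi> \<in> hom G G" using \<phi> by (simp add: iso_def)
  let ?f = "\<phi> ^^ k"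
  have G: "\<phi> (minv c) \<in> carrier G" "c * y \<in> carrier G" using c y hom_facts(1)[OF h1] by auto
  have fx: "?f x = ?f c * ?f y * (\<phi> ^^ Suc k) (minv c)"
    unfolding x hom_facts(2)[OF h G(2,1)] hom_facts(2)[OF h c y]
    by (simp add: funpow_Suc_right del: funpow.simps(2))
  have d: "c \<in> carrier_mat n n" "twisted_norm n \<phi> k y \<in> carrier_mat n n" "?f (minv c) \<in> carrier_mat n n"
    "?f c \<in> carrier_mat n n" "?f y \<in> carrier_mat n n" "(\<phi> ^^ Suc k) (minv c) \<in> carrier_mat n n"
    using c y twisted_norm_closed[OF \<phi> y] hom_facts(1)[OF h] hom_facts(1)[OF h1]
    by (simp_all add: carrier_dim)
  have inv: "?f (minv c) * ?f c = 1\<^sub>m n"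
    using hom_facts(2)[OF h minv(1)[OF c] c, symmetric] hom_facts(3)[OF h] c by simp
  have "twisted_norm n \<phi> (Suc k) x = c * twisted_norm n \<phi> k y * ?f (minv c) * (?f c * ?f y * (\<phi> ^^ Suc k) (minv c))"
    using Suc fx by simp
  also have "\<dots> = c * (twisted_norm n \<phi> k y * ?f y) * (\<phi> ^^ Suc k) (minv c)"
    using d by (simp add: assoc_mult_mat[of _ n n _ n _ n] mat_cancel[OF inv] del: funpow.simps(2))
  finally show ?case by (simp del: funpow.simps(2))
qed

lemma twisted_norm_polyfun:
  assumes \<phi>: "\<phi> \<in> iso G G" and x: "\<And>t. x t \<in> carrier G"
    and e: "\<And>k i j t. k < K \<Longrightarrow> i < n \<Longrightarrow> j < n \<Longrightarrow>
      emb ((\<phi> ^^ k) (x t)) $$ (i, j) = \<beta> k i j + of_int t * (p k i * q k j)"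
    and ij: "i < n" "j < n"
  shows "polyfun K (lead_entry n p q K i j) (\<lambda>t. emb (twisted_norm n \<phi> K (x t)) $$ (i, j))"
  using e ij
proof (induction K arbitrary: i j)
  case 0
  have "emb (twisted_norm n \<phi> 0 (x t)) $$ (i, j) = lead_entry n p q 0 i j" for t
    using 0 fract_hom.mat_hom_one[of n] by simp
  then show ?case using polyfun_const[of "lead_entry n p q 0 i j"] by simp
next
  case (Suc K)
  have c: "emb (twisted_norm n \<phi> K (x t)) \<in> carrier_mat n n" "emb ((\<phi> ^^ K) (x t)) \<in> carrier_mat n n" for t
    using twisted_norm_closed[OF \<phi> x] iso_funpow[OF \<phi>, of K] hom_facts(1)[of "\<phi> ^^ K"] x
    by (auto simp: carrier_dim iso_def)
  have "emb (twisted_norm n \<phi> (Suc K) (x t)) $$ (i, j)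
      = (\<Sum>m<n. emb (twisted_norm n \<phi> K (x t)) $$ (i, m) * (\<beta> K m j + of_int t * (p K m * q K j)))" for t
  proof -
    have "emb (twisted_norm n \<phi> (Suc K) (x t)) = emb (twisted_norm n \<phi> K (x t)) * emb ((\<phi> ^^ K) (x t))"
      using twisted_norm_closed[OF \<phi> x] iso_funpow[OF \<phi>, of K] hom_facts(1)[of "\<phi> ^^ K"] x
      by (auto simp: iso_def intro!: emb_mult)
    then show ?thesis
      unfolding index_mult_mat_sum[OF c Suc.prems(2,3), symmetric]
      using index_mult_mat_sum[OF c Suc.prems(2,3), of t t] Suc.prems(1)[of K _ j t] Suc.prems(3) by simp
  qed
  moreover have "polyfun (K + 1) (\<Sum>m<n. lead_entry n p q K i m * (p K m * q K j))
      (\<lambda>t. \<Sum>m<n. emb (twisted_norm n \<phi> K (x t)) $$ (i, m) * (\<beta> K m j + of_int t * (p K m * q K j)))"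
    using Suc.prems by (intro polyfun_sum polyfun_mult polyfun_linear Suc.IH) auto
  ultimately show ?case by simp
qed

text \<open>The vectors \<open>omega\<close> and \<open>zeta\<close> are integral and hence fixed by \<open>\<sigma>\<close>. Transposition and inversion turn the perturbation by \<open>t\<close> in column 1 into one in column 0.\<close>

lemma standard_test_entries:
  fixes s t :: int
  assumes st: "standard \<psi> b g g' \<sigma>" and ij: "i < n" "j < n"
  defines "U \<equiv> \<lambda>m. if b then of_int (omega s m) else - of_int (zeta n s m)"
  shows "emb (\<psi> (test_mat n s * elem n 0 1 (of_int t))) $$ (i, j) = std_image b g g' \<sigma> (test_mat n s) $$ (i, j)
    + of_int t * ((\<Sum>m<n. g $$ (i, m) * U m) * g' $$ (if b then 1 else 0, j))"
proof -
  note s = standardD[OF st]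
  interpret \<sigma>: comm_ring_hom \<sigma> using ring_endo_hom s(6) .
  have n: "n \<ge> 2" "0 < n" "1 < n" using n3 by auto
  let ?y = "test_mat n s :: 'a mat" and ?e = "elem n 0 1 (of_int t) :: 'a mat" and ?v = "if b then 1 else 0 :: nat"
  have EL: "?y \<in> elementary n" "?e \<in> elementary n" by (rule test_mat_elementary[OF n(1)], rule elementary_elem) (use n in auto)
  have G: "?y \<in> carrier G" "?e \<in> carrier G" using EL elementary_G by auto
  have inv: "minv ?y = test_inv n s"
    using special_inverse_unique[OF elementary_special[OF EL(1)] elementary_carrier[OF test_inv_elementary[OF n(1)]] test_mat_test_inv[OF n(1)]]
      minv_special[OF elementary_special[OF EL(1)]] by simp
  have \<sigma>i: "\<sigma> (of_int z) = of_int z" for z by (simp add: hom_distribs)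
  have entry: "contra b (?y * ?e) $$ (k, l) = contra b ?y $$ (k, l) + of_int t *
      ((if b then of_int (omega s k) else - of_int (zeta n s k)) * unit_fun ?v l)" if kl: "k < n" "l < n" for k l
  proof (cases b)
    case True
    have "(?y * ?e) $$ (k, l) = ?y $$ (k, l) + (if l = 1 then ?y $$ (k, 0) * of_int t else 0)"
      by (rule mult_elem_index[OF carrier_dim[OF G(1)] kl n(2)])
    moreover have "?y $$ (k, 0) = of_int (omega s k)" by (rule test_mat_col[OF n(1) kl(1)])
    ultimately show ?thesis using True by (simp add: contra_def unit_fun_def)
  next
    case False
    have c: "contra b ?y \<in> carrier_mat n n" using G by simp
    have "contra b (?y * ?e) = contra b ?y * elem n 1 0 (- of_int t)"
      using contra_mult[OF G] False n by (simp add: contra_elem)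
    then have "contra b (?y * ?e) $$ (k, l) = contra b ?y $$ (k, l) + (if l = 0 then contra b ?y $$ (k, 1) * - of_int t else 0)"
      using mult_elem_index[OF c kl n(3)] by simp
    moreover have "contra b ?y $$ (k, 1) = of_int (zeta n s k)"
      using False inv kl n test_inv_row[OF n(1) kl(1), of s] carrier_dim[OF minv(1)[OF G(1)]] by (simp add: contra_def)
    ultimately show ?thesis using False by (simp add: unit_fun_def)
  qed
  have "emb (\<psi> (?y * ?e)) = std_image b g g' \<sigma> (?y * ?e)" using s(7) elementary_mult EL by blast
  also have "std_image b g g' \<sigma> (?y * ?e) $$ (i, j) = std_image b g g' \<sigma> ?y $$ (i, j)
      + of_int t * ((\<Sum>m<n. g $$ (i, m) * U m) * g' $$ (?v, j))"
    unfolding std_image_def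
  proof (rule sandwich_rank_one[OF s(2,3) _ _ _ _ ij])
    show "emb (map_mat \<sigma> (contra b ?y)) \<in> carrier_mat n n" "emb (map_mat \<sigma> (contra b (?y * ?e))) \<in> carrier_mat n n"
      using G by simp_all
    show "?v < n" using n by simp
    fix k l assume kl: "k < n" "l < n"
    have d: "dim_row (contra b ?y) = n" "dim_col (contra b ?y) = n" "dim_row (contra b (?y * ?e)) = n" "dim_col (contra b (?y * ?e)) = n"
      using contra_carrier[OF G(1), of b] contra_carrier[OF mult_closed[OF G], of b] by auto
    have unit_val': "to_fract (\<sigma> (unit_fun ?v l)) = unit_fun ?v l" by (simp add: unit_fun_def)
    have U': "to_fract (\<sigma> (if b then of_int (omega s k) else - of_int (zeta n s k))) = U k"
      by (simp add: U_def hom_distribs \<sigma>i to_fract_of_int)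
    have entry': "to_fract (\<sigma> (contra b (?y * ?e) $$ (k, l)))
        = to_fract (\<sigma> (contra b ?y $$ (k, l))) + of_int t * (U k * unit_fun ?v l)"
      unfolding entry[OF kl] \<sigma>.hom_add \<sigma>.hom_mult \<sigma>i to_fract_add to_fract_mult to_fract_of_int unit_val' U' ..
    show "emb (map_mat \<sigma> (contra b (?y * ?e))) $$ (k, l)
        = emb (map_mat \<sigma> (contra b ?y)) $$ (k, l) + of_int t * (U k * unit_fun ?v l)"
      using kl d entry' by simp
  qed
  finally show ?thesis .
qed

text \<open>Each factor is conjugate over the fraction field to a determinant one matrix.\<close>

lemma det_twisted_norm:
  assumes \<phi>: "\<phi> \<in> iso G G" and x: "x \<in> elementary n"
  shows "det (emb (twisted_norm n \<phi> k x)) = 1"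
proof (induction k)
  case 0 then show ?case by (simp add: fract_hom.mat_hom_one)
next
  case (Suc k)
  have xG: "x \<in> carrier G" using elementary_G x by blast
  obtain b g g' \<sigma> where st: "standard (\<phi> ^^ k) b g g' \<sigma>" using standard_exists[OF iso_funpow[OF \<phi>]] by blast
  note s = standardD[OF st]
  interpret \<sigma>: comm_ring_hom \<sigma> using ring_endo_hom s(6) .
  have "contra b x \<in> elementary n" using x by (simp add: contra_def elementary_transpose minv_elementary)
  then have "det (contra b x) = 1" using elementary_special[of "contra b x" n] unfolding special_def by simp
  then have 1: "det (emb (map_mat \<sigma> (contra b x))) = 1" by simp
  have "det g * det g' = 1" using s(4) det_mult[OF s(2,3)] by simp
  then have "det (emb ((\<phi> ^^ k) x)) = 1"
    unfolding s(7)[OF x] std_image_def using s(2,3) xG 1 by (simp add: det_mult[of _ n])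
  moreover have "det (emb (twisted_norm n \<phi> (Suc k) x)) = det (emb (twisted_norm n \<phi> k x)) * det (emb ((\<phi> ^^ k) x))"
    using twisted_norm_closed[OF \<phi> xG] hom_facts(1)[OF s(1) xG]
    by (simp add: emb_mult det_mult[of _ n] carrier_dim)
  ultimately show ?case using Suc by simp
qed

text \<open>The relation of \<open>twisted_norm_conj\<close> reads \<open>N(x) h = \<chi> C (N(y) h) C\<^sup>-\<^sup>1\<close> with a scalar \<open>\<chi>\<close>, and \<open>\<chi>\<^sup>n = 1\<close> by determinants.\<close>

lemma class_invariant:
  assumes \<phi>: "\<phi> \<in> iso G G" and st: "standard (\<phi> ^^ L) True h h' id"
    and xy: "x \<in> elementary n" "y \<in> elementary n" and c: "c \<in> carrier G" "x = c * y * \<phi> (minv c)"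
  shows "mtrace (emb (twisted_norm n \<phi> L x) * h) ^ n = mtrace (emb (twisted_norm n \<phi> L y) * h) ^ n"
proof -
  note s = standardD[OF st]
  have G: "x \<in> carrier G" "y \<in> carrier G" "minv c \<in> carrier G" using xy elementary_G c by auto
  let ?X = "emb (twisted_norm n \<phi> L x)" and ?Y = "emb (twisted_norm n \<phi> L y)" and ?C = "emb c" and ?C' = "emb (minv c)"
  have d: "?X \<in> carrier_mat n n" "?Y \<in> carrier_mat n n" "?C \<in> carrier_mat n n" "?C' \<in> carrier_mat n n"
    using twisted_norm_closed[OF \<phi>] G c by (simp_all add: carrier_dim)
  have CC: "?C' * ?C = 1\<^sub>m n" "?C * ?C' = 1\<^sub>m n"
    using emb_mult[OF G(3) c(1), symmetric] emb_mult[OF c(1) G(3), symmetric] c(1) fract_hom.mat_hom_one[of n] by simp_all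
  obtain \<chi> where \<chi>: "emb ((\<phi> ^^ L) (minv c)) = \<chi> \<cdot>\<^sub>m std_image True h h' id (minv c)"
    using standard_up_to_scalar[OF st G(3)] by blast
  have "map_mat id A = A" for A :: "'a mat" by (rule eq_matI) auto
  then have M: "std_image True h h' id (minv c) = h * ?C' * h'" by (simp add: std_image_def contra_def)
  have "?X = ?C * ?Y * emb ((\<phi> ^^ L) (minv c))"
    unfolding twisted_norm_conj[OF \<phi> c(1) G(2) c(2)] using c(1) twisted_norm_closed[OF \<phi> G(2)] hom_facts(1)[OF s(1) G(3)]
    by (simp add: emb_mult)
  then have "?X * h = ?C * ?Y * (\<chi> \<cdot>\<^sub>m (h * ?C' * h')) * h" unfolding \<chi> M by simp
  also have "\<dots> = \<chi> \<cdot>\<^sub>m (?C * ?Y * (h * ?C' * h') * h)"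
    using d s(2,3) by (simp add: mult_smult_assoc_mat[of _ n n _ n] mult_smult_distrib[of _ n n _ n])
  also have "?C * ?Y * (h * ?C' * h') * h = ?C * (?Y * h) * ?C'"
    using d s(2,3,5) by (simp add: assoc_mult_mat[of _ n n _ n _ n])
  finally have eq: "?X * h = \<chi> \<cdot>\<^sub>m (?C * (?Y * h) * ?C')" .
  have dC: "det ?C * det ?C' = 1" using det_mult[OF d(3,4)] CC by simp
  have "det h * det h' = 1" using det_mult[OF s(2,3)] s(4) by simp
  then have dh: "det h \<noteq> 0" by auto
  have "det (?X * h) = det h" using d(1) s(2) det_twisted_norm[OF \<phi> xy(1)] by (simp add: det_mult[of _ n])
  moreover have "det (?C * (?Y * h) * ?C') = det h"
    using d s(2) det_twisted_norm[OF \<phi> xy(2)] dC by (simp add: det_mult[of _ n] mult_ac)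
  ultimately have "\<chi> ^ n = 1" using eq dh d s(2) by simp
  moreover have "mtrace (\<chi> \<cdot>\<^sub>m A) = \<chi> * mtrace A" if "A \<in> carrier_mat n n" for A
    using that by (auto simp: mtrace_def sum_distrib_left)
  then have "mtrace (?X * h) = \<chi> * mtrace (?Y * h)"
    unfolding eq using d s(2) CC by (simp add: mtrace_conj[of _ n])
  ultimately show ?thesis by (simp add: power_mult_distrib)
qed

text \<open>The type of \<open>\<phi>\<^sup>k\<close> and its conjugating matrix \<open>g k\<close> are arbitrary for each \<open>k < L\<close>. The integral matrix is therefore chosen generic with respect to the finitely many linear forms \<open>R k\<close> that occur in the leading coefficient.\<close>

theorem reidemeister_infinite:
  assumes tor: "torsion_group (ring_Aut TYPE('a))" and \<phi>: "\<phi> \<in> iso G G"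
  shows "infinite (twisted_conj_classes G \<phi>)"
proof
  assume fin: "finite (twisted_conj_classes G \<phi>)"
  have n: "n \<ge> 2" "0 < n" "1 < n" using n3 by auto
  note charF = fract_char0[OF char0]
  obtain L h h' where L: "L > 0" and stL: "standard (\<phi> ^^ L) True h h' id"
    using inner_power_exists[OF tor \<phi>] by blast
  note sL = standardD[OF stL]
  obtain L' where L': "L = Suc L'" using L by (cases L) auto
  have "\<forall>k. \<exists>b g g' \<sigma>. standard (\<phi> ^^ k) b g g' \<sigma>" using standard_exists[OF iso_funpow[OF \<phi>]] by blast
  then obtain b g g' \<sigma> where st: "\<And>k. standard (\<phi> ^^ k) (b k) (g k) (g' k) (\<sigma> k)" by metis
  note s = standardD[OF st]
  let ?v = "\<lambda>k. if b k then 1 else 0 :: nat"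
  have v: "?v k < n" for k using n by simp
  \<comment> \<open>The last linear form closes the cycle and involves \<open>h\<close>.\<close>
  define R where "R k = (if k < L' then (\<lambda>r. (g' k * g (Suc k)) $$ (?v k, r)) else (\<lambda>r. (g' L' * (h * g 0)) $$ (?v L', r)))" for k
  have "\<exists>r<n. R k r \<noteq> 0" for k
  proof (cases "k < L'")
    case True
    have "g' k * g (Suc k) * (g' (Suc k) * g k) = 1\<^sub>m n"
      using s(2,3,4,5) by (simp add: assoc_mult_mat[of _ n n _ n _ n] mat_cancel[OF s(4)])
    then show ?thesis
      using invertible_row_nonzero[of "g' k * g (Suc k)" n "g' (Suc k) * g k", OF _ _ _ v[of k]] s(2,3) True
      by (simp add: R_def)
  next
    case False
    have "g' L' * (h * g 0) * (g' 0 * (h' * g L')) = 1\<^sub>m n"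
      using s(2,3,4,5) sL(2,3,4) by (simp add: assoc_mult_mat[of _ n n _ n _ n] mat_cancel[OF s(4)] mat_cancel[OF sL(4)])
    then show ?thesis
      using invertible_row_nonzero[of "g' L' * (h * g 0)" n "g' 0 * (h' * g L')", OF _ _ _ v[of L']] s(2,3) sL(2,3) False
      by (simp add: R_def)
  qed
  then have "\<exists>s. \<forall>Q\<in>R ` {..L'}. (\<Sum>r<n. Q r * of_int (omega s r)) \<noteq> 0 \<and> (\<Sum>r<n. Q r * of_int (zeta n s r)) \<noteq> 0"
    by (intro generic_parameter[OF charF n(1)]) auto
  then obtain z where z: "\<And>k. k \<le> L' \<Longrightarrow> (\<Sum>r<n. R k r * of_int (omega z r)) \<noteq> 0"
    "\<And>k. k \<le> L' \<Longrightarrow> (\<Sum>r<n. R k r * of_int (zeta n z r)) \<noteq> 0" by auto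
  define U :: "nat \<Rightarrow> nat \<Rightarrow> 'a fract" where
    "U k = (\<lambda>m. if b k then of_int (omega z m) else - of_int (zeta n z m))" for k
  have RU: "(\<Sum>r<n. R k r * U k' r) \<noteq> 0" if "k \<le> L'" for k k'
    using z[OF that] by (cases "b k'") (simp_all add: U_def sum_negf)
  define x :: "int \<Rightarrow> 'a mat" where "x t = test_mat n z * elem n 0 1 (of_int t)" for t
  have xEL: "x t \<in> elementary n" for t unfolding x_def using n by (intro elementary_mult test_mat_elementary elementary_elem) auto
  have xG: "x t \<in> carrier G" for t using xEL elementary_G by blast
  \<comment> \<open>The coefficient of \<open>t\<close> in \<open>\<phi>\<^sup>k(x\<^sub>t)\<close> is the rank one matrix \<open>p k i * q k j\<close>.\<close>
  define p where "p k i = (\<Sum>m<n. g k $$ (i, m) * U k m)" for k i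
  define q where "q k j = g' k $$ (?v k, j)" for k j
  have entries: "emb ((\<phi> ^^ k) (x t)) $$ (i, j)
      = std_image (b k) (g k) (g' k) (\<sigma> k) (test_mat n z) $$ (i, j) + of_int t * (p k i * q k j)"
    if "i < n" "j < n" for k i j t
    unfolding x_def p_def q_def U_def by (rule standard_test_entries[OF st that])
  define F where "F t = mtrace (emb (twisted_norm n \<phi> L (x t)) * h)" for t
  define c where "c = (\<Sum>i<n. \<Sum>j<n. lead_entry n p q L i j * h $$ (j, i))"
  have "polyfun L c (\<lambda>t. \<Sum>i<n. \<Sum>j<n. emb (twisted_norm n \<phi> L (x t)) $$ (i, j) * h $$ (j, i))"
    unfolding c_def by (intro polyfun_sum polyfun_cmult twisted_norm_polyfun[OF \<phi> xG entries]) auto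
  moreover have "F t = (\<Sum>i<n. \<Sum>j<n. emb (twisted_norm n \<phi> L (x t)) $$ (i, j) * h $$ (j, i))" for t
  proof -
    have d: "emb (twisted_norm n \<phi> L (x t)) \<in> carrier_mat n n"
      using twisted_norm_closed[OF \<phi> xG] by (simp add: carrier_dim)
    then show ?thesis
      unfolding F_def mtrace_def using sL(2)
      by (auto intro!: sum.cong simp: index_mult_mat_sum[OF d sL(2)] simp del: index_map_mat(1))
  qed
  ultimately have F: "polyfun L c F" by presburger
  have "c = (\<Prod>k<L'. \<Sum>m<n. q k m * p (Suc k) m) * (\<Sum>j<n. q L' j * (\<Sum>i<n. h $$ (j, i) * p 0 i))"
  proof -
    have "c = (\<Sum>i<n. \<Sum>j<n. (\<Prod>k<L'. \<Sum>m<n. q k m * p (Suc k) m) * (q L' j * (h $$ (j, i) * p 0 i)))"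
      unfolding c_def L' by (intro sum.cong refl) (simp add: lead_entry_Suc mult_ac del: lead_entry.simps)
    also have "\<dots> = (\<Sum>j<n. \<Sum>i<n. (\<Prod>k<L'. \<Sum>m<n. q k m * p (Suc k) m) * (q L' j * (h $$ (j, i) * p 0 i)))"
      by (rule sum.swap)
    finally show ?thesis by (simp add: sum_distrib_left)
  qed
  moreover have "(\<Sum>m<n. q k m * p (Suc k) m) \<noteq> 0" if "k < L'" for k
    using RU[of k "Suc k"] that sum_row_mult[OF s(3) s(2) v, of k k "Suc k" "U (Suc k)"]
    by (simp add: q_def p_def R_def)
  moreover have "(\<Sum>j<n. q L' j * (\<Sum>i<n. h $$ (j, i) * p 0 i)) \<noteq> 0"
  proof -
    have "(\<Sum>j<n. q L' j * (\<Sum>i<n. h $$ (j, i) * p 0 i)) = (\<Sum>j<n. q L' j * (\<Sum>r<n. (h * g 0) $$ (j, r) * U 0 r))"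
      unfolding p_def by (intro sum.cong refl) (simp add: sum_row_mult[OF sL(2) s(2)])
    also have "\<dots> = (\<Sum>r<n. R L' r * U 0 r)"
      unfolding q_def using sum_row_mult[OF s(3) mult_carrier_square[OF sL(2) s(2)] v, of L' L' 0 "U 0"]
      by (simp add: R_def)
    finally show ?thesis using RU[of L' 0] by simp
  qed
  ultimately have "c \<noteq> 0" by simp
  then have inf: "infinite (range (\<lambda>t. F t ^ n))" by (rule polyfun_infinite_range[OF charF F L _ n(2)])
  have equiv: "equiv (carrier G) (twisted_conj_rel G \<phi>)"
    using group.equiv_twisted_conj_rel[OF grp] \<phi> by (simp add: iso_def)
  let ?cl = "\<lambda>t. twisted_conj_rel G \<phi> `` {x t}"
  have inv: "F t ^ n = F t' ^ n" if "?cl t = ?cl t'" for t t'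
  proof -
    have "(x t, x t') \<in> twisted_conj_rel G \<phi>" using eq_equiv_class[OF that equiv xG] .
    then obtain d where "d \<in> carrier G" "x t = d * x t' * \<phi> (minv d)"
      by (auto simp: twisted_conj_rel_def mult_eq minv_def)
    then show ?thesis unfolding F_def by (rule class_invariant[OF \<phi> stL xEL xEL])
  qed
  have "range ?cl \<subseteq> twisted_conj_classes G \<phi>"
    using xG by (auto simp: twisted_conj_classes_def intro: quotientI)
  then have "finite (range ?cl)" using fin by (rule finite_subset)
  moreover have "range (\<lambda>t. F t ^ n) \<subseteq> (\<lambda>C. F (SOME t. ?cl t = C) ^ n) ` range ?cl"
  proof
    fix y assume "y \<in> range (\<lambda>t. F t ^ n)"
    then obtain t where t: "y = F t ^ n" by blast
    have "?cl (SOME t'. ?cl t' = ?cl t) = ?cl t" by (rule someI) simp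
    then have "F (SOME t'. ?cl t' = ?cl t) ^ n = y" using inv t by blast
    then show "y \<in> (\<lambda>C. F (SOME t. ?cl t = C) ^ n) ` range ?cl" by blast
  qed
  ultimately show False using inf finite_surj by blast
qed

corollary R_infinity:
  "torsion_group (ring_Aut TYPE('a)) \<Longrightarrow> R_infinity_property G"
  using reidemeister_infinite by (simp add: R_infinity_property_def reidemeister_number_def)

end

lemma linear_group_GL:
  assumes "n \<ge> 3" "inj (of_int :: int \<Rightarrow> 'a::idom)"
  shows "linear_group n (GL n :: 'a mat monoid)"
proof (rule linear_group.intro)
  show "n \<ge> 3" "inj (of_int :: int \<Rightarrow> 'a)" by (fact assms)+
  show "Group.group (GL n :: 'a mat monoid)" by (rule group_GL)
  fix A B :: "'a mat"
  show "A \<otimes>\<^bsub>GL n\<^esub> B = A * B" by (simp add: GL_def units_of_def ring_mat_simps)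
  show "\<one>\<^bsub>GL n\<^esub> = (1\<^sub>m n :: 'a mat)" by (simp add: GL_def units_of_def ring_mat_simps)
  show "A \<in> carrier_mat n n" if "A \<in> carrier (GL n)" using that by (simp add: carrier_GL)
  have special: "carrier (SL n) \<subseteq> carrier (GL n :: 'a mat monoid)"
    using SL_subgroup_GL subgroup.subset by blast
  show "A \<in> carrier (GL n)" if "A \<in> special n"
    using that special unfolding special_def SL_def by auto
  show "transpose_mat A \<in> carrier (GL n)" if "A \<in> carrier (GL n)"
  proof -
    have A: "A \<in> carrier_mat n n" using that by (simp add: carrier_GL)
    have "invertible_mat A" using that by (simp add: carrier_GL)
    then obtain B where B: "A * B = 1\<^sub>m n" "B * A = 1\<^sub>m (dim_row B)"
      using A by (auto simp: invertible_mat_def inverts_mat_def)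
    have "dim_col B = n" using arg_cong[OF B(1), of dim_col] by simp
    moreover have "dim_row B = n" using arg_cong[OF B(2), of dim_col] A by simp
    ultimately have Bc: "B \<in> carrier_mat n n" by auto
    have "transpose_mat A * transpose_mat B = 1\<^sub>m n" "transpose_mat B * transpose_mat A = 1\<^sub>m n"
      using B Bc unfolding transpose_mult[OF A Bc, symmetric] transpose_mult[OF Bc A, symmetric] by simp_all
    then show ?thesis
      using A Bc by (auto simp: carrier_GL invertible_mat_def inverts_mat_def intro!: exI[of _ "transpose_mat B"])
  qed
qed

lemma linear_group_SL:
  assumes "n \<ge> 3" "inj (of_int :: int \<Rightarrow> 'a::idom)"
  shows "linear_group n (SL n :: 'a mat monoid)"
proof (rule linear_group.intro)
  show "n \<ge> 3" "inj (of_int :: int \<Rightarrow> 'a)" by (fact assms)+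
  show "Group.group (SL n :: 'a mat monoid)" by (rule group_SL)
  have SL: "carrier (SL n :: 'a mat monoid) = special n" by (simp add: SL_def special_def del: special_carrier)
  fix A B :: "'a mat"
  show "A \<otimes>\<^bsub>SL n\<^esub> B = A * B" by (simp add: SL_def GL_def units_of_def ring_mat_simps)
  show "\<one>\<^bsub>SL n\<^esub> = (1\<^sub>m n :: 'a mat)" by (simp add: SL_def GL_def units_of_def ring_mat_simps)
  show "A \<in> carrier_mat n n" if "A \<in> carrier (SL n)" using that SL by simp
  show "A \<in> carrier (SL n)" if "A \<in> special n" using that SL by simp
  show "transpose_mat A \<in> carrier (SL n)" if "A \<in> carrier (SL n)"
    using that by (auto simp: SL_def det_transpose)
qed

theorem theorem2:
  fixes n :: nat
  assumes "n \<ge> 3"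
    and "inj (of_int :: int \<Rightarrow> 'a::idom)"
    and "torsion_group (ring_Aut TYPE('a))"
  shows "R_infinity_property (GL n :: 'a mat monoid) \<and>
         R_infinity_property (SL n :: 'a mat monoid)"
  using linear_group.R_infinity[OF linear_group_GL[OF assms(1,2)] assms(3)]
    linear_group.R_infinity[OF linear_group_SL[OF assms(1,2)] assms(3)] ..

end
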